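(* Let $K_0=\frac12(-\partial_x^2+x^2)$ be the harmonic oscillator on $L^2(\mathbb{R},\mathbb{C})$. There exist a time periodic pseudodifferential operator of order $0$, $V\in C^\infty_b(\mathbb{T},\mathcal{A}_0)$, and, for any $r\in\mathbb{N}$, a constant $C_r>0$ and a smooth solution $\psi(t)$ of $$ i\dot\psi=\tfrac12\left(-\partial_x^2+x^2\right)\psi+V(t,x,D_x)\psi,\qquad x\in\mathbb{R},$$ such that for any $t\ge0$ one has $\psi(t)\in\mathcal{H}^r$, and $$\|\psi(t)\|_r\ \ge\ C_r\,t^r\qquad\text{for } t \text{ large enough}.$$
   Context: $\mathbb{T}=\mathbb{R}/2\pi\mathbb{Z}$, $\mathbb{N}_0=\{0,1,2,\dots\}$. For $r\ge0$, $\mathcal{H}^r=\mathrm{Dom}(K_0^r)$ with norm $\|\psi\|_r=\|K_0^r\psi\|_{L^2}$; for $r<0$, $\mathcal{H}^r$ is the dual of $\mathcal{H}^{-r}$. Symbols: for $\rho\in\mathbb{R}$, $S^\rho_{\mathrm{ho}}$ is the set of $f\in C^\infty(\mathbb{R}_x\times\mathbb{R}_\xi,\mathbb{R})$ such that for all $\alpha,\beta\in\mathbb{N}_0$ there is $C_{\alpha,\beta}>0$ with $$|\partial_x^\alpha\partial_\xi^\beta f(x,\xi)|\le C_{\alpha,\beta}(1+|x|^2+|\xi|^2)^{\rho-\frac{\alpha+\beta}{2}} .$$ It is a Fréchet space with the seminorms $\wp^\rho_j(f)=\sum_{\alpha+\beta\le j}\sup_{(x,\xi)\in\mathbb{R}^2}|\partial_x^\alpha\partial_\xi^\beta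 f(x,\xi)|\,(1+|x|^2+|\xi|^2)^{-\rho+\frac{\alpha+\beta}{2}}$, $j\in\mathbb{N}_0$. Operators: the Weyl quantization of $f$ is $$(f(x,D_x)\psi)(x)=\frac1{2\pi}\iint_{\mathbb{R}^2}e^{i(x-y)\xi}f\left(\tfrac{x+y}{2},\xi\right)\psi(y)\,dy\,d\xi .$$ $\mathcal{A}_\rho$ is the set of operators $F=f(x,D_x)$ with $f\in S^\rho_{\mathrm{ho}}$ (pseudodifferential operators of order $\rho$), with the Fréchet structure given by the seminorms of the symbols. $C_b^\infty(\mathbb{T},\mathcal{A}_0)$ is the space of $2\pi$-periodic smooth maps $t\mapsto V(t)=V(t,x,D_x)\in\mathcal{A}_0$ such that every $t$-derivative is bounded in $t$ with respect to every seminorm of $\mathcal{A}_0$. A solution is smooth if it is smooth in time with values in the scale, i.e. $\psi\in C^k(\mathbb{R};\mathcal{H}^{r-k})$ for every $k\in\mathbb{N}_0$. *)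

theory Defs
  imports "HOL-Analysis.Analysis"
begin

text \<open>
  Elements of \<open>L\<^sup>2(\<real>,\<complex>)\<close> are represented by square-integrable functions. They are never
  identified; all norms below are therefore seminorms that vanish exactly on the a.e. zero functions.
\<close>

definition L2 :: "(real \<Rightarrow> complex) set" where
  "L2 = {f. f \<in> borel_measurable lborel \<and> integrable lborel (\<lambda>x. (cmod (f x))\<^sup>2)}"

definition L2norm :: "(real \<Rightarrow> complex) \<Rightarrow> real" where
  "L2norm f = sqrt (\<integral>x. (cmod (f x))\<^sup>2 \<partial>lborel)"

definition D1 :: "(real \<Rightarrow> complex) \<Rightarrow> real \<Rightarrow> complex" where
  "D1 f = (\<lambda>x. vector_derivative f (at x))"

definition schwartz :: "(real \<Rightarrow> complex) set" where
  "schwartz = {f. (\<forall>n x. (D1 ^^ n) f differentiable (at x)) \<and>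
                  (\<forall>m n. \<exists>B. \<forall>x. \<bar>x\<bar> ^ m * cmod ((D1 ^^ n) f x) \<le> B)}"

subsection \<open>The harmonic oscillator and its Sobolev scale\<close>

definition harm :: "(real \<Rightarrow> complex) \<Rightarrow> real \<Rightarrow> complex" where
  "harm f = (\<lambda>x. (- (D1 ^^ 2) f x + complex_of_real (x\<^sup>2) * f x) / 2)"

text \<open>
  \<open>K\<^sub>0\<close> is the self-adjoint realisation of \<open>(- \<partial>\<^sub>x\<^sup>2 + x\<^sup>2) / 2\<close> on \<open>L\<^sup>2\<close>, i.e. the maximal one: \<open>K\<^sub>0 f = g\<close>
  holds in the sense of tempered distributions, with \<open>f\<close> and \<open>g\<close> both in \<open>L\<^sup>2\<close>. The differential
  expression is its own transpose, so no complex conjugate is needed in the pairing.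
\<close>

definition is_K0 :: "(real \<Rightarrow> complex) \<Rightarrow> (real \<Rightarrow> complex) \<Rightarrow> bool" where
  "is_K0 f g \<longleftrightarrow> f \<in> L2 \<and> g \<in> L2 \<and>
     (\<forall>\<phi>\<in>schwartz. (\<integral>x. f x * harm \<phi> x \<partial>lborel) = (\<integral>x. g x * \<phi> x \<partial>lborel))"

definition dom_K0 :: "(real \<Rightarrow> complex) set" where
  "dom_K0 = {f. \<exists>g. is_K0 f g}"

text \<open>The choice only selects a representative: \<open>g\<close> is determined a.e. by \<open>f\<close>.\<close>

definition K0 :: "(real \<Rightarrow> complex) \<Rightarrow> real \<Rightarrow> complex" where
  "K0 f = (SOME g. is_K0 f g)"

text \<open>\<open>Hs n\<close> is the domain of the \<open>n\<close>-th power of \<open>K\<^sub>0\<close>; only integer exponents are needed.\<close>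

definition Hs :: "nat \<Rightarrow> (real \<Rightarrow> complex) set" where
  "Hs n = {f \<in> L2. \<forall>j<n. (K0 ^^ j) f \<in> dom_K0}"

definition Hs_norm :: "nat \<Rightarrow> (real \<Rightarrow> complex) \<Rightarrow> real" where
  "Hs_norm n f = L2norm ((K0 ^^ n) f)"

text \<open>
  \<open>Hneg n\<close> is the space with exponent \<open>- n\<close>, the dual of \<open>Hs n\<close>. A functional is represented by a total
  function whose values outside \<open>Hs n\<close> are irrelevant. \<open>L\<^sup>2\<close> is embedded by the bilinear pairing, which
  makes the embedding complex linear; \<open>Hs n\<close> is invariant under conjugation, with the same norm.
\<close>

definition Hneg :: "nat \<Rightarrow> ((real \<Rightarrow> complex) \<Rightarrow> complex) set" where
  "Hneg n = {u. (\<forall>f\<in>Hs n. \<forall>g\<in>Hs n. u (\<lambda>x. f x + g x) = u f + u g) \<and>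
                (\<forall>f\<in>Hs n. \<forall>c. u (\<lambda>x. c * f x) = c * u f) \<and>
                (\<exists>B. \<forall>f\<in>Hs n. cmod (u f) \<le> B * Hs_norm n f)}"

definition Hneg_norm :: "nat \<Rightarrow> ((real \<Rightarrow> complex) \<Rightarrow> complex) \<Rightarrow> real" where
  "Hneg_norm n u = (SUP f\<in>{f \<in> Hs n. Hs_norm n f \<le> 1}. cmod (u f))"

definition pairing :: "(real \<Rightarrow> complex) \<Rightarrow> (real \<Rightarrow> complex) \<Rightarrow> complex" where
  "pairing f \<phi> = (\<integral>x. f x * \<phi> x \<partial>lborel)"

subsection \<open>Curves in a (semi)normed space of complex-valued functions\<close>

definition curve_deriv ::
  "(('b \<Rightarrow> complex) \<Rightarrow> real) \<Rightarrow> (real \<Rightarrow> 'b \<Rightarrow> complex) \<Rightarrow> ('b \<Rightarrow> complex) \<Rightarrow> real \<Rightarrow> bool" where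
  "curve_deriv N u d t \<longleftrightarrow>
     ((\<lambda>h. N (\<lambda>x. (u (t + h) x - u t x) / complex_of_real h - d x)) \<longlongrightarrow> 0) (at 0)"

definition curve_cont ::
  "(('b \<Rightarrow> complex) \<Rightarrow> real) \<Rightarrow> (real \<Rightarrow> 'b \<Rightarrow> complex) \<Rightarrow> real \<Rightarrow> bool" where
  "curve_cont N u t \<longleftrightarrow> ((\<lambda>s. N (\<lambda>x. u s x - u t x)) \<longlongrightarrow> 0) (at t)"

text \<open>\<open>u \<in> C\<^sup>k(\<real>; E)\<close>, where \<open>E\<close> carries the norm \<open>N\<close>; \<open>v j\<close> is the \<open>j\<close>-th derivative of \<open>u\<close>.\<close>

definition Ck_curve ::
  "nat \<Rightarrow> ('b \<Rightarrow> complex) set \<Rightarrow> (('b \<Rightarrow> complex) \<Rightarrow> real) \<Rightarrow> (real \<Rightarrow> 'b \<Rightarrow> complex) \<Rightarrow> bool" where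
  "Ck_curve k E N u \<longleftrightarrow>
     (\<exists>v. v 0 = u \<and>
          (\<forall>j\<le>k. \<forall>t. v j t \<in> E \<and> curve_cont N (v j) t) \<and>
          (\<forall>j<k. \<forall>t. curve_deriv N (v j) (v (Suc j) t) t))"

definition smooth_in_scale :: "nat \<Rightarrow> (real \<Rightarrow> real \<Rightarrow> complex) \<Rightarrow> bool" where
  "smooth_in_scale r \<psi> \<longleftrightarrow>
     (\<forall>k. if k \<le> r then Ck_curve k (Hs (r - k)) (Hs_norm (r - k)) \<psi>
          else Ck_curve k (Hneg (k - r)) (Hneg_norm (k - r)) (\<lambda>t. pairing (\<psi> t)))"

subsection \<open>Symbols and Weyl quantization\<close>

definition partial_x :: "(real \<Rightarrow> real \<Rightarrow> real) \<Rightarrow> real \<Rightarrow> real \<Rightarrow> real" where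
  "partial_x f = (\<lambda>x \<xi>. deriv (\<lambda>s. f s \<xi>) x)"

definition partial_xi :: "(real \<Rightarrow> real \<Rightarrow> real) \<Rightarrow> real \<Rightarrow> real \<Rightarrow> real" where
  "partial_xi f = (\<lambda>x \<xi>. deriv (\<lambda>s. f x s) \<xi>)"

definition mixed :: "nat \<Rightarrow> nat \<Rightarrow> (real \<Rightarrow> real \<Rightarrow> real) \<Rightarrow> real \<Rightarrow> real \<Rightarrow> real" where
  "mixed \<alpha> \<beta> f = (partial_x ^^ \<alpha>) ((partial_xi ^^ \<beta>) f)"

text \<open>
  Total differentiability of every \<open>mixed \<alpha> \<beta> f\<close> is \<open>C\<^sup>\<infinity>\<close> on the plane: it makes all of them continuous,
  and forces the partial derivatives to commute, so that fixing one order of them loses nothing.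
\<close>

definition smooth_plane :: "(real \<Rightarrow> real \<Rightarrow> real) \<Rightarrow> bool" where
  "smooth_plane f \<longleftrightarrow>
     (\<forall>\<alpha> \<beta> p. (\<lambda>(x, \<xi>). mixed \<alpha> \<beta> f x \<xi>) differentiable (at p))"

definition S_ho :: "real \<Rightarrow> (real \<Rightarrow> real \<Rightarrow> real) set" where
  "S_ho \<rho> = {f. smooth_plane f \<and>
     (\<forall>\<alpha> \<beta>. \<exists>C>0. \<forall>x \<xi>. \<bar>mixed \<alpha> \<beta> f x \<xi>\<bar> \<le> C * (1 + x\<^sup>2 + \<xi>\<^sup>2) powr (\<rho> - real (\<alpha> + \<beta>) / 2))}"

definition S_ho_seminorm :: "real \<Rightarrow> nat \<Rightarrow> (real \<Rightarrow> real \<Rightarrow> real) \<Rightarrow> real" where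
  "S_ho_seminorm \<rho> j f =
     (\<Sum>(\<alpha>, \<beta>)\<in>{(\<alpha>, \<beta>). \<alpha> + \<beta> \<le> j}.
        (SUP (x, \<xi>)\<in>UNIV. \<bar>mixed \<alpha> \<beta> f x \<xi>\<bar> * (1 + x\<^sup>2 + \<xi>\<^sup>2) powr (- \<rho> + real (\<alpha> + \<beta>) / 2)))"

text \<open>
  The double integral does not converge absolutely. For Schwartz \<open>\<psi>\<close> it converges as an iterated
  integral, first over \<open>y\<close>, where the oscillation produces decay in \<open>\<xi>\<close>.
\<close>

definition weyl :: "(real \<Rightarrow> real \<Rightarrow> real) \<Rightarrow> (real \<Rightarrow> complex) \<Rightarrow> real \<Rightarrow> complex" where
  "weyl f \<psi> = (\<lambda>x. complex_of_real (1 / (2 * pi)) *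
     (\<integral>\<xi>. (\<integral>y. exp (\<i> * complex_of_real ((x - y) * \<xi>)) *
                 complex_of_real (f ((x + y) / 2) \<xi>) * \<psi> y \<partial>lborel) \<partial>lborel))"

text \<open>
  Extension of an operator from Schwartz functions to \<open>L\<^sup>2\<close>, as the closure of its graph. For an operator
  of order \<open>0\<close>, which is \<open>L\<^sup>2\<close>-bounded, this is the extension by continuity to all of \<open>L\<^sup>2\<close>.
  Membership of \<open>F (\<phi> n)\<close> in \<open>L\<^sup>2\<close> is required since integrals of non-integrable functions are \<open>0\<close>.
\<close>

definition L2_closure ::
  "((real \<Rightarrow> complex) \<Rightarrow> real \<Rightarrow> complex) \<Rightarrow> (real \<Rightarrow> complex) \<Rightarrow> (real \<Rightarrow> complex) \<Rightarrow> bool" where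
  "L2_closure F f g \<longleftrightarrow> f \<in> L2 \<and> g \<in> L2 \<and>
     (\<exists>\<phi>. (\<forall>n. \<phi> n \<in> schwartz \<and> F (\<phi> n) \<in> L2) \<and>
          (\<lambda>n. L2norm (\<lambda>x. \<phi> n x - f x)) \<longlonglongrightarrow> 0 \<and>
          (\<lambda>n. L2norm (\<lambda>x. F (\<phi> n) x - g x)) \<longlonglongrightarrow> 0)"

text \<open>
  \<open>V \<in> C\<^sub>b\<^sup>\<infinity>(\<real>/2\<pi>\<int>, A\<^sub>\<rho>)\<close>, where \<open>A\<^sub>\<rho> = weyl ` S_ho \<rho>\<close> has the Frechet structure of its symbols:
  \<open>a n t\<close> is the symbol of the \<open>n\<close>-th time derivative of \<open>V\<close> at \<open>t\<close>, the difference quotients converging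
  with respect to every seminorm.
\<close>

definition Cb_smooth_A ::
  "real \<Rightarrow> (real \<Rightarrow> (real \<Rightarrow> complex) \<Rightarrow> real \<Rightarrow> complex) \<Rightarrow> bool" where
  "Cb_smooth_A \<rho> V \<longleftrightarrow>
     (\<exists>a :: nat \<Rightarrow> real \<Rightarrow> real \<Rightarrow> real \<Rightarrow> real.
        (\<forall>t. V t = weyl (a 0 t)) \<and>
        (\<forall>t. a 0 (t + 2 * pi) = a 0 t) \<and>
        (\<forall>n t. a n t \<in> S_ho \<rho>) \<and>
        (\<forall>n t j. ((\<lambda>h. S_ho_seminorm \<rho> j
             (\<lambda>x \<xi>. (a n (t + h) x \<xi> - a n t x \<xi>) / h - a (Suc n) t x \<xi>)) \<longlongrightarrow> 0) (at 0)) \<and>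
        (\<forall>n j. \<exists>M. \<forall>t. S_ho_seminorm \<rho> j (a n t) \<le> M))"

text \<open>
  \<open>i \<psi>' = K\<^sub>0 \<psi> + V(t) \<psi>\<close> for all times, for curves in \<open>Hs r\<close> with \<open>r \<ge> 1\<close>: \<open>K\<^sub>0\<close> loses one unit of
  regularity, so the time derivative is taken in \<open>Hs (r - 1)\<close>, which is contained in \<open>L\<^sup>2\<close>.
\<close>

definition solves ::
  "nat \<Rightarrow> (real \<Rightarrow> (real \<Rightarrow> complex) \<Rightarrow> real \<Rightarrow> complex) \<Rightarrow> (real \<Rightarrow> real \<Rightarrow> complex) \<Rightarrow> bool" where
  "solves r V \<psi> \<longleftrightarrow>
     (\<forall>t. \<psi> t \<in> Hs r \<and>
          (\<exists>d w. d \<in> Hs (r - 1) \<and> curve_deriv (Hs_norm (r - 1)) \<psi> d t \<and>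
                 L2_closure (V t) (\<psi> t) w \<and>
                 (AE x in lborel. \<i> * d x = K0 (\<psi> t) x + w x)))"

end

theory Submission
  imports Defs "HOL-Probability.Probability"
begin

text \<open>
  Conjugating by the flow of the harmonic oscillator rotates Weyl symbols. Hence the symbol
  \<open>(x cos t - \<xi> sin t) g(x\<^sup>2 + \<xi>\<^sup>2)\<close> becomes time independent in the interaction picture, where the
  order-\<open>0\<close> operator with symbol \<open>x g(x\<^sup>2 + \<xi>\<^sup>2)\<close> acts on Hermite functions as a Jacobi matrix with zero
  diagonal and off-diagonal weights \<open>w\<^sub>n\<close>. For \<open>g(\<rho>) = \<integral>\<^sub>0\<^sup>1 (1 - \<sigma>\<^sup>2) exp (- \<sigma>\<^sup>2 \<rho>) d\<sigma>\<close> Mehler's formula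
  expresses \<open>w\<^sub>n\<close> through a Wallis integral, whose recurrence and log-convexity make \<open>w\<^sub>n\<close> bounded and
  nondecreasing. If \<open>b\<^sub>n\<close> are the Hermite coefficients of the solution, then
  \<open>\<Sum> (n + 1/2) \<bar>b\<^sub>n\<bar>\<^sup>2\<close> has second derivative \<open>2 \<Sum> (w\<^sub>n\<^sup>2 - w\<^bsub>n-1\<^esub>\<^sup>2) \<bar>b\<^sub>n\<bar>\<^sup>2 \<ge> 0\<close>, so it grows at least
  linearly once its initial slope is positive, and Jensen's inequality turns this into growth of order
  \<open>t\<^sup>r\<close> of the \<open>r\<close>-th norm.
\<close>

section \<open>Gaussian decay and Hermite functions\<close>

text \<open>An operator of order 0 has bounded weights, so transport up the Hermite ladder must
  persist for a structural reason. Monotone weights supply it by making the energy convex in time.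
  The data are \<open>h_0 - i h_1\<close> because the phase between two neighbouring sites decides
  the initial slope, here \<open>2 w_0\<close>. The measure
  \<open>(1 - \<sigma>^2) d\<sigma>\<close> in the profile has two tasks. Its density does not
  vanish at 0, so g decays like \<rho> to the power -1/2 and x g has order 0. The factor
  \<open>1 - \<sigma>^2\<close> turns the Mehler coefficients
  \<open>(1 - s)^n / (1 + s)^(n+2)\<close>, with \<open>s = \<sigma>^2\<close>, into Wallis
  integrands, and the interval [0, 1] keeps them nonnegative. The matrix is bounded and tridiagonal
  and the data are finitely supported. Hence the coefficients decay faster than every geometric
  sequence, locally uniformly in time: a single solution lies in all spaces of the scale and serves
  every r, and questions of convergence in n reduce to absolutely convergent series.\<close>

definition gauss_decay :: "(real \<Rightarrow> 'a::real_normed_vector) \<Rightarrow> bool" where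
  "gauss_decay f \<longleftrightarrow> (\<exists>C. \<exists>a>0. \<forall>x. norm (f x) \<le> C * exp (- a * x\<^sup>2))"

text \<open>Completing the square. An arbitrarily small part of a Gaussian absorbs any factor of
  linear exponential growth, hence any polynomial amplitude.\<close>

lemma exp_abs_le_gauss:
  assumes "a > (0::real)"
  shows "exp (d * \<bar>x\<bar>) \<le> exp (d\<^sup>2 / (4 * a)) * exp (a * x\<^sup>2)"
proof -
  have "0 \<le> (2 * a * \<bar>x\<bar> - d)\<^sup>2 / (4 * a)" using assms by simp
  also have "\<dots> = a * x\<^sup>2 - d * \<bar>x\<bar> + d\<^sup>2 / (4 * a)"
    using assms by (simp add: power2_diff field_simps power2_eq_square)
  finally show ?thesis by (simp flip: exp_add)
qed

lemma gauss_decayI: "a > 0 \<Longrightarrow> (\<And>x. norm (f x) \<le> C * exp (- a * x\<^sup>2)) \<Longrightarrow> gauss_decay f"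
  unfolding gauss_decay_def by blast

lemma gauss_decayE:
  assumes "gauss_decay f"
  obtains C a where "C > 0" "a > 0" "\<And>x. norm (f x) \<le> C * exp (- a * x\<^sup>2)"
proof -
  obtain C a where *: "a > 0" "\<And>x. norm (f x) \<le> C * exp (- a * x\<^sup>2)"
    using assms unfolding gauss_decay_def by blast
  have "norm (f x) \<le> (\<bar>C\<bar> + 1) * exp (- a * x\<^sup>2)" for x
    by (rule order_trans[OF *(2)]) (auto intro!: mult_right_mono)
  then show ?thesis using that[of "\<bar>C\<bar> + 1" a] * by auto
qed

lemma gauss_decay_add:
  assumes "gauss_decay f" "gauss_decay g" shows "gauss_decay (\<lambda>x. f x + g x)"
proof -
  obtain C a where f: "C > 0" "a > 0" "\<And>x. norm (f x) \<le> C * exp (- a * x\<^sup>2)"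
    using gauss_decayE[OF assms(1)] by metis
  obtain D b where g: "D > 0" "b > 0" "\<And>x. norm (g x) \<le> D * exp (- b * x\<^sup>2)"
    using gauss_decayE[OF assms(2)] by metis
  show ?thesis
  proof (rule gauss_decayI)
    show "min a b > 0" using f g by simp
    fix x
    have "C * exp (- a * x\<^sup>2) \<le> C * exp (- (min a b) * x\<^sup>2)" "D * exp (- b * x\<^sup>2) \<le> D * exp (- (min a b) * x\<^sup>2)"
      using f g by (auto intro!: mult_left_mono mult_right_mono)
    then show "norm (f x + g x) \<le> (C + D) * exp (- (min a b) * x\<^sup>2)"
      using f(3)[of x] g(3)[of x] norm_triangle_ineq[of "f x" "g x"] by (simp add: algebra_simps)
  qed
qed

text \<open>Half of the rate \<open>a\<close> pays for the growing factor. The rate is existentially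
  quantified in \<open>gauss_decay\<close>, so the loss is harmless and can be repeated.\<close>

lemma gauss_decay_mult_exp:
  fixes f g :: "real \<Rightarrow> 'a::real_normed_algebra"
  assumes "gauss_decay f" "\<And>x. norm (g x) \<le> C * exp (d * \<bar>x\<bar>)"
  shows "gauss_decay (\<lambda>x. g x * f x)"
proof -
  obtain D a where f: "D > 0" "a > 0" "\<And>x. norm (f x) \<le> D * exp (- a * x\<^sup>2)"
    using gauss_decayE[OF assms(1)] by metis
  have C: "C \<ge> 0" using order_trans[OF norm_ge_zero assms(2)[of 0]] by simp
  show ?thesis
  proof (rule gauss_decayI)
    show "a / 2 > 0" using f by simp
    fix x
    have "norm (g x * f x) \<le> (C * exp (d * \<bar>x\<bar>)) * (D * exp (- a * x\<^sup>2))"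
      by (rule order_trans[OF norm_mult_ineq]) (intro mult_mono assms f; use C in simp)
    also have "\<dots> \<le> (C * (exp (d\<^sup>2 / (4 * (a / 2))) * exp (a / 2 * x\<^sup>2))) * (D * exp (- a * x\<^sup>2))"
      using f C by (intro mult_right_mono mult_left_mono exp_abs_le_gauss) auto
    also have "\<dots> = (C * D * exp (d\<^sup>2 / (4 * (a / 2)))) * exp (- (a / 2) * x\<^sup>2)"
      by (simp add: mult_ac flip: exp_add)
    finally show "norm (g x * f x) \<le> (C * D * exp (d\<^sup>2 / (4 * (a / 2)))) * exp (- (a / 2) * x\<^sup>2)" .
  qed
qed

lemma gauss_decay_bounded: "gauss_decay f \<Longrightarrow> \<exists>C. \<forall>x. norm (f x) \<le> C"
proof (erule gauss_decayE)
  fix C a assume "C > 0" "a > 0" and *: "\<And>x. norm (f x) \<le> C * exp (- a * x\<^sup>2)"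
  have "norm (f x) \<le> C * 1" for x
    by (rule order_trans[OF *]) (use \<open>C > 0\<close> \<open>a > 0\<close> in \<open>intro mult_left_mono, auto\<close>)
  then show ?thesis by auto
qed

lemma gauss_decay_mult_bounded:
  fixes f g :: "real \<Rightarrow> 'a::real_normed_algebra"
  assumes "gauss_decay f" "\<And>x. norm (g x) \<le> C"
  shows "gauss_decay (\<lambda>x. g x * f x)"
  using gauss_decay_mult_exp[OF assms(1), of g C 0] assms(2) by simp

lemma gauss_decay_cmult:
  fixes f :: "real \<Rightarrow> 'a::real_normed_algebra"
  shows "gauss_decay f \<Longrightarrow> gauss_decay (\<lambda>x. c * f x)"
  by (rule gauss_decay_mult_bounded[of f "\<lambda>_. c" "norm c"]) auto

lemma gauss_decay_mult:
  fixes f g :: "real \<Rightarrow> 'a::real_normed_algebra"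
  assumes "gauss_decay f" "gauss_decay g"
  shows "gauss_decay (\<lambda>x. g x * f x)"
  using gauss_decay_bounded[OF assms(2)] gauss_decay_mult_bounded[OF assms(1)] by metis

lemma gauss_decay_mult_id:
  fixes f :: "real \<Rightarrow> 'a::real_normed_algebra_1"
  assumes "gauss_decay f" shows "gauss_decay (\<lambda>x. of_real x * f x)"
proof (rule gauss_decay_mult_exp[OF assms, of _ 1 1])
  show "norm (of_real x :: 'a) \<le> 1 * exp (1 * \<bar>x\<bar>)" for x
    using order_trans[OF _ exp_ge_add_one_self[of "\<bar>x\<bar>"]] by simp
qed

lemma gauss_decay_uminus: "gauss_decay f \<Longrightarrow> gauss_decay (\<lambda>x. - f x)"
  unfolding gauss_decay_def by simp

lemma gauss_decay_diff: "gauss_decay f \<Longrightarrow> gauss_decay g \<Longrightarrow> gauss_decay (\<lambda>x. f x - g x)"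
  using gauss_decay_add[of f "\<lambda>x. - g x"] gauss_decay_uminus[of g] by simp

section \<open>Gaussian integrals and integration by parts on the line\<close>

lemma has_bochner_integral_gauss:
  assumes "a > (0::real)"
  shows "has_bochner_integral lborel (\<lambda>x. exp (- a * (x - m)\<^sup>2)) (sqrt (pi / a))"
proof -
  \<comment> \<open>The standard deviation for which the normal density is proportional to the given
    Gaussian.\<close>
  define s where "s = sqrt (1 / (2 * a))"
  have s: "s > 0" "s\<^sup>2 = 1 / (2 * a)" using assms by (auto simp: s_def)
  have "has_bochner_integral lborel (\<lambda>x. sqrt (pi / a) * normal_density m s x) (sqrt (pi / a) * 1)"
    using integrable_normal_density[OF s(1)] integral_normal_density[OF s(1)]
    by (intro has_bochner_integral_mult_right) (auto simp: has_bochner_integral_iff)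
  moreover have "sqrt (pi / a) * normal_density m s x = exp (- a * (x - m)\<^sup>2)" for x
    unfolding normal_density_def s(2) using assms by (simp add: field_simps real_sqrt_divide)
  ultimately show ?thesis by simp
qed

lemma integrable_gauss_decay:
  fixes f :: "real \<Rightarrow> 'a::{banach, second_countable_topology}"
  assumes "gauss_decay f" "f \<in> borel_measurable lborel"
  shows "integrable lborel f"
proof -
  obtain D a where f: "D > 0" "a > 0" "\<And>x. norm (f x) \<le> D * exp (- a * x\<^sup>2)"
    using gauss_decayE[OF assms(1)] by metis
  show ?thesis
  proof (rule Bochner_Integration.integrable_bound)
    show "integrable lborel (\<lambda>x. D * exp (- a * x\<^sup>2))"
      using has_bochner_integral_gauss[OF f(2), of 0] by (simp add: has_bochner_integral_iff)
    show "AE x in lborel. norm (f x) \<le> norm (D * exp (- a * x\<^sup>2))"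
      using f by (auto intro!: AE_I2 order_trans[OF f(3)])
  qed fact
qed

lemma gauss_decay_tendsto:
  assumes "gauss_decay f" shows "(f \<longlongrightarrow> 0) at_top" "(f \<longlongrightarrow> 0) at_bot"
proof -
  obtain D a where f: "D > 0" "a > 0" "\<And>x. norm (f x) \<le> D * exp (- a * x\<^sup>2)"
    using gauss_decayE[OF assms(1)] by metis
  have lim: "((\<lambda>x. D * exp (- a * x\<^sup>2)) \<longlongrightarrow> 0) at_top" "((\<lambda>x. D * exp (- a * x\<^sup>2)) \<longlongrightarrow> 0) at_bot"
    using f by real_asymp+
  show "(f \<longlongrightarrow> 0) at_top" by (rule Lim_null_comparison[OF _ lim(1)]) (use f in simp)
  show "(f \<longlongrightarrow> 0) at_bot" by (rule Lim_null_comparison[OF _ lim(2)]) (use f in simp)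
qed

text \<open>The common form of the integrations by parts below: a product is taken as
  \<open>F\<close>, and the product rule splits \<open>f\<close> into the terms to be compared.
  Gaussian decay of \<open>F\<close> removes the boundary values.\<close>

lemma integral_derivative_eq_0:
  fixes F :: "real \<Rightarrow> 'a::euclidean_space"
  assumes "\<And>x. (F has_vector_derivative f x) (at x)" "continuous_on UNIV f"
    "gauss_decay F" "gauss_decay f"
  shows "(\<integral>x. f x \<partial>lborel) = 0"
proof -
  have meas: "f \<in> borel_measurable lborel"
    using assms(2) by (simp add: borel_measurable_continuous_onI)
  have int: "integrable lborel f" by (rule integrable_gauss_decay) fact+
  have "(LBINT x=-\<infinity>..\<infinity>. f x) = 0 - 0"
  proof (rule interval_integral_FTC_integrable[of _ _ F])
    show "isCont f x" for x using assms(2) continuous_on_eq_continuous_at by blast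
    show "set_integrable lborel (einterval (- \<infinity>) \<infinity>) f"
      using int by (simp add: set_integrable_def)
    show "((F \<circ> real_of_ereal) \<longlongrightarrow> 0) (at_right (- \<infinity>))" "((F \<circ> real_of_ereal) \<longlongrightarrow> 0) (at_left \<infinity>)"
      using gauss_decay_tendsto[OF assms(3)] by (simp_all add: ereal_tendsto_simps1)
  qed (use assms in auto)
  then show ?thesis
    by (simp add: interval_lebesgue_integral_def set_lebesgue_integral_def)
qed

section \<open>Normalised Hermite functions: ladder relations, orthonormality, a crude bound\<close>

fun hermite_fun :: "nat \<Rightarrow> real \<Rightarrow> real" where
  "hermite_fun 0 x = exp (- x\<^sup>2 / 2) / sqrt (sqrt pi)"
| "hermite_fun (Suc 0) x = sqrt 2 * x * hermite_fun 0 x"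
| "hermite_fun (Suc (Suc n)) x =
     (2 * x * hermite_fun (Suc n) x - sqrt (2 * real (Suc n)) * hermite_fun n x) / sqrt (2 * real (Suc (Suc n)))"

declare hermite_fun.simps [simp del]

text \<open>At n = 0 the truncated index \<open>n - 1\<close> is 0 again, but its coefficient
  \<open>sqrt (2 * real 0)\<close> vanishes. The ladder formulas below rely on the same
  convention.\<close>

lemma hermite_fun_recurrence:
  "sqrt (2 * real (Suc n)) * hermite_fun (Suc n) x = 2 * x * hermite_fun n x - sqrt (2 * real n) * hermite_fun (n - 1) x"
proof (cases n)
  case 0
  then show ?thesis by (simp add: hermite_fun.simps mult.assoc[symmetric])
next
  case (Suc m)
  have "sqrt (2 * real (Suc (Suc m))) \<noteq> 0" by simp
  then show ?thesis unfolding Suc hermite_fun.simps(3) by (simp del: of_nat_Suc)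
qed

text \<open>The annihilation relation. The functions are defined by a recurrence that contains no
  derivative, so the relation is carried along it, with the two preceding indices as induction
  hypotheses.\<close>

lemma hermite_fun_deriv:
  "(hermite_fun n has_real_derivative (sqrt (2 * real n) * hermite_fun (n - 1) x - x * hermite_fun n x)) (at x)"
proof (induction n x rule: hermite_fun.induct)
  case (1 x)
  have "hermite_fun 0 = (\<lambda>x. inverse (sqrt (sqrt pi)) * exp (- x\<^sup>2 / 2))"
    by (auto simp: hermite_fun.simps field_simps)
  then show ?case by (auto intro!: derivative_eq_intros)
next
  case (2 x)
  have "hermite_fun (Suc 0) = (\<lambda>x. sqrt 2 * x * hermite_fun 0 x)" by (simp only: hermite_fun.simps(2) fun_eq_iff) simp
  then show ?case using 2
    by (auto simp del: hermite_fun.simps(1) intro!: derivative_eq_intros simp: algebra_simps)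
next
  case (3 n x)
  define A where "A = sqrt (2 * real (Suc (Suc n)))"
  define B where "B = sqrt (2 * real (Suc n))"
  define E where "E = sqrt (2 * real n)"
  have A: "A > 0" "A * A = B * B + 2" unfolding A_def B_def by simp_all
  have rec: "B * hermite_fun (Suc n) x = 2 * x * hermite_fun n x - E * hermite_fun (n - 1) x"
    unfolding B_def E_def by (rule hermite_fun_recurrence)
  have eq: "hermite_fun (Suc (Suc n)) = (\<lambda>x. inverse A * (2 * x * hermite_fun (Suc n) x - B * hermite_fun n x))"
    by (simp only: hermite_fun.simps(3) A_def B_def fun_eq_iff) (simp add: divide_inverse_commute)
  have IH: "(hermite_fun (Suc n) has_real_derivative B * hermite_fun n x - x * hermite_fun (Suc n) x) (at x)"
      "(hermite_fun n has_real_derivative E * hermite_fun (n - 1) x - x * hermite_fun n x) (at x)"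
    using 3 by (simp_all only: B_def E_def diff_Suc_1)
  have "(hermite_fun (Suc (Suc n)) has_real_derivative inverse A *
     (2 * hermite_fun (Suc n) x + 2 * x * (B * hermite_fun n x - x * hermite_fun (Suc n) x)
        - B * (E * hermite_fun (n - 1) x - x * hermite_fun n x))) (at x)"
    unfolding eq by (rule derivative_eq_intros IH refl)+ (simp add: algebra_simps)
  \<comment> \<open>The recurrence one level lower eliminates \<open>hermite_fun (n - 1)\<close>,
    and \<open>A * A = B * B + 2\<close> accounts for what remains.\<close>
  moreover have "2 * hermite_fun (Suc n) x + 2 * x * (B * hermite_fun n x - x * hermite_fun (Suc n) x)
        - B * (E * hermite_fun (n - 1) x - x * hermite_fun n x) = A * (A * hermite_fun (Suc n) x - x * hermite_fun (Suc (Suc n)) x)"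
  proof -
    have "B * (2 * x * hermite_fun n x - E * hermite_fun (n - 1) x) = (A * A - 2) * hermite_fun (Suc n) x"
      unfolding rec[symmetric] A(2) by simp
    moreover have "A * hermite_fun (Suc (Suc n)) x = 2 * x * hermite_fun (Suc n) x - B * hermite_fun n x"
      unfolding eq using A(1) by simp
    then have "A * (x * hermite_fun (Suc (Suc n)) x) = x * (2 * x * hermite_fun (Suc n) x - B * hermite_fun n x)"
      by (simp only: mult.left_commute[of A x])
    ultimately show ?thesis by (simp add: algebra_simps)
  qed
  moreover have "inverse A * (A * u) = u" for u using A(1) by simp
  ultimately show ?case by (simp only: A_def diff_Suc_1)
qed

lemma hermite_fun_deriv_raise:
  "(hermite_fun n has_real_derivative (x * hermite_fun n x - sqrt (2 * real (Suc n)) * hermite_fun (Suc n) x)) (at x)"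
proof -
  have "sqrt (2 * real n) * hermite_fun (n - 1) x - x * hermite_fun n x = x * hermite_fun n x - sqrt (2 * real (Suc n)) * hermite_fun (Suc n) x"
    using hermite_fun_recurrence[of n x] by linarith
  then show ?thesis using hermite_fun_deriv[of n x] by simp
qed

text \<open>The eigenvalue equation of the oscillator, stated as the derivative of the known
  expression for the first derivative. Raising after lowering returns the same function, and the two
  square roots multiply to \<open>2 * real n\<close>.\<close>

lemma hermite_fun_deriv2:
  "((\<lambda>x. sqrt (2 * real n) * hermite_fun (n - 1) x - x * hermite_fun n x) has_real_derivative
      ((x\<^sup>2 - (2 * real n + 1)) * hermite_fun n x)) (at x)"
proof (cases n)
  case 0
  show ?thesis unfolding 0 using hermite_fun_deriv[of 0 x]
    by (auto intro!: derivative_eq_intros simp: algebra_simps power2_eq_square)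
next
  case (Suc m)
  have "((\<lambda>x. sqrt (2 * real n) * hermite_fun (n - 1) x - x * hermite_fun n x) has_real_derivative
     sqrt (2 * real n) * (x * hermite_fun (n - 1) x - sqrt (2 * real n) * hermite_fun n x)
       - (hermite_fun n x + x * (sqrt (2 * real n) * hermite_fun (n - 1) x - x * hermite_fun n x))) (at x)"
    using hermite_fun_deriv[of n x] hermite_fun_deriv_raise[of m x] unfolding Suc
    by (auto intro!: derivative_eq_intros simp: algebra_simps)
  moreover have "sqrt (2 * real n) * (sqrt (2 * real n) * hermite_fun n x) = 2 * real n * hermite_fun n x"
    by (simp flip: mult.assoc)
  ultimately show ?thesis by (simp add: algebra_simps power2_eq_square)
qed

lemma gauss_decay_hermite_fun: "gauss_decay (hermite_fun n)"
proof -
  have 0: "gauss_decay (hermite_fun 0)"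
    by (rule gauss_decayI[of "1/2" _ "1 / sqrt (sqrt pi)"]) (simp_all add: hermite_fun.simps)
  have mx: "gauss_decay f \<Longrightarrow> gauss_decay (\<lambda>x. x * f x)" for f :: "real \<Rightarrow> real"
    using gauss_decay_mult_id[of f] by simp
  have "gauss_decay (hermite_fun n) \<and> gauss_decay (hermite_fun (Suc n))"
  proof (induction n)
    case 0
    have "hermite_fun (Suc 0) = (\<lambda>x. sqrt 2 * (x * hermite_fun 0 x))" by (simp only: hermite_fun.simps(2) fun_eq_iff) simp
    then show ?case using gauss_decay_cmult[OF mx[OF 0], where c = "sqrt 2"] \<open>gauss_decay (hermite_fun 0)\<close> by simp
  next
    case (Suc n)
    have "hermite_fun (Suc (Suc n)) = (\<lambda>x. 2 / sqrt (2 * real (Suc (Suc n))) * (x * hermite_fun (Suc n) x)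
        - sqrt (2 * real (Suc n)) / sqrt (2 * real (Suc (Suc n))) * hermite_fun n x)"
      by (simp only: hermite_fun.simps(3) fun_eq_iff) (simp add: diff_divide_distrib)
    moreover have "gauss_decay \<dots>"
      using Suc by (intro gauss_decay_diff gauss_decay_cmult mx) simp_all
    ultimately show ?case using Suc by simp
  qed
  then show ?thesis by simp
qed

lemma continuous_hermite_fun: "continuous_on A (hermite_fun n)"
  using hermite_fun_deriv DERIV_isCont continuous_at_imp_continuous_on by blast

lemma gauss_decay_id_hermite_fun: "gauss_decay (\<lambda>x. x * hermite_fun n x)"
  using gauss_decay_mult_id[OF gauss_decay_hermite_fun, of n] by simp

lemma continuous_on_hermite_fun[continuous_intros]: "continuous_on A g \<Longrightarrow> continuous_on A (\<lambda>x. hermite_fun n (g x))"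
  using continuous_on_compose2[OF continuous_hermite_fun[of UNIV]] by blast

lemma hermite_fun_measurable[measurable]: "hermite_fun n \<in> borel_measurable borel"
  by (rule borel_measurable_continuous_onI[OF continuous_hermite_fun])

lemma integrable_hermite_fun_hermite_fun: "integrable lborel (\<lambda>x. hermite_fun n x * hermite_fun m x)"
  by (intro integrable_gauss_decay gauss_decay_mult gauss_decay_hermite_fun) measurable

text \<open>By the eigenvalue equation the Wronskian of two Hermite functions has derivative 2 (n -
  m) h_n h_m, and the Wronskian vanishes at infinity.\<close>

lemma hermite_fun_orthogonal:
  assumes "n \<noteq> m" shows "(\<integral>x. hermite_fun n x * hermite_fun m x \<partial>lborel) = 0"
proof -
  define h' where "h' n x = sqrt (2 * real n) * hermite_fun (n - 1) x - x * hermite_fun n x" for n x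
  have cont: "continuous_on UNIV (h' n)" and dec: "gauss_decay (h' n)" for n
    unfolding h'_def by (auto intro!: continuous_intros gauss_decay_diff gauss_decay_cmult gauss_decay_hermite_fun gauss_decay_id_hermite_fun)
  have "(\<integral>x. 2 * (real n - real m) * (hermite_fun n x * hermite_fun m x) \<partial>lborel) = 0"
  proof (rule integral_derivative_eq_0)
    show "((\<lambda>x. hermite_fun n x * h' m x - h' n x * hermite_fun m x) has_vector_derivative
        2 * (real n - real m) * (hermite_fun n x * hermite_fun m x)) (at x)" for x
      unfolding has_real_derivative_iff_has_vector_derivative[symmetric]
      by (rule derivative_eq_intros hermite_fun_deriv hermite_fun_deriv2[folded h'_def] refl)+
        (simp add: h'_def algebra_simps)
  qed (auto intro!: continuous_intros gauss_decay_diff gauss_decay_cmult gauss_decay_mult gauss_decay_hermite_fun dec)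
  then show ?thesis using assms by simp
qed

text \<open>The product of two neighbours has as derivative a multiple of the difference of their
  squares, so all norms agree with that of the Gaussian \<open>hermite_fun 0\<close>.\<close>

lemma hermite_fun_normalized: "(\<integral>x. (hermite_fun n x)\<^sup>2 \<partial>lborel) = 1"
proof (induction n)
  case 0
  have "has_bochner_integral lborel (\<lambda>x. exp (- 1 * (x - 0)\<^sup>2) / sqrt pi) (sqrt (pi / 1) / sqrt pi)"
    by (rule has_bochner_integral_divide_zero[OF has_bochner_integral_gauss]) simp
  moreover have "(\<lambda>x. (hermite_fun 0 x)\<^sup>2) = (\<lambda>x. exp (- 1 * (x - 0)\<^sup>2) / sqrt pi)"
    by (simp add: hermite_fun.simps power_divide exp_double[symmetric])
  ultimately have "(\<integral>x. (hermite_fun 0 x)\<^sup>2 \<partial>lborel) = sqrt (pi / 1) / sqrt pi"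
    by (simp only: has_bochner_integral_iff)
  then show ?case by simp
next
  case (Suc n)
  have "(\<integral>x. sqrt (2 * real (Suc n)) * ((hermite_fun n x)\<^sup>2 - (hermite_fun (Suc n) x)\<^sup>2) \<partial>lborel) = 0"
  proof (rule integral_derivative_eq_0)
    show "((\<lambda>x. hermite_fun n x * hermite_fun (Suc n) x) has_vector_derivative
        sqrt (2 * real (Suc n)) * ((hermite_fun n x)\<^sup>2 - (hermite_fun (Suc n) x)\<^sup>2)) (at x)" for x
      unfolding has_real_derivative_iff_has_vector_derivative[symmetric]
      using hermite_fun_deriv_raise[of n x] hermite_fun_deriv[of "Suc n" x]
      by (auto intro!: derivative_eq_intros simp: algebra_simps power2_eq_square)
  qed (auto intro!: continuous_intros gauss_decay_diff gauss_decay_cmult gauss_decay_mult gauss_decay_hermite_fun simp: power2_eq_square)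
  then show ?case using Suc integrable_hermite_fun_hermite_fun[of n n] integrable_hermite_fun_hermite_fun[of "Suc n" "Suc n"]
    by (simp add: power2_eq_square)
qed

lemma hermite_fun_pointwise_bound: "\<bar>hermite_fun n x\<bar> \<le> (1 + 2 * \<bar>x\<bar>) ^ n"
proof -
  have h0: "\<bar>hermite_fun 0 x\<bar> \<le> 1"
  proof -
    have "exp (- x\<^sup>2 / 2) \<le> 1" by simp
    also have "1 \<le> sqrt (sqrt pi)" using pi_gt3 by simp
    finally show ?thesis by (simp add: hermite_fun.simps)
  qed
  have "\<bar>hermite_fun n x\<bar> \<le> (1 + 2 * \<bar>x\<bar>) ^ n \<and> \<bar>hermite_fun (Suc n) x\<bar> \<le> (1 + 2 * \<bar>x\<bar>) ^ Suc n"
  proof (induction n)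
    case 0
    have "sqrt 2 \<le> 2" using sqrt2_less_2 by simp
    then have "\<bar>hermite_fun (Suc 0) x\<bar> \<le> 2 * \<bar>x\<bar> * 1"
      unfolding hermite_fun.simps(2) abs_mult by (intro mult_mono h0) (auto simp: abs_mult)
    then show ?case using h0 by simp
  next
    case (Suc n)
    define A where "A = sqrt (2 * real (Suc (Suc n)))"
    have A: "A \<ge> 1" unfolding A_def by simp
    have BA: "sqrt (2 * real (Suc n)) \<le> A" unfolding A_def by simp
    have "\<bar>hermite_fun (Suc (Suc n)) x\<bar> = \<bar>2 * x * hermite_fun (Suc n) x - sqrt (2 * real (Suc n)) * hermite_fun n x\<bar> / A"
      unfolding hermite_fun.simps(3) A_def by (simp add: abs_divide)
    also have "\<dots> \<le> (2 * \<bar>x\<bar> * \<bar>hermite_fun (Suc n) x\<bar> + sqrt (2 * real (Suc n)) * \<bar>hermite_fun n x\<bar>) / A"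
      using A by (intro divide_right_mono order_trans[OF abs_triangle_ineq4]) (auto simp: abs_mult)
    also have "\<dots> \<le> (A * (2 * \<bar>x\<bar> * \<bar>hermite_fun (Suc n) x\<bar>) + A * \<bar>hermite_fun n x\<bar>) / A"
      using A BA mult_right_mono[OF A, of "2 * \<bar>x\<bar> * \<bar>hermite_fun (Suc n) x\<bar>"]
      by (intro divide_right_mono add_mono mult_right_mono) auto
    also have "\<dots> = 2 * \<bar>x\<bar> * \<bar>hermite_fun (Suc n) x\<bar> + \<bar>hermite_fun n x\<bar>" using A by (simp add: field_simps)
    also have "\<dots> \<le> 2 * \<bar>x\<bar> * (1 + 2 * \<bar>x\<bar>) ^ Suc n + 1 * (1 + 2 * \<bar>x\<bar>) ^ n"
      using Suc by (intro add_mono mult_left_mono) auto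
    also have "\<dots> \<le> 2 * \<bar>x\<bar> * (1 + 2 * \<bar>x\<bar>) ^ Suc n + (1 + 2 * \<bar>x\<bar>) * (1 + 2 * \<bar>x\<bar>) ^ n"
      by (intro add_mono mult_right_mono) auto
    also have "\<dots> = (1 + 2 * \<bar>x\<bar>) ^ Suc (Suc n)" by (simp add: algebra_simps)
    finally show ?case using Suc by blast
  qed
  then show ?thesis by blast
qed

section \<open>Schwartz functions and square-integrable functions\<close>

text \<open>
  Amplitudes are polynomials in \<open>y\<close> and a parameter \<open>s\<close>. Keeping \<open>s\<close> as a variable makes the bounds on
  amplitudes times Gaussians uniform for \<open>s\<close> in the unit interval; where no parameter is present, \<open>s = 0\<close>.
\<close>

inductive_set amp :: "(real \<Rightarrow> real \<Rightarrow> complex) set" where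
  const: "(\<lambda>s y. c) \<in> amp"
| param: "(\<lambda>s y. complex_of_real s) \<in> amp"
| var: "(\<lambda>s y. complex_of_real y) \<in> amp"
| add: "f \<in> amp \<Longrightarrow> g \<in> amp \<Longrightarrow> (\<lambda>s y. f s y + g s y) \<in> amp"
| mult: "f \<in> amp \<Longrightarrow> g \<in> amp \<Longrightarrow> (\<lambda>s y. f s y * g s y) \<in> amp"

lemma amp_bound:
  "f \<in> amp \<Longrightarrow> \<exists>C\<ge>0. \<exists>d\<ge>0. \<forall>s\<in>{0..1}. \<forall>y. cmod (f s y) \<le> C * exp (d * \<bar>y\<bar>)"
proof (induction rule: amp.induct)
  case (const c)
  show ?case by (rule exI[of _ "cmod c"], simp, rule exI[of _ 0]) simp
next
  case param
  show ?case by (rule exI[of _ 1], simp, rule exI[of _ 0]) simp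
next
  case var
  have "\<bar>y\<bar> \<le> exp \<bar>y\<bar>" for y :: real
    using order_trans[OF _ exp_ge_add_one_self[of "\<bar>y\<bar>"]] by simp
  then show ?case by (intro exI[of _ 1] conjI) simp_all
next
  case (add f g)
  then obtain C d C' d' where *: "C \<ge> 0" "d \<ge> 0" "C' \<ge> 0" "d' \<ge> 0"
    "\<And>s y. s \<in> {0..1} \<Longrightarrow> cmod (f s y) \<le> C * exp (d * \<bar>y\<bar>)"
    "\<And>s y. s \<in> {0..1} \<Longrightarrow> cmod (g s y) \<le> C' * exp (d' * \<bar>y\<bar>)" by metis
  have "cmod (f s y + g s y) \<le> (C + C') * exp ((d + d') * \<bar>y\<bar>)" if "s \<in> {0..1}" for s y
  proof -
    have "C * exp (d * \<bar>y\<bar>) \<le> C * exp ((d + d') * \<bar>y\<bar>)" "C' * exp (d' * \<bar>y\<bar>) \<le> C' * exp ((d + d') * \<bar>y\<bar>)"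
      using * by (auto intro!: mult_left_mono mult_right_mono)
    then show ?thesis using *(5,6)[OF that, of y] norm_triangle_ineq[of "f s y" "g s y"]
      by (simp add: distrib_right)
  qed
  then show ?case using * by (intro exI[of _ "C + C'"] conjI exI[of _ "d + d'"]) auto
next
  case (mult f g)
  then obtain C d C' d' where *: "C \<ge> 0" "d \<ge> 0" "C' \<ge> 0" "d' \<ge> 0"
    "\<And>s y. s \<in> {0..1} \<Longrightarrow> cmod (f s y) \<le> C * exp (d * \<bar>y\<bar>)"
    "\<And>s y. s \<in> {0..1} \<Longrightarrow> cmod (g s y) \<le> C' * exp (d' * \<bar>y\<bar>)" by metis
  have "cmod (f s y * g s y) \<le> (C * C') * exp ((d + d') * \<bar>y\<bar>)" if "s \<in> {0..1}" for s y
  proof -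
    have "cmod (f s y * g s y) \<le> (C * exp (d * \<bar>y\<bar>)) * (C' * exp (d' * \<bar>y\<bar>))"
      unfolding norm_mult using * that by (intro mult_mono) auto
    then show ?thesis by (simp add: distrib_right exp_add mult_ac distrib_left)
  qed
  then show ?case using * by (intro exI[of _ "C * C'"] conjI exI[of _ "d + d'"]) auto
qed

lemma amp_deriv:
  "f \<in> amp \<Longrightarrow> \<exists>f'\<in>amp. \<forall>s y. (f s has_vector_derivative f' s y) (at y)"
proof (induction rule: amp.induct)
  case (const c)
  show ?case by (rule bexI[OF _ amp.const[of 0]]) auto
next
  case param
  show ?case by (rule bexI[OF _ amp.const[of 0]]) auto
next
  case var
  show ?case by (rule bexI[OF _ amp.const[of 1]]) (auto intro!: derivative_eq_intros)
next
  case (add f g)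
  then obtain f' g' where *: "f' \<in> amp" "g' \<in> amp" "\<And>s y. (f s has_vector_derivative f' s y) (at y)"
    "\<And>s y. (g s has_vector_derivative g' s y) (at y)" by metis
  show ?case
    by (rule bexI[OF _ amp.add[OF *(1,2)]]) (auto intro!: has_vector_derivative_add *)
next
  case (mult f g)
  then obtain f' g' where *: "f' \<in> amp" "g' \<in> amp" "\<And>s y. (f s has_vector_derivative f' s y) (at y)"
    "\<And>s y. (g s has_vector_derivative g' s y) (at y)" by metis
  show ?case
    by (rule bexI[OF _ amp.add[OF amp.mult[OF mult(1) *(2)] amp.mult[OF *(1) mult(2)]]])
      (auto intro!: has_vector_derivative_mult *)
qed

section \<open>Schwartz functions built from modulated Gaussians\<close>

definition gwave :: "real \<Rightarrow> real \<Rightarrow> complex" where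
  "gwave w y = exp (complex_of_real (- y\<^sup>2 / 2) + \<i> * complex_of_real (w * y))"

lemma has_vector_derivative_exp_quadratic:
  fixes q q' :: "real \<Rightarrow> complex"
  assumes "(q has_vector_derivative d) (at y)"
  shows "((\<lambda>y. exp (q y)) has_vector_derivative d * exp (q y)) (at y)"
  using field_vector_diff_chain_at[OF assms, of exp "exp (q y)"] DERIV_exp
  by (simp add: o_def has_field_derivative_at_within)

lemma gwave_deriv:
  "(gwave w has_vector_derivative (- complex_of_real y + \<i> * of_real w) * gwave w y) (at y)"
proof -
  have "((\<lambda>y. complex_of_real (- y\<^sup>2 / 2) + \<i> * complex_of_real (w * y)) has_vector_derivative
      (- complex_of_real y + \<i> * of_real w)) (at y)"
    by (rule has_vector_derivative_eq_rhs, (rule derivative_intros)+)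
      (auto intro!: derivative_eq_intros simp flip: has_real_derivative_iff_has_vector_derivative)
  from has_vector_derivative_exp_quadratic[OF this] show ?thesis by (simp add: gwave_def[abs_def])
qed

lemma norm_gwave: "cmod (gwave w y) = exp (- y\<^sup>2 / 2)"
  by (simp add: gwave_def)

lemma D1_amp_gwave:
  assumes "f \<in> amp"
  shows "\<exists>g\<in>amp. \<forall>y. ((\<lambda>y. f 0 y * gwave w y) has_vector_derivative g 0 y * gwave w y) (at y)"
proof -
  obtain f' where f': "f' \<in> amp" "\<And>s y. (f s has_vector_derivative f' s y) (at y)"
    using amp_deriv[OF assms] by metis
  define g where "g s y = f' s y + f s y * (-1 * complex_of_real y + \<i> * of_real w)" for s y
  have "g \<in> amp" unfolding g_def[abs_def] by (intro amp.intros assms f')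
  moreover have "((\<lambda>y. f 0 y * gwave w y) has_vector_derivative g 0 y * gwave w y) (at y)" for y
    using has_vector_derivative_mult[OF f'(2)[of 0 y] gwave_deriv[of w y]]
    by (simp add: g_def algebra_simps)
  ultimately show ?thesis by blast
qed

lemma D1_eqI: "(\<And>x. (f has_vector_derivative f' x) (at x)) \<Longrightarrow> D1 f = f'"
  unfolding D1_def by (auto intro!: vector_derivative_at)

lemma amp_gwave_decay: "f \<in> amp \<Longrightarrow> gauss_decay (\<lambda>y. f 0 y * gwave w y)"
proof -
  assume "f \<in> amp"
  then obtain C d where "\<And>y. cmod (f 0 y) \<le> C * exp (d * \<bar>y\<bar>)" using amp_bound[of f] by force
  moreover have "gauss_decay (gwave w)"
    by (rule gauss_decayI[of "1/2" _ 1]) (simp_all add: norm_gwave)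
  ultimately show ?thesis by (intro gauss_decay_mult_exp)
qed

text \<open>Amplitudes times one fixed modulated Gaussian are stable under \<open>D1\<close> and
  under multiplication by y, and all of them are bounded. Frequency 0 covers the Hermite functions;
  free frequencies later turn testing against Schwartz functions into a statement on Fourier
  transforms.\<close>

lemma amp_gwave_schwartz:
  assumes "f \<in> amp" shows "(\<lambda>y. f 0 y * gwave w y) \<in> schwartz"
proof -
  have D: "\<exists>g\<in>amp. (D1 ^^ n) (\<lambda>y. f 0 y * gwave w y) = (\<lambda>y. g 0 y * gwave w y)" for n
  proof (induction n)
    case (Suc n)
    then obtain g where g: "g \<in> amp" "(D1 ^^ n) (\<lambda>y. f 0 y * gwave w y) = (\<lambda>y. g 0 y * gwave w y)"
      by blast
    obtain g' where "g' \<in> amp" "\<And>y. ((\<lambda>y. g 0 y * gwave w y) has_vector_derivative g' 0 y * gwave w y) (at y)"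
      using D1_amp_gwave[OF g(1)] by blast
    then show ?case using g(2) D1_eqI by (auto intro!: bexI[of _ g'])
  qed (use assms in auto)
  have "(D1 ^^ n) (\<lambda>y. f 0 y * gwave w y) differentiable (at x)" for n x
  proof -
    obtain g where g: "g \<in> amp" "(D1 ^^ n) (\<lambda>y. f 0 y * gwave w y) = (\<lambda>y. g 0 y * gwave w y)"
      using D by blast
    show ?thesis using D1_amp_gwave[OF g(1), of w] unfolding g(2) by (auto intro: differentiableI_vector)
  qed
  moreover have "\<exists>B. \<forall>x. \<bar>x\<bar> ^ m * cmod ((D1 ^^ n) (\<lambda>y. f 0 y * gwave w y) x) \<le> B" for m n
  proof -
    obtain g where g: "g \<in> amp" "(D1 ^^ n) (\<lambda>y. f 0 y * gwave w y) = (\<lambda>y. g 0 y * gwave w y)"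
      using D by blast
    have "(\<lambda>s y. complex_of_real y ^ m * g s y) \<in> amp"
    proof (induction m)
      case (Suc m)
      then show ?case using amp.mult[OF amp.var Suc] by (simp add: mult.assoc)
    qed (use g in simp)
    from gauss_decay_bounded[OF amp_gwave_decay[OF this, of w]] show ?thesis
      by (simp add: g norm_mult norm_power mult.assoc)
  qed
  ultimately show ?thesis unfolding schwartz_def by blast
qed

definition hermite_c :: "nat \<Rightarrow> real \<Rightarrow> complex" where
  "hermite_c n x = complex_of_real (hermite_fun n x)"

lemma hermite_c_amp: "\<exists>f\<in>amp. hermite_c n = (\<lambda>y. f 0 y * gwave 0 y)"
proof -
  have rec: "\<exists>h\<in>amp. (\<lambda>y. a * complex_of_real y * (f 0 y * gwave 0 y) + b * (g 0 y * gwave 0 y))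
      = (\<lambda>y. h 0 y * gwave 0 y)" if "f \<in> amp" "g \<in> amp" for f g a b
    by (rule bexI[of _ "\<lambda>s y. a * complex_of_real y * f s y + b * g s y"])
      (auto intro!: amp.intros that simp: algebra_simps)
  have h0: "hermite_c 0 = (\<lambda>y. of_real (1 / sqrt (sqrt pi)) * gwave 0 y)"
    by (auto simp: hermite_c_def hermite_fun.simps gwave_def exp_of_real[symmetric])
  have "(\<exists>f\<in>amp. hermite_c n = (\<lambda>y. f 0 y * gwave 0 y)) \<and> (\<exists>f\<in>amp. hermite_c (Suc n) = (\<lambda>y. f 0 y * gwave 0 y))"
  proof (induction n)
    case 0
    have "hermite_c (Suc 0) = (\<lambda>y. (\<lambda>s y. of_real (sqrt 2) * complex_of_real y * of_real (1 / sqrt (sqrt pi))) 0 y * gwave 0 y)"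
    proof -
      have "hermite_c (Suc 0) y = of_real (sqrt 2) * of_real y * hermite_c 0 y" for y
        by (simp add: hermite_c_def hermite_fun.simps(2))
      then show ?thesis unfolding h0 by (simp add: fun_eq_iff)
    qed
    then have "\<exists>f\<in>amp. hermite_c (Suc 0) = (\<lambda>y. f 0 y * gwave 0 y)"
      by (intro bexI[of _ "\<lambda>s y. of_real (sqrt 2) * complex_of_real y * of_real (1 / sqrt (sqrt pi))"]
          amp.intros) simp
    moreover have "\<exists>f\<in>amp. hermite_c 0 = (\<lambda>y. f 0 y * gwave 0 y)"
      using h0 by (intro bexI[OF _ amp.const[of "of_real (1 / sqrt (sqrt pi))"]]) simp
    ultimately show ?case by blast
  next
    case (Suc n)
    then obtain f g where fg: "f \<in> amp" "g \<in> amp" "hermite_c n = (\<lambda>y. f 0 y * gwave 0 y)" "hermite_c (Suc n) = (\<lambda>y. g 0 y * gwave 0 y)"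
      by blast
    have "hermite_c (Suc (Suc n)) = (\<lambda>y. of_real (2 / sqrt (2 * real (Suc (Suc n)))) * complex_of_real y * hermite_c (Suc n) y
        + of_real (- sqrt (2 * real (Suc n)) / sqrt (2 * real (Suc (Suc n)))) * hermite_c n y)"
      by (auto simp: fun_eq_iff hermite_c_def hermite_fun.simps(3) diff_divide_distrib simp del: of_nat_Suc)
    moreover have "\<exists>h\<in>amp. \<dots> = (\<lambda>y. h 0 y * gwave 0 y)"
      unfolding fg(3,4) by (rule rec[OF fg(2,1)])
    ultimately show ?case using Suc by simp
  qed
  then show ?thesis by blast
qed

lemma hermite_c_schwartz: "hermite_c n \<in> schwartz"
  using hermite_c_amp[of n] amp_gwave_schwartz[of _ 0] by force

section \<open>Linear structure and continuity of Schwartz functions\<close>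

lemma schwartz_deriv:
  assumes "\<phi> \<in> schwartz"
  shows "((D1 ^^ n) \<phi> has_vector_derivative (D1 ^^ Suc n) \<phi> x) (at x)"
proof -
  have "(D1 ^^ n) \<phi> differentiable (at x)" using assms by (simp add: schwartz_def)
  then have "((D1 ^^ n) \<phi> has_vector_derivative D1 ((D1 ^^ n) \<phi>) x) (at x)"
    unfolding D1_def[of "(D1 ^^ n) \<phi>"] by (rule vector_derivative_works[THEN iffD1])
  then show ?thesis by simp
qed

lemma schwartz_continuous: "\<phi> \<in> schwartz \<Longrightarrow> continuous_on UNIV ((D1 ^^ n) \<phi>)"
  by (intro continuous_at_imp_continuous_on ballI has_vector_derivative_continuous[OF schwartz_deriv])

lemma schwartz_bounded: "\<phi> \<in> schwartz \<Longrightarrow> \<exists>B. \<forall>x. \<bar>x\<bar> ^ m * cmod ((D1 ^^ n) \<phi> x) \<le> B"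
  by (simp add: schwartz_def)

lemma schwartz_add:
  assumes "f \<in> schwartz" "g \<in> schwartz" shows "(\<lambda>x. f x + g x) \<in> schwartz"
    and "(D1 ^^ n) (\<lambda>x. f x + g x) = (\<lambda>x. (D1 ^^ n) f x + (D1 ^^ n) g x)"
proof -
  have D: "(D1 ^^ n) (\<lambda>x. f x + g x) = (\<lambda>x. (D1 ^^ n) f x + (D1 ^^ n) g x)" for n
  proof (induction n)
    case (Suc n)
    have "D1 (\<lambda>x. (D1 ^^ n) f x + (D1 ^^ n) g x) = (\<lambda>x. (D1 ^^ Suc n) f x + (D1 ^^ Suc n) g x)"
      by (intro D1_eqI has_vector_derivative_add schwartz_deriv assms)
    then show ?case using Suc by simp
  qed simp
  then show "(D1 ^^ n) (\<lambda>x. f x + g x) = (\<lambda>x. (D1 ^^ n) f x + (D1 ^^ n) g x)" .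
  have "\<exists>B. \<forall>x. \<bar>x\<bar> ^ m * cmod ((D1 ^^ n) f x + (D1 ^^ n) g x) \<le> B" for m n
  proof -
    obtain B B' where "\<And>x. \<bar>x\<bar> ^ m * cmod ((D1 ^^ n) f x) \<le> B" "\<And>x. \<bar>x\<bar> ^ m * cmod ((D1 ^^ n) g x) \<le> B'"
      using schwartz_bounded[OF assms(1)] schwartz_bounded[OF assms(2)] by blast
    moreover have "\<bar>x\<bar> ^ m * cmod ((D1 ^^ n) f x + (D1 ^^ n) g x)
        \<le> \<bar>x\<bar> ^ m * cmod ((D1 ^^ n) f x) + \<bar>x\<bar> ^ m * cmod ((D1 ^^ n) g x)" for x
      unfolding distrib_left[symmetric] by (intro mult_left_mono norm_triangle_ineq) simp
    ultimately show ?thesis by (meson add_mono order_trans)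
  qed
  moreover have "(\<lambda>x. (D1 ^^ n) f x + (D1 ^^ n) g x) differentiable at x" for n x
    using assms by (auto simp: schwartz_def)
  ultimately show "(\<lambda>x. f x + g x) \<in> schwartz" unfolding schwartz_def mem_Collect_eq D by blast
qed

lemma schwartz_cmult:
  assumes "f \<in> schwartz" shows "(\<lambda>x. c * f x) \<in> schwartz"
    and "(D1 ^^ n) (\<lambda>x. c * f x) = (\<lambda>x. c * (D1 ^^ n) f x)"
proof -
  have D: "(D1 ^^ n) (\<lambda>x. c * f x) = (\<lambda>x. c * (D1 ^^ n) f x)" for n
  proof (induction n)
    case (Suc n)
    have "D1 (\<lambda>x. c * (D1 ^^ n) f x) = (\<lambda>x. c * (D1 ^^ Suc n) f x)"
      by (intro D1_eqI has_vector_derivative_mult_right schwartz_deriv assms)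
    then show ?case using Suc by simp
  qed simp
  then show "(D1 ^^ n) (\<lambda>x. c * f x) = (\<lambda>x. c * (D1 ^^ n) f x)" .
  have "\<exists>B. \<forall>x. \<bar>x\<bar> ^ m * cmod (c * (D1 ^^ n) f x) \<le> B" for m n
  proof -
    obtain B where "\<And>x. \<bar>x\<bar> ^ m * cmod ((D1 ^^ n) f x) \<le> B"
      using schwartz_bounded[OF assms] by blast
    then have "\<bar>x\<bar> ^ m * cmod (c * (D1 ^^ n) f x) \<le> cmod c * B" for x
      by (simp add: norm_mult mult.left_commute mult_left_mono)
    then show ?thesis by blast
  qed
  moreover have "(\<lambda>x. c * (D1 ^^ n) f x) differentiable at x" for n x
    using assms by (auto simp: schwartz_def)
  ultimately show "(\<lambda>x. c * f x) \<in> schwartz" unfolding schwartz_def mem_Collect_eq D by blast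
qed

section \<open>The space of square-integrable functions\<close>

lemma L2_I:
  assumes "f \<in> borel_measurable lborel" "integrable lborel (\<lambda>x. (cmod (f x))\<^sup>2)" shows "f \<in> L2"
  using assms by (simp add: L2_def)

lemma L2_measurable: "f \<in> L2 \<Longrightarrow> f \<in> borel_measurable lborel"
  and L2_integrable: "f \<in> L2 \<Longrightarrow> integrable lborel (\<lambda>x. (cmod (f x))\<^sup>2)"
  by (simp_all add: L2_def)

lemma L2_mult_integrable:
  assumes "f \<in> L2" "g \<in> L2"
  shows "integrable lborel (\<lambda>x. f x * g x)" "integrable lborel (\<lambda>x. cmod (f x) * cmod (g x))"
proof -
  note [measurable] = assms[THEN L2_measurable]
  have int: "integrable lborel (\<lambda>x. (cmod (f x))\<^sup>2 + (cmod (g x))\<^sup>2)"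
    using assms L2_integrable by auto
  have le: "cmod (f x) * cmod (g x) \<le> (cmod (f x))\<^sup>2 + (cmod (g x))\<^sup>2" for x
    using sum_squares_bound[of "cmod (f x)" "cmod (g x)"]
      mult_nonneg_nonneg[OF norm_ge_zero[of "f x"] norm_ge_zero[of "g x"]]
    by linarith
  show "integrable lborel (\<lambda>x. f x * g x)"
    by (rule Bochner_Integration.integrable_bound[OF int]) (auto simp: norm_mult intro!: AE_I2 le)
  show "integrable lborel (\<lambda>x. cmod (f x) * cmod (g x))"
    by (rule Bochner_Integration.integrable_bound[OF int]) (auto intro!: AE_I2 le)
qed

lemma L2norm_nonneg: "0 \<le> L2norm f"
  by (simp add: L2norm_def)

lemma L2norm_sq: "(L2norm f)\<^sup>2 = (\<integral>x. (cmod (f x))\<^sup>2 \<partial>lborel)"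
  by (simp add: L2norm_def)

text \<open>Integrate \<open>2 t |f| |g| \<le> t^2 |f|^2 + |g|^2\<close> and take for t the quotient
  of the norms of g and f. Other values of t exclude that one of the norms vanishes while the
  integral is positive.\<close>

lemma Cauchy_Schwarz_L2:
  assumes "f \<in> L2" "g \<in> L2"
  shows "(\<integral>x. cmod (f x) * cmod (g x) \<partial>lborel) \<le> L2norm f * L2norm g"
proof -
  define I where "I = (\<integral>x. cmod (f x) * cmod (g x) \<partial>lborel)"
  have I0: "I \<ge> 0" unfolding I_def by simp
  have *: "2 * t * I \<le> t\<^sup>2 * (L2norm f)\<^sup>2 + (L2norm g)\<^sup>2" for t
  proof -
    have "(\<integral>x. 2 * t * (cmod (f x) * cmod (g x)) \<partial>lborel) \<le> (\<integral>x. t\<^sup>2 * (cmod (f x))\<^sup>2 + (cmod (g x))\<^sup>2 \<partial>lborel)"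
    proof (rule integral_mono)
      show "2 * t * (cmod (f x) * cmod (g x)) \<le> t\<^sup>2 * (cmod (f x))\<^sup>2 + (cmod (g x))\<^sup>2" for x
        using sum_squares_bound[of "t * cmod (f x)" "cmod (g x)"] by (simp add: power_mult_distrib mult_ac)
    qed (use assms in \<open>auto intro!: L2_mult_integrable L2_integrable\<close>)
    then show ?thesis using assms L2_integrable by (simp add: L2norm_sq I_def)
  qed
  have "I \<le> L2norm f * L2norm g"
  proof (cases "I = 0")
    case False
    then have I: "I > 0" using I0 by simp
    have "L2norm f \<noteq> 0"
      using *[of "((L2norm g)\<^sup>2 + 1) / (2 * I)"] I by auto
    then have f: "L2norm f > 0" using L2norm_nonneg[of f] by simp
    have "L2norm g \<noteq> 0"
    proof
      assume "L2norm g = 0"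
      then have "2 * (I / (L2norm f)\<^sup>2) * I \<le> (I / (L2norm f)\<^sup>2)\<^sup>2 * (L2norm f)\<^sup>2"
        using *[of "I / (L2norm f)\<^sup>2"] by simp
      also have "\<dots> = (I / (L2norm f)\<^sup>2) * I" using f by (simp add: power2_eq_square)
      finally have "(I / (L2norm f)\<^sup>2) * I \<le> 0" by simp
      moreover have "(I / (L2norm f)\<^sup>2) * I > 0" using I f by simp
      ultimately show False by simp
    qed
    then have g: "L2norm g > 0" using L2norm_nonneg[of g] by simp
    have "2 * (L2norm g / L2norm f) * I \<le> 2 * (L2norm g)\<^sup>2"
      using *[of "L2norm g / L2norm f"] f by (simp add: power_divide)
    then show ?thesis using f g by (simp add: field_simps power2_eq_square)
  qed (simp add: L2norm_nonneg)
  then show ?thesis by (simp add: I_def)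
qed

lemma pairing_le_L2norm:
  assumes "f \<in> L2" "g \<in> L2" shows "cmod (pairing f g) \<le> L2norm f * L2norm g"
proof -
  have "cmod (pairing f g) \<le> (\<integral>x. cmod (f x * g x) \<partial>lborel)"
    unfolding pairing_def by (rule integral_norm_bound)
  then show ?thesis using Cauchy_Schwarz_L2[OF assms] by (simp add: norm_mult)
qed

lemma L2_add:
  assumes "f \<in> L2" "g \<in> L2" shows "(\<lambda>x. f x + g x) \<in> L2"
proof (rule L2_I)
  note [measurable] = assms[THEN L2_measurable]
  show "(\<lambda>x. f x + g x) \<in> borel_measurable lborel" by measurable
  show "integrable lborel (\<lambda>x. (cmod (f x + g x))\<^sup>2)"
  proof (rule Bochner_Integration.integrable_bound)
    show "integrable lborel (\<lambda>x. 2 * (cmod (f x))\<^sup>2 + 2 * (cmod (g x))\<^sup>2)"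
      using assms L2_integrable by auto
    have "(cmod (f x + g x))\<^sup>2 \<le> 2 * (cmod (f x))\<^sup>2 + 2 * (cmod (g x))\<^sup>2" for x
    proof -
      have "(cmod (f x + g x))\<^sup>2 \<le> (cmod (f x) + cmod (g x))\<^sup>2"
        by (intro power_mono norm_triangle_ineq) auto
      then show ?thesis using sum_squares_bound[of "cmod (f x)" "cmod (g x)"] by (simp add: power2_sum)
    qed
    then show "AE x in lborel. norm ((cmod (f x + g x))\<^sup>2) \<le> norm (2 * (cmod (f x))\<^sup>2 + 2 * (cmod (g x))\<^sup>2)"
      by (auto intro!: AE_I2)
  qed measurable
qed

lemma L2_cmult: "f \<in> L2 \<Longrightarrow> (\<lambda>x. c * f x) \<in> L2"
  unfolding L2_def by (auto simp: norm_mult power_mult_distrib)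

lemma L2norm_cmult: "L2norm (\<lambda>x. c * f x) = cmod c * L2norm f"
  unfolding L2norm_def by (simp add: norm_mult power_mult_distrib real_sqrt_mult)

lemma L2_diff: "f \<in> L2 \<Longrightarrow> g \<in> L2 \<Longrightarrow> (\<lambda>x. f x - g x) \<in> L2"
  using L2_add[of f "\<lambda>x. -1 * g x"] L2_cmult[of g "-1"] by simp

lemma L2norm_triangle:
  assumes "f \<in> L2" "g \<in> L2" shows "L2norm (\<lambda>x. f x + g x) \<le> L2norm f + L2norm g"
proof (rule power2_le_imp_le)
  have "(L2norm (\<lambda>x. f x + g x))\<^sup>2 \<le> (\<integral>x. (cmod (f x))\<^sup>2 + (cmod (g x))\<^sup>2 + 2 * (cmod (f x) * cmod (g x)) \<partial>lborel)"
    unfolding L2norm_sq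
  proof (rule integral_mono)
    show "(cmod (f x + g x))\<^sup>2 \<le> (cmod (f x))\<^sup>2 + (cmod (g x))\<^sup>2 + 2 * (cmod (f x) * cmod (g x))" for x
      using power_mono[OF norm_triangle_ineq[of "f x" "g x"] norm_ge_zero, of 2] by (simp add: power2_sum)
  qed (use assms in \<open>auto intro!: L2_mult_integrable L2_integrable L2_add\<close>)
  also have "\<dots> = (L2norm f)\<^sup>2 + (L2norm g)\<^sup>2 + 2 * (\<integral>x. cmod (f x) * cmod (g x) \<partial>lborel)"
    using assms L2_integrable L2_mult_integrable by (simp add: L2norm_sq)
  also have "\<dots> \<le> (L2norm f + L2norm g)\<^sup>2"
    using Cauchy_Schwarz_L2[OF assms] by (simp add: power2_sum)
  finally show "(L2norm (\<lambda>x. f x + g x))\<^sup>2 \<le> (L2norm f + L2norm g)\<^sup>2" .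
qed (simp add: L2norm_nonneg)

lemma schwartz_L2:
  assumes "\<phi> \<in> schwartz" shows "(\<lambda>x. complex_of_real (x ^ m) * (D1 ^^ n) \<phi> x) \<in> L2"
proof -
  have cont: "continuous_on UNIV ((D1 ^^ n) \<phi>)" by (rule schwartz_continuous[OF assms])
  note [measurable] = borel_measurable_continuous_onI[OF cont]
  \<comment> \<open>Two more powers of |x| produce the weight 1 + x^2: the bounds y \<le> A and y (1
    + x^2) \<le> A + B multiply to an integrable bound for y^2.\<close>
  obtain A B where A: "\<And>x. \<bar>x\<bar> ^ m * cmod ((D1 ^^ n) \<phi> x) \<le> A" and B: "\<And>x. \<bar>x\<bar> ^ (m + 2) * cmod ((D1 ^^ n) \<phi> x) \<le> B"
    using schwartz_bounded[OF assms] by blast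
  show ?thesis
  proof (rule L2_I)
    show "integrable lborel (\<lambda>x. (cmod (complex_of_real (x ^ m) * (D1 ^^ n) \<phi> x))\<^sup>2)"
    proof (rule Bochner_Integration.integrable_bound)
      show "integrable lborel (\<lambda>x::real. A * (A + B) * inverse (1 + x\<^sup>2))"
        using integrable_inverse_1_plus_square by (simp add: set_integrable_def)
      have "(cmod (complex_of_real (x ^ m) * (D1 ^^ n) \<phi> x))\<^sup>2 \<le> A * (A + B) * inverse (1 + x\<^sup>2)" for x
      proof -
        define y where "y = \<bar>x\<bar> ^ m * cmod ((D1 ^^ n) \<phi> x)"
        have "\<bar>x\<bar> ^ (m + 2) * cmod ((D1 ^^ n) \<phi> x) = x\<^sup>2 * y"
          by (simp add: y_def power_add power2_eq_square)
        then have "x\<^sup>2 * y \<le> B" using B[of x] by (simp only:)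
        then have y: "0 \<le> y" "y \<le> A" "x\<^sup>2 * y \<le> B"
          using A[of x] by (auto simp: y_def)
        have "y * (y * (1 + x\<^sup>2)) \<le> A * (A + B)" using y by (intro mult_mono) (auto simp: algebra_simps)
        then have "y\<^sup>2 \<le> A * (A + B) * inverse (1 + x\<^sup>2)"
          by (simp add: divide_inverse[symmetric] pos_le_divide_eq power2_eq_square add_pos_nonneg mult_ac)
        then show ?thesis by (simp add: y_def norm_mult norm_power)
      qed
      then show "AE x in lborel. norm ((cmod (complex_of_real (x ^ m) * (D1 ^^ n) \<phi> x))\<^sup>2) \<le> norm (A * (A + B) * inverse (1 + x\<^sup>2))"
        by (auto intro!: AE_I2 order_trans[OF _ abs_ge_self])
    qed measurable
  qed measurable
qed

lemma harm_L2: "\<phi> \<in> schwartz \<Longrightarrow> harm \<phi> \<in> L2"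
  using L2_cmult[OF L2_diff[OF schwartz_L2[of \<phi> 2 0] schwartz_L2[of \<phi> 0 2]], of "1/2"]
  by (simp add: harm_def[abs_def] field_simps)

lemma schwartz_subset_L2: "\<phi> \<in> schwartz \<Longrightarrow> \<phi> \<in> L2"
  using schwartz_L2[of \<phi> 0 0] by simp

section \<open>Hermite series with rapidly decaying coefficients\<close>

text \<open>
  With decay faster than geometric, the crude bound \<open>(1 + 2\<bar>x\<bar>)\<^sup>n\<close> on Hermite functions suffices for
  pointwise convergence of the series.
\<close>

definition rapid :: "(nat \<Rightarrow> complex) \<Rightarrow> bool" where
  "rapid c \<longleftrightarrow> (\<forall>R\<ge>0. \<exists>B. \<forall>n. cmod (c n) * R ^ n \<le> B)"

definition hermite_sum :: "nat \<Rightarrow> (nat \<Rightarrow> complex) \<Rightarrow> real \<Rightarrow> complex" where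
  "hermite_sum N c x = (\<Sum>n<N. c n * hermite_c n x)"

definition hermite_series :: "(nat \<Rightarrow> complex) \<Rightarrow> real \<Rightarrow> complex" where
  "hermite_series c x = (\<Sum>n. c n * hermite_c n x)"

text \<open>The eigenvalue of the oscillator on the n-th Hermite function.\<close>

definition \<kappa> :: "nat \<Rightarrow> real" where
  "\<kappa> n = real n + 1 / 2"

section \<open>Calculus of rapidly decaying sequences\<close>

lemma rapid_summable:
  assumes "rapid c" "R \<ge> 0" shows "summable (\<lambda>n. cmod (c n) * R ^ n)"
proof -
  obtain B where B: "\<And>n. cmod (c n) * (2 * R) ^ n \<le> B"
    using assms unfolding rapid_def by (metis mult_nonneg_nonneg zero_le_numeral)
  show ?thesis
  proof (rule summable_comparison_test')
    show "summable (\<lambda>n. B * (1 / 2) ^ n)" by (intro summable_mult summable_geometric) simp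
    show "norm (cmod (c n) * R ^ n) \<le> B * (1 / 2) ^ n" for n
      using B[of n] assms(2) by (simp add: power_mult_distrib power_divide field_simps)
  qed
qed

lemma rapid_summable_norm: "rapid c \<Longrightarrow> summable (\<lambda>n. cmod (c n))"
  using rapid_summable[of c 1] by simp

lemma rapid_norm_le_summable:
  assumes "rapid c" "\<And>n. cmod (c' n) \<le> cmod (c n)" shows "rapid c'"
  unfolding rapid_def
proof (intro allI impI)
  fix R :: real assume "R \<ge> 0"
  then obtain B where "\<And>n. cmod (c n) * R ^ n \<le> B" using assms unfolding rapid_def by blast
  then have "cmod (c' n) * R ^ n \<le> B" for n
    using mult_right_mono[OF assms(2)[of n], of "R ^ n"] \<open>R \<ge> 0\<close> order_trans by fastforce
  then show "\<exists>B. \<forall>n. cmod (c' n) * R ^ n \<le> B" by blast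
qed

lemma rapid_add:
  assumes "rapid c" "rapid d" shows "rapid (\<lambda>n. c n + d n)"
  unfolding rapid_def
proof (intro allI impI)
  fix R :: real assume R: "R \<ge> 0"
  then obtain B B' where B: "\<And>n. cmod (c n) * R ^ n \<le> B" "\<And>n. cmod (d n) * R ^ n \<le> B'"
    using assms unfolding rapid_def by meson
  have "cmod (c n + d n) * R ^ n \<le> B + B'" for n
    using mult_right_mono[OF norm_triangle_ineq[of "c n" "d n"], of "R ^ n"] R B[of n]
    by (simp add: algebra_simps)
  then show "\<exists>B. \<forall>n. cmod (c n + d n) * R ^ n \<le> B" by blast
qed

text \<open>Multipliers of geometric growth preserve the class because \<open>R\<close> in its
  definition is arbitrary: the factor \<open>2 ^ n\<close> is absorbed by passing from
  \<open>R\<close> to \<open>2 * R\<close>. Both \<open>\<kappa> n \<le> 2 ^ n\<close> and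
  \<open>inverse (\<kappa> n) \<le> 2\<close> fit this shape.\<close>

lemma rapid_mult:
  assumes "rapid c" "K \<ge> 0" "\<And>n. cmod (p n) \<le> K * 2 ^ n" shows "rapid (\<lambda>n. p n * c n)"
  unfolding rapid_def
proof (intro allI impI)
  fix R :: real assume R: "R \<ge> 0"
  then obtain B where B: "\<And>n. cmod (c n) * (2 * R) ^ n \<le> B"
    using assms unfolding rapid_def by (metis mult_nonneg_nonneg zero_le_numeral)
  have "cmod (p n * c n) * R ^ n \<le> K * B" for n
  proof -
    have "cmod (p n * c n) * R ^ n \<le> (K * 2 ^ n) * cmod (c n) * R ^ n"
      unfolding norm_mult using R assms by (intro mult_right_mono) auto
    also have "\<dots> = K * (cmod (c n) * (2 * R) ^ n)" by (simp add: power_mult_distrib)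
    finally show ?thesis using mult_left_mono[OF B[of n] assms(2)] by simp
  qed
  then show "\<exists>B. \<forall>n. cmod (p n * c n) * R ^ n \<le> B" by blast
qed

lemma rapid_cmult: "rapid c \<Longrightarrow> rapid (\<lambda>n. a * c n)"
  by (rule rapid_mult[of c "cmod a"]) (auto simp: mult_le_cancel_left1)

lemma rapid_diff: "rapid c \<Longrightarrow> rapid d \<Longrightarrow> rapid (\<lambda>n. c n - d n)"
  using rapid_add[OF _ rapid_cmult[of d "-1"]] by simp

lemma \<kappa>_pos: "\<kappa> n > 0" by (simp add: \<kappa>_def)

lemma \<kappa>_le_two_power: "\<kappa> n \<le> 2 ^ n"
proof -
  have "real (Suc n) \<le> 2 ^ n"
    by (metis less_exp Suc_leI of_nat_le_iff of_nat_numeral of_nat_power)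
  then show ?thesis by (simp add: \<kappa>_def)
qed

lemma rapid_\<kappa>: "rapid c \<Longrightarrow> rapid (\<lambda>n. of_real (\<kappa> n) * c n)"
  by (rule rapid_mult[of c 1]) (use \<kappa>_pos \<kappa>_le_two_power in \<open>auto simp: less_imp_le\<close>)

lemma rapid_inv_\<kappa>: "rapid c \<Longrightarrow> rapid (\<lambda>n. of_real (inverse (\<kappa> n)) * c n)"
proof (rule rapid_mult[of c 2])
  show "cmod (of_real (inverse (\<kappa> n))) \<le> 2 * 2 ^ n" for n
  proof -
    have "inverse (\<kappa> n) \<le> 2 * 1" by (simp add: \<kappa>_def field_simps)
    also have "\<dots> \<le> 2 * 2 ^ n" by (intro mult_left_mono) auto
    finally show ?thesis using \<kappa>_pos[of n] by (simp add: norm_inverse)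
  qed
qed auto

lemma rapid_\<kappa>_pow: "rapid c \<Longrightarrow> rapid (\<lambda>n. of_real (\<kappa> n ^ j) * c n)"
  by (induction j) (auto dest: rapid_\<kappa> simp: mult.assoc)

lemma rapid_inv_\<kappa>_pow: "rapid c \<Longrightarrow> rapid (\<lambda>n. of_real (inverse (\<kappa> n) ^ j) * c n)"
  by (induction j) (auto dest: rapid_inv_\<kappa> simp: mult.assoc)

lemma hermite_c_bound: "cmod (hermite_c n x) \<le> (1 + 2 * \<bar>x\<bar>) ^ n"
  using hermite_fun_pointwise_bound by (simp add: hermite_c_def)

lemma hermite_series_summable: "rapid c \<Longrightarrow> summable (\<lambda>n. c n * hermite_c n x)"
  by (rule summable_comparison_test'[OF rapid_summable[of c "1 + 2 * \<bar>x\<bar>"]])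
     (auto simp: norm_mult intro!: mult_left_mono hermite_c_bound)

lemma hermite_sum_tendsto: "rapid c \<Longrightarrow> (\<lambda>N. hermite_sum N c x) \<longlonglongrightarrow> hermite_series c x"
  unfolding hermite_sum_def hermite_series_def by (rule summable_LIMSEQ[OF hermite_series_summable])

lemma hermite_series_add: "rapid c \<Longrightarrow> rapid d \<Longrightarrow> hermite_series (\<lambda>n. c n + d n) x = hermite_series c x + hermite_series d x"
  unfolding hermite_series_def by (subst suminf_add) (auto intro: hermite_series_summable simp: algebra_simps)

lemma hermite_series_cmult: "rapid c \<Longrightarrow> hermite_series (\<lambda>n. a * c n) x = a * hermite_series c x"
  unfolding hermite_series_def by (subst suminf_mult[symmetric]) (auto intro: hermite_series_summable simp: algebra_simps)

lemma hermite_series_diff: "rapid c \<Longrightarrow> rapid d \<Longrightarrow> hermite_series (\<lambda>n. c n - d n) x = hermite_series c x - hermite_series d x"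
  using hermite_series_add[of c "\<lambda>n. -1 * d n"] hermite_series_cmult[of d "-1"] rapid_cmult[of d "-1"] by simp

lemma rapid_finite: assumes "\<And>n. n \<ge> N \<Longrightarrow> c n = 0" shows "rapid c"
  unfolding rapid_def
proof (intro allI impI exI)
  fix R :: real and n assume "R \<ge> 0"
  show "cmod (c n) * R ^ n \<le> (\<Sum>n<N. cmod (c n) * R ^ n)"
  proof (cases "n < N")
    case True
    then show ?thesis using \<open>R \<ge> 0\<close> by (intro member_le_sum) auto
  qed (use assms \<open>R \<ge> 0\<close> in \<open>auto intro!: sum_nonneg\<close>)
qed

lemma hermite_series_finite: assumes "\<And>n. n \<ge> N \<Longrightarrow> c n = 0" shows "hermite_series c = hermite_sum N c"
  unfolding hermite_series_def hermite_sum_def by (intro ext suminf_finite) (auto simp: assms not_less)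

section \<open>Parseval's identity for Hermite series\<close>

lemma hermite_c_measurable[measurable]: "hermite_c n \<in> borel_measurable borel"
  unfolding hermite_c_def[abs_def] by measurable

lemma hermite_c_L2: "hermite_c n \<in> L2" by (rule schwartz_subset_L2[OF hermite_c_schwartz])

lemma hermite_sum_measurable[measurable]: "hermite_sum N c \<in> borel_measurable borel"
  unfolding hermite_sum_def[abs_def] by measurable

lemma hermite_sum_Suc: "hermite_sum (Suc N) c = (\<lambda>x. hermite_sum N c x + c N * hermite_c N x)"
  by (auto simp: hermite_sum_def)

lemma hermite_sum_schwartz: "hermite_sum N c \<in> schwartz"
proof (induction N)
  case 0
  have "hermite_sum 0 c = (\<lambda>x. 0 * hermite_c 0 x)" by (auto simp: hermite_sum_def)
  then show ?case using schwartz_cmult(1)[OF hermite_c_schwartz[of 0], of 0] by simp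
next
  case (Suc N)
  then show ?case unfolding hermite_sum_Suc by (intro schwartz_add schwartz_cmult hermite_c_schwartz)
qed

lemma hermite_sum_L2: "hermite_sum N c \<in> L2" by (rule schwartz_subset_L2[OF hermite_sum_schwartz])

lemma norm_add_real_sq:
  "(cmod (a + b * of_real r))\<^sup>2 = (cmod a)\<^sup>2 + (cmod b)\<^sup>2 * r\<^sup>2 + 2 * (Re (a * cnj b) * r)"
  unfolding cmod_power2 by (simp add: power2_eq_square algebra_simps)

text \<open>Pythagoras, one term at a time. The new Hermite function is real, so the cross term is a
  real combination of products of distinct Hermite functions and integrates to 0.\<close>

lemma hermite_sum_L2norm: "(L2norm (hermite_sum N c))\<^sup>2 = (\<Sum>n<N. (cmod (c n))\<^sup>2)"
proof (induction N)
  case 0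
  then show ?case by (simp add: L2norm_sq hermite_sum_def)
next
  case (Suc N)
  have cross: "Re (hermite_sum N c x * cnj (c N)) * hermite_fun N x = (\<Sum>k<N. Re (c k * cnj (c N)) * (hermite_fun k x * hermite_fun N x))" for x
    unfolding hermite_sum_def sum_distrib_right Re_sum by (intro sum.cong) (auto simp: hermite_c_def algebra_simps)
  have crossint: "integrable lborel (\<lambda>x. Re (hermite_sum N c x * cnj (c N)) * hermite_fun N x)"
    unfolding cross by (intro Bochner_Integration.integrable_sum integrable_mult_right integrable_hermite_fun_hermite_fun)
  have "(\<integral>x. Re (hermite_sum N c x * cnj (c N)) * hermite_fun N x \<partial>lborel) = (\<Sum>k<N. Re (c k * cnj (c N)) * (\<integral>x. hermite_fun k x * hermite_fun N x \<partial>lborel))"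
    unfolding cross by (simp add: integrable_hermite_fun_hermite_fun)
  also have "\<dots> = 0" by (intro sum.neutral) (auto simp: hermite_fun_orthogonal)
  finally have crosszero: "(\<integral>x. Re (hermite_sum N c x * cnj (c N)) * hermite_fun N x \<partial>lborel) = 0" .
  have "(L2norm (hermite_sum (Suc N) c))\<^sup>2 = (\<integral>x. (cmod (hermite_sum N c x))\<^sup>2 + (cmod (c N))\<^sup>2 * (hermite_fun N x)\<^sup>2
     + 2 * (Re (hermite_sum N c x * cnj (c N)) * hermite_fun N x) \<partial>lborel)"
    unfolding L2norm_sq hermite_sum_Suc hermite_c_def norm_add_real_sq by simp
  also have "\<dots> = (L2norm (hermite_sum N c))\<^sup>2 + (cmod (c N))\<^sup>2"
    using L2_integrable[OF hermite_sum_L2, of N c] crossint integrable_hermite_fun_hermite_fun[of N N, folded power2_eq_square]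
      crosszero hermite_fun_normalized[of N]
    by (simp add: L2norm_sq)
  finally show ?case using Suc by simp
qed

lemma summable_norm_sq: "rapid c \<Longrightarrow> summable (\<lambda>n. (cmod (c n))\<^sup>2)"
proof -
  assume c: "rapid c"
  obtain B where B: "\<And>n. cmod (c n) \<le> B" using c unfolding rapid_def by (metis mult.right_neutral power_one zero_le_one)
  show ?thesis
  proof (rule summable_comparison_test')
    show "summable (\<lambda>n. B * cmod (c n))" by (intro summable_mult rapid_summable_norm c)
    show "norm ((cmod (c n))\<^sup>2) \<le> B * cmod (c n)" for n
      using B[of n] by (simp add: power2_eq_square mult_right_mono)
  qed
qed

lemma hermite_series_measurable: "rapid c \<Longrightarrow> hermite_series c \<in> borel_measurable borel"
  by (rule borel_measurable_LIMSEQ_metric[where f = "\<lambda>N. hermite_sum N c", OF _ hermite_sum_tendsto]) auto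

text \<open>Fatou's lemma along the pointwise convergent partial sums. It yields only an upper
  bound, but applied to the tails this bound gives norm convergence of the partial sums, and from
  that the equality.\<close>

lemma hermite_series_L2_aux:
  assumes c: "rapid c"
  shows "hermite_series c \<in> L2 \<and> (L2norm (hermite_series c))\<^sup>2 \<le> (\<Sum>n. (cmod (c n))\<^sup>2)"
proof -
  note [measurable] = hermite_series_measurable[OF c]
  define S where "S = (\<Sum>n. (cmod (c n))\<^sup>2)"
  have S: "S \<ge> 0" unfolding S_def by (intro suminf_nonneg summable_norm_sq c) auto
  have P: "(\<integral>\<^sup>+x. ennreal ((cmod (hermite_sum N c x))\<^sup>2) \<partial>lborel) \<le> ennreal S" for N
  proof -
    have "(\<integral>\<^sup>+x. ennreal ((cmod (hermite_sum N c x))\<^sup>2) \<partial>lborel) = ennreal ((L2norm (hermite_sum N c))\<^sup>2)"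
      unfolding L2norm_sq by (intro nn_integral_eq_integral L2_integrable hermite_sum_L2) auto
    also have "\<dots> \<le> ennreal S"
      unfolding hermite_sum_L2norm S_def by (intro ennreal_leI sum_le_suminf summable_norm_sq c) auto
    finally show ?thesis .
  qed
  have "(\<integral>\<^sup>+x. ennreal ((cmod (hermite_series c x))\<^sup>2) \<partial>lborel) = (\<integral>\<^sup>+x. liminf (\<lambda>N. ennreal ((cmod (hermite_sum N c x))\<^sup>2)) \<partial>lborel)"
  proof (rule nn_integral_cong)
    fix x
    have "(\<lambda>N. ennreal ((cmod (hermite_sum N c x))\<^sup>2)) \<longlonglongrightarrow> ennreal ((cmod (hermite_series c x))\<^sup>2)"
      by (intro tendsto_intros hermite_sum_tendsto c)
    then show "ennreal ((cmod (hermite_series c x))\<^sup>2) = liminf (\<lambda>N. ennreal ((cmod (hermite_sum N c x))\<^sup>2))"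
      by (rule lim_imp_Liminf[symmetric, rotated]) simp
  qed
  also have "\<dots> \<le> liminf (\<lambda>N. \<integral>\<^sup>+x. ennreal ((cmod (hermite_sum N c x))\<^sup>2) \<partial>lborel)"
    by (rule nn_integral_liminf) measurable
  also have "\<dots> \<le> liminf (\<lambda>N::nat. ennreal S)" by (intro Liminf_mono always_eventually allI P)
  also have "\<dots> = ennreal S" by (simp add: Liminf_const)
  finally have le: "(\<integral>\<^sup>+x. ennreal ((cmod (hermite_series c x))\<^sup>2) \<partial>lborel) \<le> ennreal S" .
  have int: "integrable lborel (\<lambda>x. (cmod (hermite_series c x))\<^sup>2)"
    by (rule integrableI_nonneg) (use le in \<open>auto simp: ennreal_less_top less_top le_less_trans\<close>)
  then have "hermite_series c \<in> L2" by (intro L2_I) auto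
  moreover have "(\<integral>x. (cmod (hermite_series c x))\<^sup>2 \<partial>lborel) \<le> S"
    using le int S by (subst (asm) nn_integral_eq_integral) auto
  ultimately show ?thesis by (simp add: L2norm_sq S_def)
qed

lemma hermite_series_L2: "rapid c \<Longrightarrow> hermite_series c \<in> L2"
  using hermite_series_L2_aux by blast

lemma hermite_series_tail:
  assumes "rapid c"
  shows "(\<lambda>x. hermite_series c x - hermite_sum N c x) = hermite_series (\<lambda>n. if n < N then 0 else c n)"
    "rapid (\<lambda>n. if n < N then 0 else c n)"
proof -
  have f: "rapid (\<lambda>n. if n < N then c n else 0)" by (rule rapid_finite[of N]) auto
  have "hermite_series (\<lambda>n. if n < N then c n else 0) = hermite_sum N c"
    by (subst hermite_series_finite[of N]) (auto simp: hermite_sum_def)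
  moreover have "(\<lambda>n. if n < N then 0 else c n) = (\<lambda>n. c n - (if n < N then c n else 0))" by auto
  ultimately show "(\<lambda>x. hermite_series c x - hermite_sum N c x) = hermite_series (\<lambda>n. if n < N then 0 else c n)"
    using hermite_series_diff[OF assms f] by (simp add: fun_eq_iff)
  show "rapid (\<lambda>n. if n < N then 0 else c n)" by (rule rapid_norm_le_summable[OF assms]) auto
qed

lemma suminf_tail:
  fixes f :: "nat \<Rightarrow> real"
  assumes "summable f"
  shows "(\<Sum>n. if n < N then 0 else f n) = suminf f - sum f {..<N}"
proof -
  have fin: "summable (\<lambda>n. if n < N then f n else 0)" by (rule summable_finite[of "{..<N}"]) auto
  have "(\<Sum>n. if n < N then 0 else f n) = (\<Sum>n. f n - (if n < N then f n else 0))"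
    by (intro suminf_cong) auto
  also have "\<dots> = suminf f - (\<Sum>n. if n < N then f n else 0)" by (intro suminf_diff[symmetric] assms fin)
  also have "(\<Sum>n. if n < N then f n else 0) = sum f {..<N}"
    by (subst suminf_finite[of "{..<N}"]) auto
  finally show ?thesis .
qed

lemma hermite_sum_L2norm_tendsto:
  assumes c: "rapid c" shows "(\<lambda>N. L2norm (\<lambda>x. hermite_series c x - hermite_sum N c x)) \<longlonglongrightarrow> 0"
proof -
  let ?f = "\<lambda>n. (cmod (c n))\<^sup>2"
  have le: "L2norm (\<lambda>x. hermite_series c x - hermite_sum N c x) \<le> sqrt (suminf ?f - sum ?f {..<N})" for N
  proof -
    have "(L2norm (\<lambda>x. hermite_series c x - hermite_sum N c x))\<^sup>2 \<le> (\<Sum>n. (cmod (if n < N then 0 else c n))\<^sup>2)"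
      unfolding hermite_series_tail(1)[OF c] using hermite_series_L2_aux[OF hermite_series_tail(2)[OF c]] by blast
    also have "\<dots> = (\<Sum>n. if n < N then 0 else ?f n)" by (intro suminf_cong) auto
    also have "\<dots> = suminf ?f - sum ?f {..<N}" by (intro suminf_tail summable_norm_sq c)
    finally show "L2norm (\<lambda>x. hermite_series c x - hermite_sum N c x) \<le> sqrt (suminf ?f - sum ?f {..<N})"
      by (rule real_le_rsqrt)
  qed
  have "(\<lambda>N. sqrt (suminf ?f - sum ?f {..<N})) \<longlonglongrightarrow> sqrt (suminf ?f - suminf ?f)"
    by (intro tendsto_intros summable_LIMSEQ summable_norm_sq c)
  then have lim: "(\<lambda>N. sqrt (suminf ?f - sum ?f {..<N})) \<longlonglongrightarrow> 0" by simp
  show ?thesis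
    by (rule tendsto_sandwich[OF always_eventually always_eventually tendsto_const lim])
      (auto simp: L2norm_nonneg le)
qed

lemma L2norm_hermite_series_sq:
  assumes c: "rapid c" shows "(L2norm (hermite_series c))\<^sup>2 = (\<Sum>n. (cmod (c n))\<^sup>2)"
proof (rule antisym)
  have lim: "(\<lambda>N. L2norm (hermite_series c) + L2norm (\<lambda>x. hermite_series c x - hermite_sum N c x)) \<longlonglongrightarrow> L2norm (hermite_series c) + 0"
    by (intro tendsto_intros hermite_sum_L2norm_tendsto c)
  have "sqrt (\<Sum>n<N. (cmod (c n))\<^sup>2) \<le> L2norm (hermite_series c) + L2norm (\<lambda>x. hermite_series c x - hermite_sum N c x)" for N
  proof -
    have "L2norm (\<lambda>x. hermite_series c x + -1 * (hermite_series c x - hermite_sum N c x)) \<le> L2norm (hermite_series c) + L2norm (\<lambda>x. -1 * (hermite_series c x - hermite_sum N c x))"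
      by (intro L2norm_triangle L2_cmult L2_diff hermite_sum_L2 hermite_series_L2 c)
    also have "(\<lambda>x. hermite_series c x + -1 * (hermite_series c x - hermite_sum N c x)) = hermite_sum N c" by auto
    also have "L2norm (\<lambda>x. -1 * (hermite_series c x - hermite_sum N c x)) = L2norm (\<lambda>x. hermite_series c x - hermite_sum N c x)"
      by (subst L2norm_cmult) simp
    also have "L2norm (hermite_sum N c) = sqrt (\<Sum>n<N. (cmod (c n))\<^sup>2)"
      unfolding hermite_sum_L2norm[symmetric] by (simp add: L2norm_nonneg)
    finally show ?thesis .
  qed
  then have "sqrt (\<Sum>n. (cmod (c n))\<^sup>2) \<le> L2norm (hermite_series c)"
    by (intro LIMSEQ_le[OF tendsto_real_sqrt[OF summable_LIMSEQ[OF summable_norm_sq[OF c]]] lim[simplified]]) auto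
  then show "(\<Sum>n. (cmod (c n))\<^sup>2) \<le> (L2norm (hermite_series c))\<^sup>2"
    by (rule sqrt_le_D)
qed (use hermite_series_L2_aux[OF c] in blast)

text \<open>Comparison of square-summable with summable coefficients. It converts termwise estimates
  into norm estimates by mere summation, which is how difference quotients in time and the errors in
  the operator closure are controlled.\<close>

lemma L2norm_hermite_series_le:
  assumes c: "rapid c" shows "L2norm (hermite_series c) \<le> (\<Sum>n. cmod (c n))"
proof (rule power2_le_imp_le)
  let ?T = "\<Sum>n. cmod (c n)"
  have le: "cmod (c n) \<le> ?T" for n
    using sum_le_suminf[OF rapid_summable_norm[OF c], of "{n}"] by simp
  have "(L2norm (hermite_series c))\<^sup>2 = (\<Sum>n. (cmod (c n))\<^sup>2)" by (rule L2norm_hermite_series_sq[OF c])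
  also have "\<dots> \<le> (\<Sum>n. ?T * cmod (c n))"
    by (intro suminf_le summable_norm_sq summable_mult rapid_summable_norm c)
      (auto simp: power2_eq_square intro!: mult_right_mono le)
  also have "\<dots> = ?T\<^sup>2" by (simp add: suminf_mult rapid_summable_norm[OF c] power2_eq_square)
  finally show "(L2norm (hermite_series c))\<^sup>2 \<le> ?T\<^sup>2" .
qed (auto intro!: suminf_nonneg rapid_summable_norm c)

section \<open>Pairing Hermite series with square-integrable functions\<close>

lemma pairing_add: "f \<in> L2 \<Longrightarrow> g \<in> L2 \<Longrightarrow> h \<in> L2 \<Longrightarrow> pairing (\<lambda>x. f x + g x) h = pairing f h + pairing g h"
  unfolding pairing_def by (simp add: distrib_right L2_mult_integrable)

lemma pairing_add_right: "f \<in> L2 \<Longrightarrow> g \<in> L2 \<Longrightarrow> h \<in> L2 \<Longrightarrow> pairing h (\<lambda>x. f x + g x) = pairing h f + pairing h g"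
  unfolding pairing_def by (simp add: distrib_left L2_mult_integrable)

lemma pairing_cmult: "pairing (\<lambda>x. a * f x) h = a * pairing f h"
  unfolding pairing_def by (simp add: mult.assoc)

lemma pairing_cmult_right: "pairing h (\<lambda>x. a * f x) = a * pairing h f"
  unfolding pairing_def by (simp add: mult.left_commute)

lemma pairing_diff: "f \<in> L2 \<Longrightarrow> g \<in> L2 \<Longrightarrow> h \<in> L2 \<Longrightarrow> pairing (\<lambda>x. f x - g x) h = pairing f h - pairing g h"
  unfolding pairing_def by (simp add: left_diff_distrib L2_mult_integrable)

lemma pairing_hermite_sum: "f \<in> L2 \<Longrightarrow> pairing (hermite_sum N c) f = (\<Sum>n<N. c n * pairing (hermite_c n) f)"
proof (induction N)
  case 0
  then show ?case by (simp add: hermite_sum_def pairing_def)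
next
  case (Suc N)
  then show ?case unfolding hermite_sum_Suc by (simp add: pairing_add pairing_cmult hermite_sum_L2 L2_cmult hermite_c_L2)
qed

lemma pairing_hermite_series:
  assumes c: "rapid c" and f: "f \<in> L2"
  shows "(\<lambda>n. c n * pairing (hermite_c n) f) sums pairing (hermite_series c) f"
  unfolding sums_def pairing_hermite_sum[OF f, symmetric]
proof (rule LIM_zero_cancel, rule Lim_null_comparison)
  show "\<forall>\<^sub>F N in sequentially. norm (pairing (hermite_sum N c) f - pairing (hermite_series c) f) \<le> L2norm (\<lambda>x. hermite_series c x - hermite_sum N c x) * L2norm f"
    using pairing_le_L2norm[OF L2_diff[OF hermite_series_L2[OF c] hermite_sum_L2] f]
    by (auto simp: pairing_diff hermite_series_L2 c hermite_sum_L2 f norm_minus_commute)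
  show "(\<lambda>N. L2norm (\<lambda>x. hermite_series c x - hermite_sum N c x) * L2norm f) \<longlonglongrightarrow> 0"
    by (rule tendsto_mult_left_zero[OF hermite_sum_L2norm_tendsto[OF c]])
qed

section \<open>The harmonic oscillator on Hermite series\<close>

lemma gauss_decay_of_real:
  "gauss_decay f \<Longrightarrow> gauss_decay (\<lambda>x. of_real (f x) :: 'a::real_normed_algebra_1)"
  unfolding gauss_decay_def by simp

definition hermite_fun_diff :: "nat \<Rightarrow> real \<Rightarrow> real" where
  "hermite_fun_diff n x = sqrt (2 * real n) * hermite_fun (n - 1) x - x * hermite_fun n x"

lemma hermite_c_deriv: "(hermite_c n has_vector_derivative of_real (hermite_fun_diff n x)) (at x)"
  unfolding hermite_c_def[abs_def] hermite_fun_diff_def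
  by (intro has_vector_derivative_of_real hermite_fun_deriv)

lemma hermite_fun_diff_deriv:
  "((\<lambda>x. complex_of_real (hermite_fun_diff n x)) has_vector_derivative of_real (x\<^sup>2 - (2 * real n + 1)) * hermite_c n x) (at x)"
  using has_vector_derivative_of_real[OF hermite_fun_deriv2[of n x]]
  by (simp add: hermite_fun_diff_def[abs_def] hermite_c_def)

lemma gauss_decay_hermite_c: "gauss_decay (hermite_c n)"
  unfolding hermite_c_def[abs_def] by (intro gauss_decay_of_real gauss_decay_hermite_fun)

lemma gauss_decay_hermite_fun_diff: "gauss_decay (hermite_fun_diff n)"
  unfolding hermite_fun_diff_def[abs_def] by (intro gauss_decay_diff gauss_decay_cmult gauss_decay_hermite_fun gauss_decay_id_hermite_fun)

lemma harm_hermite_c: "harm (hermite_c n) = (\<lambda>x. of_real (\<kappa> n) * hermite_c n x)"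
proof -
  have "D1 (hermite_c n) = (\<lambda>x. of_real (hermite_fun_diff n x))" by (rule D1_eqI[OF hermite_c_deriv])
  moreover have "D1 \<dots> = (\<lambda>x. of_real (x\<^sup>2 - (2 * real n + 1)) * hermite_c n x)"
    by (rule D1_eqI[OF hermite_fun_diff_deriv])
  ultimately have eq: "(D1 ^^ 2) (hermite_c n) = (\<lambda>x. of_real (x\<^sup>2 - (2 * real n + 1)) * hermite_c n x)"
    by (simp add: numeral_2_eq_2)
  show ?thesis unfolding harm_def eq \<kappa>_def fun_eq_iff by (simp add: field_simps)
qed

lemma schwartz_sup: "\<phi> \<in> schwartz \<Longrightarrow> \<exists>B. \<forall>x. cmod ((D1 ^^ n) \<phi> x) \<le> B"
  using schwartz_bounded[of \<phi> 0 n] by simp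

lemma harm_bounded:
  assumes "\<phi> \<in> schwartz" shows "\<exists>B. \<forall>x. cmod (harm \<phi> x) \<le> B"
proof -
  obtain A B where A: "\<And>x. cmod ((D1 ^^ 2) \<phi> x) \<le> A" and B: "\<And>x. \<bar>x\<bar> ^ 2 * cmod ((D1 ^^ 0) \<phi> x) \<le> B"
    using schwartz_sup[OF assms, of 2] schwartz_bounded[OF assms, of 2 0] by blast
  have "cmod (harm \<phi> x) \<le> (A + B) / 2" for x
  proof -
    have "cmod (- (D1 ^^ 2) \<phi> x + complex_of_real (x\<^sup>2) * \<phi> x) \<le> cmod (- (D1 ^^ 2) \<phi> x) + cmod (complex_of_real (x\<^sup>2) * \<phi> x)"
      by (rule norm_triangle_ineq)
    also have "\<dots> \<le> A + B" using A[of x] B[of x] by (simp add: norm_mult norm_power)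
    finally show ?thesis unfolding harm_def by (simp add: norm_divide)
  qed
  then show ?thesis by blast
qed

lemma continuous_harm: "\<phi> \<in> schwartz \<Longrightarrow> continuous_on UNIV (harm \<phi>)"
  using schwartz_continuous[of \<phi> 0] schwartz_continuous[of \<phi> 2]
  unfolding harm_def[abs_def] by (auto intro!: continuous_intros)

lemma continuous_hermite_c: "continuous_on A (hermite_c n)"
  unfolding hermite_c_def[abs_def] by (intro continuous_intros)

text \<open>Green's formula. The Wronskian of \<phi> and h_n has Gaussian decay, \<phi> and its
  derivative entering only as bounded factors, and its derivative is twice the difference of the two
  integrands.\<close>

lemma pairing_harm:
  assumes \<phi>: "\<phi> \<in> schwartz"
  shows "pairing (hermite_c n) (harm \<phi>) = of_real (\<kappa> n) * pairing (hermite_c n) \<phi>"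
proof -
  obtain A B C where A: "\<And>x. cmod ((D1 ^^ 1) \<phi> x) \<le> A" and B: "\<And>x. cmod ((D1 ^^ 0) \<phi> x) \<le> B"
      and C: "\<And>x. cmod (harm \<phi> x) \<le> C"
    using schwartz_sup[OF \<phi>] harm_bounded[OF \<phi>] by meson
  let ?f = "\<lambda>x. of_real (2 * \<kappa> n) * (\<phi> x * hermite_c n x) - 2 * (harm \<phi> x * hermite_c n x)"
  have dec: "gauss_decay (\<lambda>x. \<phi> x * hermite_c n x)" "gauss_decay (\<lambda>x. harm \<phi> x * hermite_c n x)"
    using B C by (auto intro!: gauss_decay_mult_bounded gauss_decay_hermite_c)
  have "(\<integral>x. ?f x \<partial>lborel) = 0"
  proof (rule integral_derivative_eq_0)
    show "((\<lambda>x. D1 \<phi> x * hermite_c n x - \<phi> x * of_real (hermite_fun_diff n x)) has_vector_derivative ?f x) (at x)" for x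
      by (rule has_vector_derivative_eq_rhs, (rule derivative_intros hermite_c_deriv hermite_fun_diff_deriv
          schwartz_deriv[OF \<phi>, of 0, simplified] schwartz_deriv[OF \<phi>, of 1, simplified])+)
        (simp add: harm_def numeral_2_eq_2 \<kappa>_def field_simps)
    show "continuous_on UNIV ?f"
      using schwartz_continuous[OF \<phi>, of 0]
      by (auto intro!: continuous_intros continuous_harm continuous_hermite_c \<phi>)
    show "gauss_decay (\<lambda>x. D1 \<phi> x * hermite_c n x - \<phi> x * of_real (hermite_fun_diff n x))"
      using A B by (auto intro!: gauss_decay_diff gauss_decay_mult_bounded gauss_decay_hermite_c gauss_decay_of_real gauss_decay_hermite_fun_diff)
    show "gauss_decay ?f" by (intro gauss_decay_diff gauss_decay_cmult dec)
  qed
  moreover have "integrable lborel (\<lambda>x. \<phi> x * hermite_c n x)" "integrable lborel (\<lambda>x. harm \<phi> x * hermite_c n x)"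
    by (intro L2_mult_integrable hermite_c_L2 schwartz_subset_L2 harm_L2 \<phi>)+
  ultimately have "of_real (2 * \<kappa> n) * (\<integral>x. \<phi> x * hermite_c n x \<partial>lborel) = 2 * (\<integral>x. harm \<phi> x * hermite_c n x \<partial>lborel)"
    by simp
  then show ?thesis by (simp add: pairing_def mult.commute)
qed

text \<open>Tested against a Schwartz function, both sides become series in n, which agree term by
  term by Green's formula.\<close>

lemma is_K0_hermite_series:
  assumes c: "rapid c" shows "is_K0 (hermite_series c) (hermite_series (\<lambda>n. of_real (\<kappa> n) * c n))"
  unfolding is_K0_def
proof (intro conjI ballI)
  fix \<phi> assume \<phi>: "\<phi> \<in> schwartz"
  have "(\<lambda>n. c n * pairing (hermite_c n) (harm \<phi>)) sums pairing (hermite_series c) (harm \<phi>)"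
    by (intro pairing_hermite_series c harm_L2 \<phi>)
  moreover have "(\<lambda>n. of_real (\<kappa> n) * c n * pairing (hermite_c n) \<phi>) sums pairing (hermite_series (\<lambda>n. of_real (\<kappa> n) * c n)) \<phi>"
    by (intro pairing_hermite_series rapid_\<kappa> c schwartz_subset_L2 \<phi>)
  ultimately have "pairing (hermite_series c) (harm \<phi>) = pairing (hermite_series (\<lambda>n. of_real (\<kappa> n) * c n)) \<phi>"
    by (simp add: pairing_harm[OF \<phi>] sums_unique2 mult_ac)
  then show "(LINT x|lborel. hermite_series c x * harm \<phi> x) = (LINT x|lborel. hermite_series (\<lambda>n. of_real (\<kappa> n) * c n) x * \<phi> x)"
    by (simp add: pairing_def)
qed (auto intro!: hermite_series_L2 rapid_\<kappa> c)

text \<open>Hermite functions are admissible test functions and eigenfunctions of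
  \<open>harm\<close>. The Hermite coefficients of the image are therefore known for every f in the
  domain, also when f is not given as a series.\<close>

lemma is_K0_pairing_hermite_c:
  assumes "is_K0 f g" shows "pairing (hermite_c n) g = of_real (\<kappa> n) * pairing (hermite_c n) f"
proof -
  have "(\<integral>x. f x * harm (hermite_c n) x \<partial>lborel) = (\<integral>x. g x * hermite_c n x \<partial>lborel)"
    using assms hermite_c_schwartz unfolding is_K0_def by blast
  moreover have "f x * harm (hermite_c n) x = of_real (\<kappa> n) * (hermite_c n x * f x)" for x
    by (simp add: harm_hermite_c mult_ac)
  ultimately show ?thesis by (simp add: pairing_def mult.commute[of "g _"])
qed

lemma pairing_hermite_series_K0:
  assumes "rapid c" "is_K0 f g"
  shows "pairing (hermite_series (\<lambda>n. of_real (\<kappa> n) * c n)) f = pairing (hermite_series c) g"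
proof -
  have "f \<in> L2" "g \<in> L2" using assms(2) by (auto simp: is_K0_def)
  then show ?thesis
    using pairing_hermite_series[OF rapid_\<kappa>[OF assms(1)], of f] pairing_hermite_series[OF assms(1), of g]
    by (simp add: is_K0_pairing_hermite_c[OF assms(2)] sums_unique2 mult_ac)
qed

section \<open>Fourier uniqueness and the uniqueness of \<open>K0\<close>\<close>

lemma fourier_zero_real:
  fixes f :: "real \<Rightarrow> real"
  assumes f: "integrable lborel f" and zero: "\<And>w. (\<integral>x. of_real (f x) * iexp (w * x) \<partial>lborel) = 0"
  shows "AE x in lborel. f x = 0"
proof -
  have [measurable]: "f \<in> borel_measurable lborel" using f by auto
  \<comment> \<open>Positive and negative part, once normalised, are probability densities with the
    same characteristic function, so that Levy's uniqueness theorem applies to them.\<close>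
  define p where "p x = max 0 (f x)" for x
  define q where "q x = max 0 (- f x)" for x
  have [measurable]: "p \<in> borel_measurable lborel" "q \<in> borel_measurable lborel"
    unfolding p_def[abs_def] q_def[abs_def] by measurable
  have pq: "f x = p x - q x" "p x \<ge> 0" "q x \<ge> 0" for x unfolding p_def q_def by auto
  have int: "integrable lborel p" "integrable lborel q"
    unfolding p_def[abs_def] q_def[abs_def] using f by auto
  have inte: "integrable lborel (\<lambda>x. of_real (g x) * iexp (w * x))" if "integrable lborel g" for g :: "real \<Rightarrow> real" and w
  proof (rule Bochner_Integration.integrable_bound[OF that])
    show "(\<lambda>x. of_real (g x) * iexp (w * x)) \<in> borel_measurable lborel" using that by measurable
  qed (simp add: norm_mult)
  have eqc: "(\<integral>x. of_real (p x) * iexp (w * x) \<partial>lborel) = (\<integral>x. of_real (q x) * iexp (w * x) \<partial>lborel)" for w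
    using zero[of w] inte[OF int(1), of w] inte[OF int(2), of w] by (simp add: pq(1) left_diff_distrib)
  define m where "m = (\<integral>x. p x \<partial>lborel)"
  \<comment> \<open>Frequency 0: both parts have the same mass, hence the same normalisation. Mass 0
    is treated apart.\<close>
  have m: "m = (\<integral>x. q x \<partial>lborel)"
    using eqc[of 0] unfolding m_def by simp
  have m0: "m \<ge> 0" unfolding m_def using pq by simp
  show ?thesis
  proof (cases "m = 0")
    case True
    have "AE x in lborel. p x = 0"
      using True pq unfolding m_def by (subst integral_nonneg_eq_0_iff_AE[OF int(1), symmetric]) auto
    moreover have "AE x in lborel. q x = 0"
      using True pq unfolding m by (subst integral_nonneg_eq_0_iff_AE[OF int(2), symmetric]) auto
    ultimately show ?thesis by eventually_elim (simp add: pq(1))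
  next
    case False
    then have mpos: "m > 0" using m0 by simp
    define M where "M g = density lborel (\<lambda>x. ennreal (g x / m))" for g :: "real \<Rightarrow> real"
    have M: "real_distribution (M g)" "char (M g) = (\<lambda>w. (\<integral>x. of_real (g x) * iexp (w * x) \<partial>lborel) / m)"
      if g: "integrable lborel g" "\<And>x. g x \<ge> 0" "(\<integral>x. g x \<partial>lborel) = m" for g
    proof -
      have [measurable]: "g \<in> borel_measurable lborel" using g by auto
      have "emeasure (M g) (space (M g)) = (\<integral>\<^sup>+x. ennreal (g x / m) \<partial>lborel)"
        unfolding M_def by (subst emeasure_density) auto
      also have "\<dots> = ennreal (\<integral>x. g x / m \<partial>lborel)"
        using g mpos by (intro nn_integral_eq_integral) auto
      also have "\<dots> = 1" using g mpos by simp
      finally have "prob_space (M g)" by (rule prob_spaceI)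
      then show "real_distribution (M g)"
        by (simp add: real_distribution_def real_distribution_axioms_def M_def)
      show "char (M g) = (\<lambda>w. (\<integral>x. of_real (g x) * iexp (w * x) \<partial>lborel) / m)"
      proof
        fix w
        have "char (M g) w = (\<integral>x. (g x / m) *\<^sub>R iexp (w * x) \<partial>lborel)"
          unfolding char_def M_def using g mpos by (subst integral_density) auto
        also have "\<dots> = (\<integral>x. of_real (g x) * iexp (w * x) / m \<partial>lborel)"
          by (simp add: scaleR_conv_of_real)
        also have "\<dots> = (\<integral>x. of_real (g x) * iexp (w * x) \<partial>lborel) / m" by simp
        finally show "char (M g) w = \<dots>" .
      qed
    qed
    have "M p = M q"
      by (rule Levy_uniqueness) (use M(1) M(2) int pq m m_def eqc in auto)
    then have "AE x in lborel. ennreal (p x / m) = ennreal (q x / m)"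
      unfolding M_def by (intro sigma_finite_measure.density_unique[OF sigma_finite_lborel]) auto
    then show ?thesis
      by eventually_elim (use pq mpos in \<open>auto simp: divide_nonneg_nonneg\<close>)
  qed
qed

text \<open>Multiplication by a Gaussian makes G integrable, and testing G against all modulated
  Gaussians says that the Fourier transform of the product vanishes. The Gaussian has no zeros, so G
  itself vanishes almost everywhere.\<close>

lemma schwartz_orthogonal_imp_AE_0:
  assumes G: "G \<in> L2" and zero: "\<And>\<phi>. \<phi> \<in> schwartz \<Longrightarrow> pairing G \<phi> = 0"
  shows "AE x in lborel. G x = 0"
proof -
  define F where "F x = G x * gwave 0 x" for x
  have gw: "gwave w \<in> schwartz" for w
    using amp_gwave_schwartz[OF amp.const[of 1], of w] by simp
  have [measurable]: "G \<in> borel_measurable lborel" using G by (rule L2_measurable)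
  have F: "integrable lborel F"
    unfolding F_def[abs_def] by (intro L2_mult_integrable G schwartz_subset_L2 gw)
  then have [measurable]: "F \<in> borel_measurable lborel" by auto
  have intF: "integrable lborel (\<lambda>x. F x * iexp (w * x))" for w
    by (rule Bochner_Integration.integrable_bound[OF F]) (auto simp: norm_mult)
  have 0: "(\<integral>x. F x * iexp (w * x) \<partial>lborel) = 0" for w
  proof -
    have "F x * iexp (w * x) = G x * gwave w x" for x
      by (simp add: F_def gwave_def mult.assoc flip: exp_add)
    then show ?thesis using zero[OF gw[of w]] by (simp add: pairing_def)
  qed
  \<comment> \<open>Conjugation reverses the frequency, so the transform of the conjugate vanishes
    as well. Real and imaginary part can then be handled by the real-valued statement.\<close>
  have eq: "cnj (F x) * iexp (w * x) = cnj (F x * iexp (- w * x))" for x w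
    by (simp add: exp_cnj)
  have intc: "integrable lborel (\<lambda>x. cnj (F x) * iexp (w * x))" for w
    unfolding eq by (intro integrable_cnj intF)
  have c: "(\<integral>x. cnj (F x) * iexp (w * x) \<partial>lborel) = 0" for w
    unfolding eq Bochner_Integration.integral_cnj by (simp only: 0 complex_cnj_zero)
  have "AE x in lborel. Re (F x) = 0"
  proof (rule fourier_zero_real)
    fix w
    have eq': "of_real (Re (F x)) * iexp (w * x) = (F x * iexp (w * x) + cnj (F x) * iexp (w * x)) / 2" for x
      by (simp add: complex_eq_iff algebra_simps)
    show "(\<integral>x. of_real (Re (F x)) * iexp (w * x) \<partial>lborel) = 0"
      unfolding eq' using intF[of w] intc[of w] 0[of w] c[of w] by simp
  qed (use F in auto)
  moreover have "AE x in lborel. Im (F x) = 0"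
  proof (rule fourier_zero_real)
    fix w
    have eq': "of_real (Im (F x)) * iexp (w * x) = (F x * iexp (w * x) - cnj (F x) * iexp (w * x)) / (2 * \<i>)" for x
      by (simp add: complex_eq_iff Re_divide Im_divide algebra_simps)
    show "(\<integral>x. of_real (Im (F x)) * iexp (w * x) \<partial>lborel) = 0"
      unfolding eq' using intF[of w] intc[of w] 0[of w] c[of w] by simp
  qed (use F in auto)
  ultimately show ?thesis
  proof eventually_elim
    case (elim x)
    then have "F x = 0" by (simp add: complex_eq_iff)
    then show ?case using norm_gwave[of 0 x] by (auto simp: F_def)
  qed
qed

lemma is_K0_unique:
  assumes "is_K0 f g" "is_K0 f h" shows "AE x in lborel. g x = h x"
proof -
  have L: "g \<in> L2" "h \<in> L2" using assms by (auto simp: is_K0_def)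
  have "AE x in lborel. g x - h x = 0"
  proof (rule schwartz_orthogonal_imp_AE_0)
    fix \<phi> assume \<phi>: "\<phi> \<in> schwartz"
    have "pairing g \<phi> = pairing h \<phi>" using assms \<phi> unfolding is_K0_def pairing_def by metis
    then show "pairing (\<lambda>x. g x - h x) \<phi> = 0"
      by (simp add: pairing_diff L \<phi> schwartz_subset_L2)
  qed (intro L2_diff L)
  then show ?thesis by simp
qed

lemma AE_eq_L2:
  assumes "f \<in> L2" "f' \<in> borel_measurable lborel" "AE x in lborel. f' x = f x"
  shows "f' \<in> L2" "L2norm f' = L2norm f"
proof -
  note [measurable] = assms(2) L2_measurable[OF assms(1)]
  have ae: "AE x in lborel. (cmod (f' x))\<^sup>2 = (cmod (f x))\<^sup>2" using assms(3) by auto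
  show "f' \<in> L2"
    using integrable_cong_AE[OF _ _ ae] L2_integrable[OF assms(1)] by (intro L2_I) auto
  show "L2norm f' = L2norm f"
    unfolding L2norm_def using integral_cong_AE[OF _ _ ae] by simp
qed

text \<open>\<open>K0\<close> picks an unspecified representative, so its iterates are known only up
  to null sets. For \<open>K0\<close> to be applied again, the relation has to survive such a change
  of its argument.\<close>

lemma is_K0_cong_AE:
  assumes K: "is_K0 f g" and "f' \<in> borel_measurable lborel" "AE x in lborel. f' x = f x"
  shows "is_K0 f' g"
  unfolding is_K0_def
proof (intro conjI ballI)
  have f: "f \<in> L2" using K by (simp add: is_K0_def)
  show f': "f' \<in> L2" by (rule AE_eq_L2[OF f assms(2,3)])
  show "g \<in> L2" using K by (simp add: is_K0_def)
  fix \<phi> assume \<phi>: "\<phi> \<in> schwartz"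
  note [measurable] = assms(2) L2_measurable[OF f] L2_measurable[OF harm_L2[OF \<phi>]]
  have "(\<integral>x. f' x * harm \<phi> x \<partial>lborel) = (\<integral>x. f x * harm \<phi> x \<partial>lborel)"
    by (rule integral_cong_AE) (use assms(3) in auto)
  also have "\<dots> = (\<integral>x. g x * \<phi> x \<partial>lborel)" using K \<phi> by (simp add: is_K0_def)
  finally show "(\<integral>x. f' x * harm \<phi> x \<partial>lborel) = \<dots>" .
qed

lemma is_K0_K0: "f \<in> dom_K0 \<Longrightarrow> is_K0 f (K0 f)"
  unfolding dom_K0_def K0_def mem_Collect_eq by (rule someI_ex[of "is_K0 f"])

lemma K0_L2: "f \<in> dom_K0 \<Longrightarrow> K0 f \<in> L2"
  using is_K0_K0 by (simp add: is_K0_def)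

lemma K0_AE_hermite_series:
  assumes c: "rapid c" and f: "f \<in> L2" "AE x in lborel. f x = hermite_series c x"
  shows "f \<in> dom_K0" "AE x in lborel. K0 f x = hermite_series (\<lambda>n. of_real (\<kappa> n) * c n) x"
proof -
  have K: "is_K0 f (hermite_series (\<lambda>n. of_real (\<kappa> n) * c n))"
    by (rule is_K0_cong_AE[OF is_K0_hermite_series[OF c] L2_measurable[OF f(1)] f(2)])
  then show "f \<in> dom_K0" unfolding dom_K0_def by blast
  then show "AE x in lborel. K0 f x = hermite_series (\<lambda>n. of_real (\<kappa> n) * c n) x"
    using is_K0_unique[OF is_K0_K0 K] by blast
qed

section \<open>Powers of \<open>K0\<close> and the dual scale\<close>

lemma K0_pow_hermite_series:
  assumes c: "rapid c"
  shows "(K0 ^^ j) (hermite_series c) \<in> L2 \<and> (AE x in lborel. (K0 ^^ j) (hermite_series c) x = hermite_series (\<lambda>n. of_real (\<kappa> n ^ j) * c n) x)"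
proof (induction j)
  case 0
  then show ?case using hermite_series_L2[OF c] by simp
next
  case (Suc j)
  note * = K0_AE_hermite_series[OF rapid_\<kappa>_pow[OF c] conjunct1[OF Suc] conjunct2[OF Suc]]
  show ?case using K0_L2[OF *(1)] *(2) by (simp add: mult.assoc)
qed

lemma hermite_series_Hs: "rapid c \<Longrightarrow> hermite_series c \<in> Hs n"
  unfolding Hs_def using hermite_series_L2 K0_AE_hermite_series(1)[OF rapid_\<kappa>_pow] K0_pow_hermite_series by blast

lemma Hs_norm_hermite_series: "rapid c \<Longrightarrow> Hs_norm n (hermite_series c) = L2norm (hermite_series (\<lambda>m. of_real (\<kappa> m ^ n) * c m))"
  unfolding Hs_norm_def using K0_pow_hermite_series[of c n] AE_eq_L2(2)[OF hermite_series_L2[OF rapid_\<kappa>_pow] L2_measurable]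
  by blast

lemma Hs_K0_pow_L2: "f \<in> Hs n \<Longrightarrow> j \<le> n \<Longrightarrow> (K0 ^^ j) f \<in> L2"
  by (cases j) (auto simp: Hs_def intro: K0_L2)

text \<open>Powers of \<open>K0\<close> are moved one at a time from the coefficients to f. With
  Cauchy-Schwarz this bounds a Hermite series, as a functional on \<open>Hs n\<close>, by the norm
  of the series whose coefficients are divided by \<open>\<kappa> m ^ n\<close>.\<close>

lemma pairing_hermite_series_K0_pow:
  assumes c: "rapid c" and f: "f \<in> Hs n"
  shows "pairing (hermite_series c) f = pairing (hermite_series (\<lambda>m. of_real (inverse (\<kappa> m) ^ n) * c m)) ((K0 ^^ n) f)"
proof -
  have "j \<le> n \<Longrightarrow> pairing (hermite_series c) f = pairing (hermite_series (\<lambda>m. of_real (inverse (\<kappa> m) ^ j) * c m)) ((K0 ^^ j) f)" for j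
  proof (induction j)
    case (Suc j)
    have eq: "(\<lambda>m. of_real (\<kappa> m) * (of_real (inverse (\<kappa> m) ^ Suc j) * c m)) = (\<lambda>m. of_real (inverse (\<kappa> m) ^ j) * c m)"
      using \<kappa>_pos by (auto simp: fun_eq_iff less_imp_neq[symmetric])
    have dom: "(K0 ^^ j) f \<in> dom_K0" using f Suc by (simp add: Hs_def)
    have "pairing (hermite_series c) f = pairing (hermite_series (\<lambda>m. of_real (inverse (\<kappa> m) ^ j) * c m)) ((K0 ^^ j) f)"
      using Suc by simp
    also have "\<dots> = pairing (hermite_series (\<lambda>m. of_real (inverse (\<kappa> m) ^ Suc j) * c m)) (K0 ((K0 ^^ j) f))"
      using pairing_hermite_series_K0[OF rapid_inv_\<kappa>_pow[OF c] is_K0_K0[OF dom], of "Suc j"] unfolding eq .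
    finally show ?case by simp
  qed simp
  then show ?thesis by simp
qed

lemma pairing_hermite_series_bound:
  assumes c: "rapid c" and f: "f \<in> Hs n"
  shows "cmod (pairing (hermite_series c) f) \<le> L2norm (hermite_series (\<lambda>m. of_real (inverse (\<kappa> m) ^ n) * c m)) * Hs_norm n f"
  unfolding pairing_hermite_series_K0_pow[OF c f] Hs_norm_def
  using pairing_le_L2norm hermite_series_L2[OF rapid_inv_\<kappa>_pow[OF c]] Hs_K0_pow_L2[OF f] by blast

lemma Hs_L2: "f \<in> Hs n \<Longrightarrow> f \<in> L2" by (simp add: Hs_def)

lemma pairing_hermite_series_Hneg: "rapid c \<Longrightarrow> pairing (hermite_series c) \<in> Hneg n"
  unfolding Hneg_def using pairing_hermite_series_bound[of c _ n]
  by (auto simp: pairing_add_right pairing_cmult_right hermite_series_L2 Hs_L2 intro!: exI)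

text \<open>The supremum is meaningful over a nonempty set with bounded image: the zero series lies
  in the unit ball, and the dual estimate bounds the image. The functional is prescribed only on
  \<open>Hs n\<close>, since its other values are irrelevant.\<close>

lemma Hneg_norm_le:
  assumes c: "rapid c" and u: "\<And>f. f \<in> Hs n \<Longrightarrow> u f = pairing (hermite_series c) f"
  shows "0 \<le> Hneg_norm n u" "Hneg_norm n u \<le> L2norm (hermite_series (\<lambda>m. of_real (inverse (\<kappa> m) ^ n) * c m))"
proof -
  define S where "S = {f \<in> Hs n. Hs_norm n f \<le> 1}"
  let ?B = "L2norm (hermite_series (\<lambda>m. of_real (inverse (\<kappa> m) ^ n) * c m))"
  have bd: "cmod (u f) \<le> ?B" if "f \<in> S" for f
  proof -
    have f: "f \<in> Hs n" "Hs_norm n f \<le> 1" using that by (auto simp: S_def)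
    have "cmod (u f) \<le> ?B * Hs_norm n f" unfolding u[OF f(1)] by (rule pairing_hermite_series_bound[OF c f(1)])
    also have "\<dots> \<le> ?B * 1" by (intro mult_left_mono f L2norm_nonneg)
    finally show ?thesis by simp
  qed
  have z: "rapid (\<lambda>_. 0)" by (rule rapid_finite[of 0]) simp
  have "L2norm (hermite_series (\<lambda>_. 0)) = 0" using L2norm_hermite_series_sq[OF z] by simp
  then have "Hs_norm n (hermite_series (\<lambda>_. 0)) = 0" by (simp add: Hs_norm_hermite_series[OF z])
  then have zS: "hermite_series (\<lambda>_. 0) \<in> S" using hermite_series_Hs[OF z] by (simp add: S_def)
  show "Hneg_norm n u \<le> ?B"
    unfolding Hneg_norm_def S_def[symmetric] using zS by (intro cSUP_least bd) auto
  have "0 \<le> cmod (u (hermite_series (\<lambda>_. 0)))" by simp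
  also have "\<dots> \<le> Hneg_norm n u"
    unfolding Hneg_norm_def S_def[symmetric] by (rule cSUP_upper[OF zS]) (use bd in \<open>auto intro!: bdd_aboveI\<close>)
  finally show "0 \<le> Hneg_norm n u" .
qed

section \<open>A Jacobi matrix flow\<close>

text \<open>Uniformity on bounded time intervals is what allows Taylor remainders in time to be
  summed over n.\<close>

definition rapid_curve :: "(real \<Rightarrow> nat \<Rightarrow> complex) \<Rightarrow> bool" where
  "rapid_curve d \<longleftrightarrow> (\<forall>T R. R \<ge> 0 \<longrightarrow> (\<exists>B. \<forall>t n. \<bar>t\<bar> \<le> T \<longrightarrow> cmod (d t n) * R ^ n \<le> B))"

lemma rapid_curveD: "rapid_curve d \<Longrightarrow> R \<ge> 0 \<Longrightarrow> \<exists>B. \<forall>t n. \<bar>t\<bar> \<le> T \<longrightarrow> cmod (d t n) * R ^ n \<le> B"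
  unfolding rapid_curve_def by blast

lemma rapid_curve_rapid: "rapid_curve d \<Longrightarrow> rapid (d t)"
  unfolding rapid_def rapid_curve_def by (metis order_refl)

lemma suminf_shift:
  fixes f :: "nat \<Rightarrow> real"
  assumes "summable f"
  shows "summable (\<lambda>n. case n of 0 \<Rightarrow> 0 | Suc m \<Rightarrow> f m)" "(\<Sum>n. case n of 0 \<Rightarrow> 0 | Suc m \<Rightarrow> f m) = suminf f"
proof -
  show s: "summable (\<lambda>n. case n of 0 \<Rightarrow> 0 | Suc m \<Rightarrow> f m)"
    using assms by (subst summable_Suc_iff[symmetric]) simp
  show "(\<Sum>n. case n of 0 \<Rightarrow> 0 | Suc m \<Rightarrow> f m) = suminf f"
    using suminf_split_head[OF s] by simp
qed

text \<open>The mean value inequality twice, for f' and for f minus its tangent, on an interval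
  around t that contains t + h for either sign of h. The restriction on h keeps this interval inside
  the region where the second derivative is bounded.\<close>

lemma taylor1_bound:
  fixes f f' f'' :: "real \<Rightarrow> complex"
  assumes f: "\<And>s. (f has_vector_derivative f' s) (at s)" and f': "\<And>s. (f' has_vector_derivative f'' s) (at s)"
    and B: "\<And>s. \<bar>s\<bar> \<le> \<bar>t\<bar> + 1 \<Longrightarrow> cmod (f'' s) \<le> B" and h: "\<bar>h\<bar> \<le> 1"
  shows "cmod (f (t + h) - f t - of_real h * f' t) \<le> B * h\<^sup>2"
proof -
  define I where "I = {t - \<bar>h\<bar>..t + \<bar>h\<bar>}"
  have conv: "convex I" unfolding I_def by simp
  have on: "onorm (\<lambda>x. x *\<^sub>R v) \<le> K" if "cmod v \<le> K" for v :: complex and K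
    using that order_trans[OF norm_ge_zero that] by (intro onorm_bound) (auto simp: mult.commute[of K] mult_left_mono)
  have B0: "B \<ge> 0" using order_trans[OF norm_ge_zero B[of t]] by simp
  have 1: "cmod (f' s - f' t) \<le> B * \<bar>h\<bar>" if "s \<in> I" for s
  proof -
    have "cmod (f' s - f' t) \<le> B * norm (s - t)"
    proof (rule differentiable_bound[OF conv])
      show "(f' has_derivative (\<lambda>x. x *\<^sub>R f'' y)) (at y within I)" for y
        using f'[of y] by (simp add: has_vector_derivative_def has_derivative_at_withinI)
      show "onorm (\<lambda>x. x *\<^sub>R f'' y) \<le> B" if "y \<in> I" for y
        using that h by (intro on B) (auto simp: I_def)
    qed (use that h in \<open>auto simp: I_def\<close>)
    also have "\<dots> \<le> B * \<bar>h\<bar>" using that B0 by (intro mult_left_mono) (auto simp: I_def)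
    finally show ?thesis .
  qed
  define g where "g s = f s - of_real (s - t) * f' t" for s
  have "cmod (g (t + h) - g t) \<le> (B * \<bar>h\<bar>) * norm (t + h - t)"
  proof (rule differentiable_bound[OF conv])
    show "(g has_derivative (\<lambda>x. x *\<^sub>R (f' y - f' t))) (at y within I)" for y
    proof -
      have "(g has_vector_derivative (f' y - f' t)) (at y)"
        unfolding g_def[abs_def] by (auto intro!: derivative_eq_intros f has_vector_derivative_of_real simp: scaleR_conv_of_real)
      then show ?thesis by (simp add: has_vector_derivative_def has_derivative_at_withinI)
    qed
    show "onorm (\<lambda>x. x *\<^sub>R (f' y - f' t)) \<le> B * \<bar>h\<bar>" if "y \<in> I" for y
      by (intro on 1 that)
  qed (auto simp: I_def)
  then show ?thesis by (simp add: g_def power2_eq_square mult.assoc algebra_simps)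
qed

lemma cis_deriv: "((\<lambda>t. cis (a * t)) has_vector_derivative \<i> * of_real a * cis (a * t)) (at t)"
proof -
  have "((\<lambda>t. \<i> * of_real (a * t)) has_vector_derivative \<i> * of_real a) (at t)"
    by (auto intro!: derivative_eq_intros has_vector_derivative_of_real)
  from has_vector_derivative_exp_quadratic[OF this] show ?thesis by (simp add: cis_conv_exp)
qed

text \<open>A Jacobi matrix with zero diagonal. Boundedness gives the flow as an everywhere
  convergent exponential series, monotonicity the convexity of the energy, and
  \<open>w 0 > 0\<close> its initial slope.\<close>

locale jacobi =
  fixes w :: "nat \<Rightarrow> real" and W :: real
  assumes w_nonneg: "w n \<ge> 0" and w_le: "w n \<le> W" and w_mono: "w n \<le> w (Suc n)" and w0: "w 0 > 0"
begin

definition up :: "(nat \<Rightarrow> complex) \<Rightarrow> nat \<Rightarrow> complex" where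
  "up d n = (case n of 0 \<Rightarrow> 0 | Suc m \<Rightarrow> of_real (w m) * d m)"

definition dn :: "(nat \<Rightarrow> complex) \<Rightarrow> nat \<Rightarrow> complex" where
  "dn d n = of_real (w n) * d (Suc n)"

text \<open>The k-th time derivative at 0 of the flow in the interaction picture: the k-th power of
  -\<i> times the matrix, applied to the data. The relative phase -\<i> directs the initial current
  between the sites 0 and 1 upwards.\<close>

fun bt :: "nat \<Rightarrow> nat \<Rightarrow> complex" where
  "bt 0 n = (if n = 0 then 1 else if n = 1 then - \<i> else 0)"
| "bt (Suc k) n = - \<i> * (up (bt k) n + dn (bt k) n)"

definition b :: "real \<Rightarrow> nat \<Rightarrow> complex" where
  "b t n = (\<Sum>k. bt k n / fact k * of_real t ^ k)"

lemma W_nonneg: "W \<ge> 0" using w_nonneg[of 0] w_le[of 0] by simp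

text \<open>Finite propagation: the matrix couples only neighbours, and the data occupy the sites 0
  and 1.\<close>

lemma bt_zero: "n > Suc k \<Longrightarrow> bt k n = 0"
  by (induction k arbitrary: n) (auto simp: up_def dn_def split: nat.splits)

lemma bt_bound: "cmod (bt k n) \<le> (2 * W) ^ k"
proof (induction k arbitrary: n)
  case (Suc k)
  have "cmod (up (bt k) n) \<le> W * (2 * W) ^ k"
    using Suc W_nonneg w_le w_nonneg by (auto simp: up_def norm_mult split: nat.split intro!: mult_mono)
  moreover have "cmod (dn (bt k) n) \<le> W * (2 * W) ^ k"
    using Suc W_nonneg w_le w_nonneg by (auto simp: dn_def norm_mult intro!: mult_mono)
  ultimately have "cmod (up (bt k) n + dn (bt k) n) \<le> W * (2 * W) ^ k + W * (2 * W) ^ k"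
    by (rule norm_triangle_mono)
  also have "\<dots> = (2 * W) ^ Suc k" by (simp add: algebra_simps)
  also have "cmod (up (bt k) n + dn (bt k) n) = cmod (bt (Suc k) n)" by (simp add: norm_mult)
  finally show ?case .
qed auto

lemma exp_summable: "summable (\<lambda>k. (x::real) ^ k / fact k)"
  using summable_exp_generic[of x] by (simp add: divide_inverse mult.commute)

lemma bt_summable: "summable (\<lambda>k. bt k n / fact k * z ^ k)"
proof (rule summable_comparison_test')
  show "summable (\<lambda>k. (2 * W * cmod z) ^ k / fact k)" by (rule exp_summable)
  show "norm (bt k n / fact k * z ^ k) \<le> (2 * W * cmod z) ^ k / fact k" for k
    using mult_right_mono[OF bt_bound[of k n], of "cmod z ^ k / fact k"]
    by (simp add: norm_mult norm_divide norm_power power_mult_distrib)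
qed

text \<open>The Schroedinger equation in the interaction picture. Termwise differentiation of an
  entire power series shifts its coefficients, and by the recursion for \<open>bt\<close> the shift
  is an application of the matrix.\<close>

lemma b_deriv: "((\<lambda>t. b t n) has_vector_derivative - \<i> * (up (b t) n + dn (b t) n)) (at t)"
proof -
  have "((\<lambda>z. \<Sum>k. bt k n / fact k * z ^ k) has_field_derivative
      (\<Sum>k. diffs (\<lambda>k. bt k n / fact k) k * of_real t ^ k)) (at (of_real t))"
    by (intro termdiffs_strong_converges_everywhere bt_summable)
  then have d: "((\<lambda>t. b t n) has_vector_derivative (\<Sum>k. diffs (\<lambda>k. bt k n / fact k) k * of_real t ^ k)) (at t)"
    unfolding b_def by (rule has_vector_derivative_real_field)
  have eq: "diffs (\<lambda>k. bt k n / fact k) k = bt (Suc k) n / fact k" for k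
    unfolding diffs_def fact_Suc by (simp del: bt.simps of_nat_Suc)
  have up: "(\<lambda>k. up (\<lambda>n. bt k n / fact k * of_real t ^ k) n) sums up (b t) n"
  proof (cases n)
    case (Suc m)
    then show ?thesis unfolding up_def b_def Suc nat.case
      by (intro sums_mult summable_sums bt_summable)
  qed (simp add: up_def)
  have dn: "(\<lambda>k. dn (\<lambda>n. bt k n / fact k * of_real t ^ k) n) sums dn (b t) n"
    unfolding dn_def b_def by (intro sums_mult summable_sums bt_summable)
  have "(\<lambda>k. - \<i> * (up (\<lambda>n. bt k n / fact k * of_real t ^ k) n + dn (\<lambda>n. bt k n / fact k * of_real t ^ k) n))
     sums (- \<i> * (up (b t) n + dn (b t) n))"
    by (intro sums_mult sums_add up dn)
  moreover have "- \<i> * (up (\<lambda>n. bt k n / fact k * of_real t ^ k) n + dn (\<lambda>n. bt k n / fact k * of_real t ^ k) n)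
      = bt (Suc k) n / fact k * of_real t ^ k" for k
    by (simp add: up_def dn_def field_simps split: nat.split)
  ultimately have "(\<Sum>k. bt (Suc k) n / fact k * of_real t ^ k) = - \<i> * (up (b t) n + dn (b t) n)"
    by (simp add: sums_iff del: bt.simps)
  then show ?thesis using d unfolding eq by (simp del: bt.simps)
qed

lemma b_0: "b 0 n = bt 0 n"
  unfolding b_def by (subst suminf_finite[of "{0}"]) (auto simp del: bt.simps)

text \<open>Finite propagation turned into decay: the term of order k reaches site n only if n \<le>
  k + 1, and then \<open>R ^ n \<le> R ^ Suc k\<close>, so the exponential series in
  \<open>2 * W * \<bar>T\<bar> * R\<close> dominates. Enlarging the given ratio to at least 1
  validates this comparison of powers.\<close>

lemma rapid_curve_b: "rapid_curve b"
  unfolding rapid_curve_def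
proof (intro allI impI)
  fix T R' :: real assume "R' \<ge> 0"
  define R where "R = max R' 1"
  have R: "R \<ge> 1" "R' \<le> R" by (auto simp: R_def)
  define x where "x = 2 * W * \<bar>T\<bar> * R"
  have "cmod (b t n) * R' ^ n \<le> R * exp x" if t: "\<bar>t\<bar> \<le> T" for t n
  proof -
    have T: "\<bar>t\<bar> \<le> \<bar>T\<bar>" using t by simp
    have "cmod (b t n) * R' ^ n \<le> cmod (b t n) * R ^ n"
      using R \<open>R' \<ge> 0\<close> by (intro mult_left_mono power_mono) auto
    also have "\<dots> = cmod (\<Sum>k. of_real (R ^ n) * (bt k n / fact k * of_real t ^ k))"
      using R by (subst suminf_mult[OF bt_summable]) (simp add: b_def norm_mult norm_power)
    also have "\<dots> \<le> (\<Sum>k. R * (x ^ k / fact k))"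
    proof (rule norm_suminf_le)
      show "summable (\<lambda>k. R * (x ^ k / fact k))" by (intro summable_mult exp_summable)
      fix k
      show "norm (of_real (R ^ n) * (bt k n / fact k * of_real t ^ k)) \<le> R * (x ^ k / fact k)"
      proof (cases "n > Suc k")
        case True
        have "x \<ge> 0" unfolding x_def using R W_nonneg by simp
        then show ?thesis using R by (simp add: bt_zero[OF True])
      next
        case False
        have "R ^ n * (cmod (bt k n) * \<bar>t\<bar> ^ k) \<le> R ^ Suc k * ((2 * W) ^ k * \<bar>T\<bar> ^ k)"
          using R T False W_nonneg
          by (intro mult_mono bt_bound power_mono power_increasing) auto
        then have "R ^ n * (cmod (bt k n) * \<bar>t\<bar> ^ k) / fact k \<le> R ^ Suc k * ((2 * W) ^ k * \<bar>T\<bar> ^ k) / fact k"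
          by (rule divide_right_mono) simp
        then show ?thesis using R by (simp add: norm_mult norm_divide norm_power x_def power_mult_distrib mult_ac)
      qed
    qed
    also have "\<dots> = R * exp x"
      by (subst suminf_mult[OF exp_summable]) (simp add: exp_def scaleR_conv_of_real divide_inverse mult.commute)
    finally show ?thesis .
  qed
  then show "\<exists>B. \<forall>t n. \<bar>t\<bar> \<le> T \<longrightarrow> cmod (b t n) * R' ^ n \<le> B" by blast
qed

section \<open>The solution in Hermite coordinates and its time derivatives\<close>

definition c :: "real \<Rightarrow> nat \<Rightarrow> complex" where
  "c t n = cis (- t * \<kappa> n) * b t n"

text \<open>Differentiation of \<open>c\<close> in time produces factors \<kappa> and ladder
  operators with rotating phases. The smallest class closed under these contains all time
  derivatives and consists of rapid curves, so smoothness becomes a structural induction.\<close>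

inductive_set curves :: "(real \<Rightarrow> nat \<Rightarrow> complex) set" where
  base: "c \<in> curves"
| add: "d \<in> curves \<Longrightarrow> e \<in> curves \<Longrightarrow> (\<lambda>t n. d t n + e t n) \<in> curves"
| scale: "d \<in> curves \<Longrightarrow> (\<lambda>t n. a * d t n) \<in> curves"
| mult_\<kappa>: "d \<in> curves \<Longrightarrow> (\<lambda>t n. of_real (\<kappa> n) * d t n) \<in> curves"
| up: "d \<in> curves \<Longrightarrow> (\<lambda>t n. cis (- t) * up (d t) n) \<in> curves"
| dn: "d \<in> curves \<Longrightarrow> (\<lambda>t n. cis t * dn (d t) n) \<in> curves"

definition Mc :: "real \<Rightarrow> (nat \<Rightarrow> complex) \<Rightarrow> nat \<Rightarrow> complex" where
  "Mc t d n = of_real (\<kappa> n) * d n + cis (- t) * up d n + cis t * dn d n"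

text \<open>Leaving the interaction picture: neighbouring values of \<open>\<kappa>\<close> differ
  by 1, so moving the free phase past a shift of the index costs exactly \<open>cis (- t)\<close> or
  \<open>cis t\<close>. \<open>Mc\<close> is the matrix of the full Hamiltonian at time t.\<close>

lemma c_deriv: "((\<lambda>t. c t n) has_vector_derivative - \<i> * Mc t (c t) n) (at t)"
proof -
  have "((\<lambda>t. cis (- \<kappa> n * t) * b t n) has_vector_derivative
     cis (- \<kappa> n * t) * (- \<i> * (up (b t) n + dn (b t) n)) + \<i> * of_real (- \<kappa> n) * cis (- \<kappa> n * t) * b t n) (at t)"
    by (intro has_vector_derivative_mult cis_deriv b_deriv)
  moreover have "cis (- \<kappa> n * t) * up (b t) n = cis (- t) * up (c t) n"
  proof (cases n)
    case (Suc m)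
    have "cis (- \<kappa> n * t) = cis (- t) * cis (- t * \<kappa> m)"
      unfolding cis_mult Suc \<kappa>_def by (rule arg_cong[of _ _ cis]) (simp add: algebra_simps)
    then show ?thesis by (simp add: up_def c_def Suc)
  qed (simp add: up_def)
  moreover have "cis (- \<kappa> n * t) * dn (b t) n = cis t * dn (c t) n"
  proof -
    have "cis (- \<kappa> n * t) = cis t * cis (- t * \<kappa> (Suc n))"
      unfolding cis_mult \<kappa>_def by (rule arg_cong[of _ _ cis]) (simp add: algebra_simps)
    then show ?thesis by (simp add: dn_def c_def)
  qed
  moreover have "(\<lambda>t. c t n) = (\<lambda>t. cis (- \<kappa> n * t) * b t n)" "c t n = cis (- \<kappa> n * t) * b t n"
    by (simp_all add: c_def mult.commute)
  moreover have "q * (- \<i> * (u + v)) + \<i> * of_real (- k) * q * z = - \<i> * (of_real k * (q * z) + q * u + q * v)"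
    for q u v z k by (simp add: algebra_simps)
  ultimately show ?thesis unfolding Mc_def by (simp only:)
qed

lemma Mc_curves: "d \<in> curves \<Longrightarrow> (\<lambda>t n. a * Mc t (d t) n) \<in> curves"
  unfolding Mc_def by (intro curves.intros)

lemma curves_deriv:
  "d \<in> curves \<Longrightarrow> \<exists>d'\<in>curves. \<forall>t n. ((\<lambda>t. d t n) has_vector_derivative d' t n) (at t)"
proof (induction rule: curves.induct)
  case base
  show ?case by (intro bexI[OF _ Mc_curves[OF curves.base, of "- \<i>"]] allI c_deriv)
next
  case (add d e)
  then obtain d' e' where *: "d' \<in> curves" "e' \<in> curves" "\<And>t n. ((\<lambda>t. d t n) has_vector_derivative d' t n) (at t)"
    "\<And>t n. ((\<lambda>t. e t n) has_vector_derivative e' t n) (at t)" by blast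
  show ?case
    by (intro bexI[OF _ curves.add[OF *(1,2)]] allI has_vector_derivative_add *)
next
  case (scale d a)
  then obtain d' where *: "d' \<in> curves" "\<And>t n. ((\<lambda>t. d t n) has_vector_derivative d' t n) (at t)" by blast
  show ?case by (intro bexI[OF _ curves.scale[OF *(1), of a]] allI has_vector_derivative_mult_right *)
next
  case (mult_\<kappa> d)
  then obtain d' where *: "d' \<in> curves" "\<And>t n. ((\<lambda>t. d t n) has_vector_derivative d' t n) (at t)" by blast
  show ?case by (intro bexI[OF _ curves.mult_\<kappa>[OF *(1)]] allI has_vector_derivative_mult_right *)
next
  case (up d)
  then obtain d' where *: "d' \<in> curves" "\<And>t n. ((\<lambda>t. d t n) has_vector_derivative d' t n) (at t)" by blast
  have u: "((\<lambda>t. up (d t) n) has_vector_derivative up (d' t) n) (at t)" for t n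
    unfolding up_def by (cases n) (auto intro: has_vector_derivative_mult_right *)
  have hd: "((\<lambda>t. cis (- t) * up (d t) n) has_vector_derivative
      cis (- t) * up (d' t) n + (- \<i>) * (cis (- t) * up (d t) n)) (at t)" for t n
    using has_vector_derivative_mult[OF cis_deriv[of "-1" t] u[of n t]] by (simp add: mult.assoc)
  show ?case
    by (intro bexI[OF _ curves.add[OF curves.up[OF *(1)] curves.scale[OF curves.up[OF up(1)], of "- \<i>"]]] allI hd)
next
  case (dn d)
  then obtain d' where *: "d' \<in> curves" "\<And>t n. ((\<lambda>t. d t n) has_vector_derivative d' t n) (at t)" by blast
  have u: "((\<lambda>t. dn (d t) n) has_vector_derivative dn (d' t) n) (at t)" for t n
    unfolding dn_def by (auto intro: has_vector_derivative_mult_right *)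
  have hd: "((\<lambda>t. cis t * dn (d t) n) has_vector_derivative
      cis t * dn (d' t) n + \<i> * (cis t * dn (d t) n)) (at t)" for t n
    using has_vector_derivative_mult[OF cis_deriv[of 1 t] u[of n t]] by (simp add: mult.assoc)
  show ?case
    by (intro bexI[OF _ curves.add[OF curves.dn[OF *(1)] curves.scale[OF curves.dn[OF dn(1)], of "\<i>"]]] allI hd)
qed

lemma rapid_curve_mono:
  assumes "rapid_curve d" "\<And>t n. cmod (e t n) \<le> K * 2 ^ n * cmod (d t n)" "K \<ge> 0"
  shows "rapid_curve e"
  unfolding rapid_curve_def
proof (intro allI impI)
  fix T R :: real assume R: "R \<ge> 0"
  then obtain B where B: "\<And>t n. \<bar>t\<bar> \<le> T \<Longrightarrow> cmod (d t n) * (2 * R) ^ n \<le> B"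
    using rapid_curveD[OF assms(1), of "2 * R" T] by auto
  have "cmod (e t n) * R ^ n \<le> K * B" if "\<bar>t\<bar> \<le> T" for t n
  proof -
    have "cmod (e t n) * R ^ n \<le> K * 2 ^ n * cmod (d t n) * R ^ n"
      using R by (intro mult_right_mono assms) auto
    also have "\<dots> = K * (cmod (d t n) * (2 * R) ^ n)" by (simp add: power_mult_distrib)
    also have "\<dots> \<le> K * B" by (intro mult_left_mono B that assms)
    finally show ?thesis .
  qed
  then show "\<exists>B. \<forall>t n. \<bar>t\<bar> \<le> T \<longrightarrow> cmod (e t n) * R ^ n \<le> B" by blast
qed

lemma up_norm: "cmod (up d (Suc m)) \<le> W * cmod (d m)" "up d 0 = 0"
  and dn_norm: "cmod (dn d n) \<le> W * cmod (d (Suc n))"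
  using w_nonneg w_le by (auto simp: up_def dn_def norm_mult intro!: mult_right_mono)

lemma rapid_curve_up: "rapid_curve d \<Longrightarrow> rapid_curve (\<lambda>t n. cis (- t) * up (d t) n)"
  unfolding rapid_curve_def
proof (intro allI impI)
  fix T R :: real assume d: "\<forall>T R. R \<ge> 0 \<longrightarrow> (\<exists>B. \<forall>t n. \<bar>t\<bar> \<le> T \<longrightarrow> cmod (d t n) * R ^ n \<le> B)" and R: "R \<ge> 0"
  obtain B where B: "\<And>t n. \<bar>t\<bar> \<le> T \<Longrightarrow> cmod (d t n) * R ^ n \<le> B" using d R by blast
  have "cmod (cis (- t) * up (d t) n) * R ^ n \<le> W * \<bar>B\<bar> * R" if "\<bar>t\<bar> \<le> T" for t n
  proof (cases n)
    case 0
    then show ?thesis using R W_nonneg by (simp add: up_norm)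
  next
    case (Suc m)
    have "cmod (up (d t) n) * R ^ n \<le> W * cmod (d t m) * R ^ n"
      unfolding Suc using R by (intro mult_right_mono up_norm) auto
    also have "\<dots> = W * R * (cmod (d t m) * R ^ m)" by (simp add: Suc)
    also have "\<dots> \<le> W * R * \<bar>B\<bar>"
      using R W_nonneg B[OF that, of m] by (intro mult_left_mono) auto
    finally show ?thesis by (simp add: norm_mult mult_ac)
  qed
  then show "\<exists>B. \<forall>t n. \<bar>t\<bar> \<le> T \<longrightarrow> cmod (cis (- t) * up (d t) n) * R ^ n \<le> B" by blast
qed

lemma rapid_curve_dn: "rapid_curve d \<Longrightarrow> rapid_curve (\<lambda>t n. cis t * dn (d t) n)"
  unfolding rapid_curve_def
proof (intro allI impI)
  fix T R :: real assume d: "\<forall>T R. R \<ge> 0 \<longrightarrow> (\<exists>B. \<forall>t n. \<bar>t\<bar> \<le> T \<longrightarrow> cmod (d t n) * R ^ n \<le> B)" and R: "R \<ge> 0"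
  \<comment> \<open>The lowering operator reads the coefficient of index n + 1; with a ratio of at
    least 1 the power n can be replaced by n + 1.\<close>
  define R' where "R' = max R 1"
  have R': "R' \<ge> 1" "R \<le> R'" by (auto simp: R'_def)
  obtain B where B: "\<And>t n. \<bar>t\<bar> \<le> T \<Longrightarrow> cmod (d t n) * R' ^ n \<le> B" using d R' by (metis order_trans zero_le_one)
  have "cmod (cis t * dn (d t) n) * R ^ n \<le> W * B" if "\<bar>t\<bar> \<le> T" for t n
  proof -
    have "R ^ n \<le> R' ^ n" using R R' by (intro power_mono) auto
    also have "\<dots> \<le> R' ^ Suc n" using R' by (intro power_increasing) auto
    finally have "cmod (dn (d t) n) * R ^ n \<le> (W * cmod (d t (Suc n))) * R' ^ Suc n"
      using R W_nonneg by (intro mult_mono dn_norm) auto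
    also have "\<dots> \<le> W * B" using mult_left_mono[OF B[OF that, of "Suc n"] W_nonneg] by (simp add: mult.assoc)
    finally show ?thesis by (simp add: norm_mult)
  qed
  then show "\<exists>B. \<forall>t n. \<bar>t\<bar> \<le> T \<longrightarrow> cmod (cis t * dn (d t) n) * R ^ n \<le> B" by blast
qed

lemma curves_rapid: "d \<in> curves \<Longrightarrow> rapid_curve d"
proof (induction rule: curves.induct)
  case base
  show ?case by (rule rapid_curve_mono[OF rapid_curve_b, of _ 1]) (auto simp: c_def norm_mult mult_le_cancel_right1)
next
  case (add d e)
  show ?case unfolding rapid_curve_def
  proof (intro allI impI)
    fix T R :: real assume R: "R \<ge> 0"
    then obtain B B' where "\<And>t n. \<bar>t\<bar> \<le> T \<Longrightarrow> cmod (d t n) * R ^ n \<le> B" "\<And>t n. \<bar>t\<bar> \<le> T \<Longrightarrow> cmod (e t n) * R ^ n \<le> B'"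
      using rapid_curveD add by metis
    moreover have "cmod (d t n + e t n) * R ^ n \<le> cmod (d t n) * R ^ n + cmod (e t n) * R ^ n" for t n
      unfolding distrib_right[symmetric] using R by (intro mult_right_mono norm_triangle_ineq) auto
    ultimately show "\<exists>B. \<forall>t n. \<bar>t\<bar> \<le> T \<longrightarrow> cmod (d t n + e t n) * R ^ n \<le> B"
      by (meson add_mono order_trans)
  qed
next
  case (scale d a)
  have "cmod (d t n) \<le> 2 ^ n * cmod (d t n)" for t n by (simp add: mult_le_cancel_right1)
  then have "cmod (a * d t n) \<le> cmod a * 2 ^ n * cmod (d t n)" for t n
    unfolding norm_mult mult.assoc by (intro mult_left_mono) auto
  then show ?case by (rule rapid_curve_mono[OF scale(2)]) simp
next
  case (mult_\<kappa> d)
  show ?case by (rule rapid_curve_mono[OF mult_\<kappa>(2), of _ 1])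
    (use \<kappa>_pos \<kappa>_le_two_power in \<open>auto simp: norm_mult less_imp_le intro!: mult_right_mono\<close>)
qed (auto intro: rapid_curve_up rapid_curve_dn)

text \<open>The second derivative belongs to \<open>curves\<close> too. Its decay with ratio 2,
  uniform near t, bounds the n-th coefficient of the error by a constant times |h| / 2^n, and these
  bounds sum to a multiple of |h|.\<close>

lemma curves_quotient:
  assumes d: "d \<in> curves" and d': "d' \<in> curves" and deriv: "\<And>t n. ((\<lambda>t. d t n) has_vector_derivative d' t n) (at t)"
  shows "((\<lambda>h. L2norm (hermite_series (\<lambda>n. (d (t + h) n - d t n) / of_real h - d' t n))) \<longlongrightarrow> 0) (at 0)"
    and "rapid (\<lambda>n. (d (t + h) n - d t n) / of_real h - d' t n)"
proof -
  show r: "rapid (\<lambda>n. (d (t + h) n - d t n) / of_real h - d' t n)" for h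
    using rapid_diff[OF rapid_cmult[OF rapid_diff, of _ _ "inverse (of_real h)"]] 
      rapid_curve_rapid[OF curves_rapid[OF d]] rapid_curve_rapid[OF curves_rapid[OF d']]
    by (simp add: divide_inverse mult.commute)
  obtain d'' where d'': "d'' \<in> curves" "\<And>t n. ((\<lambda>t. d' t n) has_vector_derivative d'' t n) (at t)"
    using curves_deriv[OF d'] by blast
  obtain B where B: "\<And>s n. \<bar>s\<bar> \<le> \<bar>t\<bar> + 1 \<Longrightarrow> cmod (d'' s n) * 2 ^ n \<le> B"
    using rapid_curveD[OF curves_rapid[OF d''(1)], of 2 "\<bar>t\<bar> + 1"] by auto
  have le: "L2norm (hermite_series (\<lambda>n. (d (t + h) n - d t n) / of_real h - d' t n)) \<le> 2 * B * \<bar>h\<bar>" if h: "h \<noteq> 0" "\<bar>h\<bar> \<le> 1" for h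
  proof -
    have 1: "cmod ((d (t + h) n - d t n) / of_real h - d' t n) \<le> B * \<bar>h\<bar> * (1 / 2) ^ n" for n
    proof -
      have "cmod (d (t + h) n - d t n - of_real h * d' t n) \<le> (B / 2 ^ n) * h\<^sup>2"
        by (rule taylor1_bound[OF deriv d''(2) _ h(2)]) (use B in \<open>simp add: pos_le_divide_eq\<close>)
      moreover have eq: "(d (t + h) n - d t n) / of_real h - d' t n = (d (t + h) n - d t n - of_real h * d' t n) / of_real h"
        using h by (simp add: field_simps)
      ultimately have "cmod ((d (t + h) n - d t n) / of_real h - d' t n) \<le> (B / 2 ^ n) * h\<^sup>2 / \<bar>h\<bar>"
        unfolding eq norm_divide norm_of_real by (intro divide_right_mono) auto
      also have "\<dots> = B * \<bar>h\<bar> * (1 / 2) ^ n" using h by (simp add: power2_eq_square power_divide field_simps abs_if)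
      finally show ?thesis .
    qed
    have "L2norm (hermite_series (\<lambda>n. (d (t + h) n - d t n) / of_real h - d' t n)) \<le> (\<Sum>n. cmod ((d (t + h) n - d t n) / of_real h - d' t n))"
      by (rule L2norm_hermite_series_le[OF r])
    also have "\<dots> \<le> (\<Sum>n. B * \<bar>h\<bar> * (1 / 2) ^ n)"
      by (intro suminf_le 1 rapid_summable_norm r summable_mult summable_geometric) auto
    also have "\<dots> = 2 * B * \<bar>h\<bar>"
      by (subst suminf_mult) (auto simp: suminf_geometric)
    finally show ?thesis .
  qed
  show "((\<lambda>h. L2norm (hermite_series (\<lambda>n. (d (t + h) n - d t n) / of_real h - d' t n))) \<longlongrightarrow> 0) (at 0)"
  proof (rule Lim_null_comparison)
    have "\<forall>\<^sub>F h in at 0. h \<noteq> 0 \<and> \<bar>h\<bar> \<le> (1::real)"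
      by (auto simp: eventually_at intro!: exI[of _ 1])
    then show "\<forall>\<^sub>F h in at 0. norm (L2norm (hermite_series (\<lambda>n. (d (t + h) n - d t n) / of_real h - d' t n))) \<le> 2 * B * \<bar>h\<bar>"
      by eventually_elim (use le L2norm_nonneg in auto)
    have "((\<lambda>h. 2 * B * \<bar>h\<bar>) \<longlongrightarrow> 2 * B * \<bar>0\<bar>) (at (0::real))" by (intro tendsto_intros)
    then show "((\<lambda>h. 2 * B * \<bar>h\<bar>) \<longlongrightarrow> 0) (at (0::real))" by simp
  qed
qed

end

section \<open>Growth of the flow\<close>

lemma DERIV_series_bounded:
  fixes g g' :: "nat \<Rightarrow> real \<Rightarrow> real"
  assumes g: "\<And>n t. (g n has_real_derivative g' n t) (at t)"
    and M: "\<And>T. \<exists>M. summable M \<and> (\<forall>n t. \<bar>t\<bar> \<le> T \<longrightarrow> \<bar>g' n t\<bar> \<le> M n)"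
    and s: "\<And>t. summable (\<lambda>n. g n t)"
  shows "((\<lambda>t. \<Sum>n. g n t) has_real_derivative (\<Sum>n. g' n t)) (at t)"
proof -
  define S where "S = {- (\<bar>t\<bar> + 1)..\<bar>t\<bar> + 1}"
  obtain M where M: "summable M" "\<And>n s. \<bar>s\<bar> \<le> \<bar>t\<bar> + 1 \<Longrightarrow> \<bar>g' n s\<bar> \<le> M n" using M by blast
  show ?thesis
  proof (rule has_field_derivative_series'(2)[of S])
    show "uniformly_convergent_on S (\<lambda>n x. \<Sum>i<n. g' i x)"
      by (rule Weierstrass_m_test'[OF _ M(1)]) (use M(2) in \<open>auto simp: S_def\<close>)
    show "(g n has_real_derivative g' n x) (at x within S)" for n x
      by (rule has_field_derivative_at_within[OF g])
    show "t \<in> interior S" by (auto simp: S_def)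
    show "t \<in> S" by (auto simp: S_def)
  qed (auto simp: S_def s)
qed

text \<open>Bernoulli's inequality for x / \<mu>. Summed against masses with mean \<mu>, the tangent
  bound is Jensen's inequality for powers.\<close>

lemma power_tangent_le:
  fixes x \<mu> :: real
  assumes "x \<ge> 0" "\<mu> > 0"
  shows "\<mu> ^ m + real m * \<mu> ^ (m - 1) * (x - \<mu>) \<le> x ^ m"
proof (cases m)
  case (Suc k)
  have "1 + real m * (x / \<mu> - 1) \<le> (1 + (x / \<mu> - 1)) ^ m"
    by (rule Bernoulli_inequality) (use assms in simp)
  then have "\<mu> ^ m * (1 + real m * (x / \<mu> - 1)) \<le> \<mu> ^ m * (x / \<mu>) ^ m"
    using assms by (intro mult_left_mono) auto
  also have "\<mu> ^ m * (x / \<mu>) ^ m = x ^ m" using assms by (simp flip: power_mult_distrib)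
  also have "\<mu> ^ m * (1 + real m * (x / \<mu> - 1)) = \<mu> ^ m + real m * \<mu> ^ (m - 1) * (x - \<mu>)"
    using assms by (simp add: Suc field_simps)
  finally show ?thesis .
qed simp

lemma Re_has_real_derivative: "(f has_vector_derivative d) (at t) \<Longrightarrow> ((\<lambda>t. Re (f t)) has_real_derivative Re d) (at t)"
  and Im_has_real_derivative: "(f has_vector_derivative d) (at t) \<Longrightarrow> ((\<lambda>t. Im (f t)) has_real_derivative Im d) (at t)"
  unfolding has_real_derivative_iff_has_vector_derivative
  by (rule bounded_linear.has_vector_derivative[OF bounded_linear_Re] bounded_linear.has_vector_derivative[OF bounded_linear_Im], assumption)+

context jacobi
begin

section \<open>Currents, conservation of mass and the energy\<close>

lemma b_bound: "\<exists>B\<ge>0. \<forall>t n. \<bar>t\<bar> \<le> T \<longrightarrow> cmod (b t n) \<le> B * (1 / 4) ^ n \<and> cmod (b t n) \<le> B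
    \<and> cmod (b t (Suc n)) \<le> B * (1 / 4) ^ n \<and> cmod (up (b t) n) \<le> W * B \<and> cmod (dn (b t) n) \<le> W * B * (1 / 4) ^ n"
proof -
  \<comment> \<open>The ratio 1/4 leaves a summable (1/2)^n after multiplication by weights as large
    as 2^n, such as \<open>\<kappa>\<close>.\<close>
  obtain B where B: "\<And>t n. \<bar>t\<bar> \<le> T \<Longrightarrow> cmod (b t n) * 4 ^ n \<le> B"
    using rapid_curveD[OF rapid_curve_b, of 4 T] by auto
  define C where "C = \<bar>B\<bar>"
  have 1: "cmod (b t n) \<le> C * (1 / 4) ^ n" if "\<bar>t\<bar> \<le> T" for t n
    using B[OF that, of n] by (simp add: C_def power_divide field_simps)
  have le: "C * (1 / 4) ^ n \<le> C * 1" for n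
    by (intro mult_left_mono power_le_one) (auto simp: C_def)
  have 2: "cmod (b t n) \<le> C" if "\<bar>t\<bar> \<le> T" for t n
    using 1[OF that, of n] le[of n] by simp
  have 3: "cmod (b t (Suc n)) \<le> C * (1 / 4) ^ n" if "\<bar>t\<bar> \<le> T" for t n
  proof -
    have "C * (1 / 4) ^ Suc n \<le> C * (1 / 4) ^ n" by (simp add: C_def)
    then show ?thesis using 1[OF that, of "Suc n"] by simp
  qed
  have 4: "cmod (up (b t) n) \<le> W * C" if "\<bar>t\<bar> \<le> T" for t n
    using up_norm(1)[of "b t"] mult_left_mono[OF 2[OF that] W_nonneg] W_nonneg
    by (cases n) (auto simp: up_norm(2) C_def intro: order_trans)
  have 5: "cmod (dn (b t) n) \<le> W * C * (1 / 4) ^ n" if "\<bar>t\<bar> \<le> T" for t n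
    using dn_norm[of "b t" n] mult_left_mono[OF 3[OF that] W_nonneg, of n] by (simp add: mult.assoc)
  show ?thesis using 1 2 3 4 5 by (intro exI[of _ C]) (auto simp: C_def)
qed

text \<open>The current through the bond between n and n + 1, counted positive when mass moves down;
  hence the minus sign in \<open>flux\<close>. Together with \<open>cur_shift\<close>,
  \<open>normsq_deriv\<close> is the discrete continuity equation.\<close>

definition cur :: "nat \<Rightarrow> real \<Rightarrow> real" where
  "cur n t = 2 * Im (cnj (b t n) * dn (b t) n)"

lemma cur_shift: "2 * Im (cnj (b t n) * up (b t) n) = - (case n of 0 \<Rightarrow> 0 | Suc m \<Rightarrow> cur m t)"
  by (cases n) (simp_all add: up_def dn_def cur_def algebra_simps)

lemma Re_b_deriv: "((\<lambda>t. Re (b t n)) has_real_derivative Im (up (b t) n) + Im (dn (b t) n)) (at t)"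
  and Im_b_deriv: "((\<lambda>t. Im (b t n)) has_real_derivative - Re (dn (b t) n) - Re (up (b t) n)) (at t)"
  using Re_has_real_derivative[OF b_deriv[of n t]] Im_has_real_derivative[OF b_deriv[of n t]]
  by (simp_all add: add.commute)

lemma normsq_deriv:
  "((\<lambda>t. (cmod (b t n))\<^sup>2) has_real_derivative 2 * Im (cnj (b t n) * up (b t) n) + cur n t) (at t)"
proof -
  have "((\<lambda>t. (Re (b t n))\<^sup>2 + (Im (b t n))\<^sup>2) has_real_derivative
      2 * Im (cnj (b t n) * up (b t) n) + cur n t) (at t)"
    by (rule DERIV_cong[OF DERIV_add[OF DERIV_power[OF Re_b_deriv] DERIV_power[OF Im_b_deriv]]])
      (simp add: cur_def algebra_simps)
  then show ?thesis by (simp add: cmod_power2)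
qed

lemma summable_two_power_bound:
  assumes "\<And>n. \<bar>f n\<bar> \<le> K * (1 / 4) ^ n" shows "summable (\<lambda>n. 2 ^ n * f n :: real)"
proof (rule summable_comparison_test')
  show "summable (\<lambda>n. K * (1 / 2) ^ n)" by (intro summable_mult summable_geometric) simp
  show "norm (2 ^ n * f n) \<le> K * (1 / 2) ^ n" for n
  proof -
    have "2 ^ n * \<bar>f n\<bar> \<le> 2 ^ n * (K * (1 / 4) ^ n)" by (intro mult_left_mono assms) simp
    also have "\<dots> = K * (2 * (1 / 4)) ^ n" unfolding power_mult_distrib by simp
    finally show ?thesis by (simp add: abs_mult)
  qed
qed

lemma summable_weighted:
  assumes "\<And>n. \<bar>f n\<bar> \<le> K * (1 / 4) ^ n" "\<And>n. \<bar>p n\<bar> \<le> C * 2 ^ n" shows "summable (\<lambda>n. p n * f n :: real)"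
proof (rule summable_comparison_test')
  have "summable (\<lambda>n. 2 ^ n * \<bar>f n\<bar>)" by (rule summable_two_power_bound[of _ K]) (simp add: assms)
  then show "summable (\<lambda>n. C * (2 ^ n * \<bar>f n\<bar>))" by (rule summable_mult)
  show "norm (p n * f n) \<le> C * (2 ^ n * \<bar>f n\<bar>)" for n
    using mult_right_mono[OF assms(2)[of n], of "\<bar>f n\<bar>"] by (simp add: abs_mult mult.assoc)
qed

lemma Re_Im_mult_bound: "cmod u \<le> x \<Longrightarrow> cmod v \<le> y \<Longrightarrow> \<bar>Re (cnj u * v)\<bar> \<le> x * y \<and> \<bar>Im (cnj u * v)\<bar> \<le> x * y"
  using abs_Re_le_cmod[of "cnj u * v"] abs_Im_le_cmod[of "cnj u * v"] mult_mono[of "cmod u" x "cmod v" y]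
    order_trans[OF norm_ge_zero, of u x] by (auto simp: norm_mult intro: order_trans)

lemma two_Im_bound: "cmod u \<le> x \<Longrightarrow> cmod v \<le> y \<Longrightarrow> \<bar>2 * Im (cnj u * v)\<bar> \<le> 2 * (x * y)"
  using Re_Im_mult_bound[of u x v y] unfolding abs_mult[of 2] abs_numeral by linarith

lemma cur_bound: "\<exists>K\<ge>0. \<forall>n t. \<bar>t\<bar> \<le> T \<longrightarrow> \<bar>cur n t\<bar> \<le> K * (1 / 4) ^ n \<and>
    \<bar>2 * Im (cnj (b t n) * up (b t) n)\<bar> \<le> K * (1 / 4) ^ n \<and> (cmod (b t n))\<^sup>2 \<le> K * (1 / 4) ^ n"
proof -
  obtain B where B: "B \<ge> 0" "\<And>t n. \<bar>t\<bar> \<le> T \<Longrightarrow> cmod (b t n) \<le> B * (1 / 4) ^ n" "\<And>t n. \<bar>t\<bar> \<le> T \<Longrightarrow> cmod (b t n) \<le> B"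
    "\<And>t n. \<bar>t\<bar> \<le> T \<Longrightarrow> cmod (up (b t) n) \<le> W * B" "\<And>t n. \<bar>t\<bar> \<le> T \<Longrightarrow> cmod (dn (b t) n) \<le> W * B * (1 / 4) ^ n"
    using b_bound[of T] by blast
  have "\<bar>cur n t\<bar> \<le> 2 * W * B\<^sup>2 * (1 / 4) ^ n" if "\<bar>t\<bar> \<le> T" for n t
    unfolding cur_def by (rule order_trans[OF two_Im_bound[OF B(3)[OF that] B(5)[OF that]]])
      (simp add: power2_eq_square mult_ac)
  moreover have "\<bar>2 * Im (cnj (b t n) * up (b t) n)\<bar> \<le> 2 * W * B\<^sup>2 * (1 / 4) ^ n" if "\<bar>t\<bar> \<le> T" for n t
    by (rule order_trans[OF two_Im_bound[OF B(2)[OF that] B(4)[OF that]]])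
      (simp add: power2_eq_square mult_ac)
  moreover have "(cmod (b t n))\<^sup>2 \<le> B\<^sup>2 * (1 / 4) ^ n" if "\<bar>t\<bar> \<le> T" for n t
    using mult_mono[OF B(3)[OF that, of n] B(2)[OF that, of n]] B(1) by (simp add: power2_eq_square mult_ac)
  moreover have "2 * W * B\<^sup>2 * (1 / 4) ^ n \<le> (2 * W * B\<^sup>2 + B\<^sup>2) * (1 / 4) ^ n" "B\<^sup>2 * (1 / 4) ^ n \<le> (2 * W * B\<^sup>2 + B\<^sup>2) * (1 / 4) ^ n" for n
    using W_nonneg by (intro mult_right_mono; simp)+
  moreover have "2 * W * B\<^sup>2 + B\<^sup>2 \<ge> 0" using W_nonneg by simp
  ultimately show ?thesis by (intro exI[of _ "2 * W * B\<^sup>2 + B\<^sup>2"]) (meson order_trans)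
qed

lemma summable_weighted_b:
  assumes "\<And>n. \<bar>p n\<bar> \<le> C * 2 ^ n"
  shows "summable (\<lambda>n. p n * (cmod (b t n))\<^sup>2)" "summable (\<lambda>n. p n * cur n t)"
    "summable (\<lambda>n. p n * (2 * Im (cnj (b t n) * up (b t) n)))"
proof -
  obtain K where K: "\<And>n. \<bar>cur n t\<bar> \<le> K * (1 / 4) ^ n" "\<And>n. \<bar>2 * Im (cnj (b t n) * up (b t) n)\<bar> \<le> K * (1 / 4) ^ n"
    "\<And>n. (cmod (b t n))\<^sup>2 \<le> K * (1 / 4) ^ n"
    using cur_bound[of "\<bar>t\<bar>"] by blast
  show "summable (\<lambda>n. p n * (cmod (b t n))\<^sup>2)" by (rule summable_weighted[OF _ assms, of _ K]) (use K in simp)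
  show "summable (\<lambda>n. p n * cur n t)" by (rule summable_weighted[OF _ assms, of _ K]) (use K in simp)
  show "summable (\<lambda>n. p n * (2 * Im (cnj (b t n) * up (b t) n)))"
    by (rule summable_weighted[OF K(2) assms])
qed

text \<open>The continuity equation and a summation by parts: only the increments of the weight
  survive. Weight 1 gives conservation of mass, weight \<open>\<kappa>\<close> the flux as
  derivative of the energy.\<close>

lemma weighted_norm_deriv:
  assumes p: "\<And>n. \<bar>p n\<bar> \<le> C * 2 ^ n" and C: "C \<ge> 0"
  shows "((\<lambda>t. \<Sum>n. p n * (cmod (b t n))\<^sup>2) has_real_derivative (\<Sum>n. (p n - p (Suc n)) * cur n t)) (at t)"
proof -
  define u where "u n t = 2 * Im (cnj (b t n) * up (b t) n)" for n t
  have d: "((\<lambda>t. \<Sum>n. p n * (cmod (b t n))\<^sup>2) has_real_derivative (\<Sum>n. p n * (u n t + cur n t))) (at t)"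
  proof (rule DERIV_series_bounded)
    show "((\<lambda>t. p n * (cmod (b t n))\<^sup>2) has_real_derivative p n * (u n t + cur n t)) (at t)" for n t
      unfolding u_def by (intro DERIV_cmult normsq_deriv)
    show "summable (\<lambda>n. p n * (cmod (b t n))\<^sup>2)" for t by (rule summable_weighted_b[OF p])
    show "\<exists>M. summable M \<and> (\<forall>n t. \<bar>t\<bar> \<le> T \<longrightarrow> \<bar>p n * (u n t + cur n t)\<bar> \<le> M n)" for T
    proof -
      obtain K where K: "K \<ge> 0" "\<And>n t. \<bar>t\<bar> \<le> T \<Longrightarrow> \<bar>cur n t\<bar> \<le> K * (1 / 4) ^ n" "\<And>n t. \<bar>t\<bar> \<le> T \<Longrightarrow> \<bar>u n t\<bar> \<le> K * (1 / 4) ^ n"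
        using cur_bound[of T] unfolding u_def by blast
      have "summable (\<lambda>n. C * (2 * K) * (1 / 2) ^ n)" by (intro summable_mult summable_geometric) simp
      moreover have "\<bar>p n * (u n t + cur n t)\<bar> \<le> C * (2 * K) * (1 / 2) ^ n" if "\<bar>t\<bar> \<le> T" for n t
      proof -
        have "\<bar>u n t + cur n t\<bar> \<le> 2 * K * (1 / 4) ^ n" using K(2,3)[OF that, of n] by linarith
        then have "\<bar>p n * (u n t + cur n t)\<bar> \<le> (C * 2 ^ n) * (2 * K * (1 / 4) ^ n)"
          unfolding abs_mult using p C by (intro mult_mono) auto
        also have "\<dots> = C * (2 * K) * (2 * (1 / 4)) ^ n" unfolding power_mult_distrib by simp
        finally show ?thesis by simp
      qed
      ultimately show ?thesis by blast
    qed
  qed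
  have p': "\<bar>p (Suc n)\<bar> \<le> (2 * C) * 2 ^ n" for n using p[of "Suc n"] by simp
  have s: "summable (\<lambda>n. p n * cur n t)" "summable (\<lambda>n. p (Suc n) * cur n t)" "summable (\<lambda>n. p n * u n t)"
    unfolding u_def by (rule summable_weighted_b[OF p] summable_weighted_b[OF p'])+
  have "(\<Sum>n. p n * u n t) = (\<Sum>n. - (case n of 0 \<Rightarrow> 0 | Suc m \<Rightarrow> p (Suc m) * cur m t))"
    unfolding u_def cur_shift by (intro suminf_cong) (auto split: nat.split)
  also have "\<dots> = - (\<Sum>n. p (Suc n) * cur n t)"
    using suminf_shift[OF s(2)] by (subst suminf_minus) auto
  finally have "(\<Sum>n. p n * u n t) = - (\<Sum>n. p (Suc n) * cur n t)" .
  then have "(\<Sum>n. p n * (u n t + cur n t)) = (\<Sum>n. (p n - p (Suc n)) * cur n t)"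
    using s by (simp add: distrib_left left_diff_distrib suminf_add[symmetric] suminf_diff[symmetric])
  then show ?thesis using d by simp
qed

lemma mass: "(\<Sum>n. (cmod (b t n))\<^sup>2) = 2"
proof -
  have "((\<lambda>t. \<Sum>n. 1 * (cmod (b t n))\<^sup>2) has_real_derivative (\<Sum>n. (1 - 1) * cur n t)) (at t)" for t
    by (rule weighted_norm_deriv[of "\<lambda>_. 1" 1]) auto
  then have "((\<lambda>t. \<Sum>n. (cmod (b t n))\<^sup>2) has_real_derivative 0) (at t)" for t by simp
  then have "(\<Sum>n. (cmod (b t n))\<^sup>2) = (\<Sum>n. (cmod (b 0 n))\<^sup>2)" by (intro DERIV_isconst_all) auto
  also have "\<dots> = (\<Sum>n\<in>{0,1}. (cmod (b 0 n))\<^sup>2)"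
    by (rule suminf_finite) (auto simp: b_0)
  also have "\<dots> = 2" by (simp add: b_0)
  finally show ?thesis .
qed

text \<open>The first two terms are one second-neighbour correlation taken at adjacent positions and
  cancel when summed over n. The last term is the one whose sum has a sign.\<close>

lemma b_product_deriv:
  "((\<lambda>t. cur n t) has_real_derivative
     2 * (w n * Re (cnj (up (b t) n) * b t (Suc n)) - w n * w (Suc n) * Re (cnj (b t n) * b t (Suc (Suc n)))
        + (w n)\<^sup>2 * ((cmod (b t (Suc n)))\<^sup>2 - (cmod (b t n))\<^sup>2))) (at t)"
proof -
  have "((\<lambda>t. 2 * w n * (Re (b t n) * Im (b t (Suc n)) - Im (b t n) * Re (b t (Suc n)))) has_real_derivative
     2 * (w n * Re (cnj (up (b t) n) * b t (Suc n)) - w n * w (Suc n) * Re (cnj (b t n) * b t (Suc (Suc n)))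
        + (w n)\<^sup>2 * ((cmod (b t (Suc n)))\<^sup>2 - (cmod (b t n))\<^sup>2))) (at t)"
    by (rule DERIV_cong[OF DERIV_cmult[OF DERIV_diff[OF
          DERIV_mult[OF Re_b_deriv Im_b_deriv] DERIV_mult[OF Im_b_deriv Re_b_deriv]]]])
      (unfold cmod_power2, simp add: dn_def up_def[of _ "Suc n"] algebra_simps power2_eq_square)
  then show ?thesis by (simp add: cur_def dn_def algebra_simps)
qed

definition flux :: "real \<Rightarrow> real" where
  "flux t = - (\<Sum>n. cur n t)"

lemma flux_mono: assumes "t \<ge> 0" shows "flux 0 \<le> flux t"
proof -
  define q where "q n t = w n * w (Suc n) * Re (cnj (b t n) * b t (Suc (Suc n)))" for n t
  define q' where "q' n t = w n * Re (cnj (up (b t) n) * b t (Suc n))" for n t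
  define v where "v n t = (w n)\<^sup>2 * (cmod (b t (Suc n)))\<^sup>2" for n t
  define v' where "v' n t = (w n)\<^sup>2 * (cmod (b t n))\<^sup>2" for n t
  have q': "q' n t = (case n of 0 \<Rightarrow> 0 | Suc m \<Rightarrow> q m t)" for n t
    by (cases n) (simp_all add: q'_def q_def up_def algebra_simps)
  have bd: "\<exists>K\<ge>0. \<forall>n t. \<bar>t\<bar> \<le> T \<longrightarrow> \<bar>q n t\<bar> \<le> K * (1 / 4) ^ n \<and> \<bar>q' n t\<bar> \<le> K * (1 / 4) ^ n \<and>
     \<bar>v n t\<bar> \<le> K * (1 / 4) ^ n \<and> \<bar>v' n t\<bar> \<le> K * (1 / 4) ^ n" for T
  proof -
    obtain B where B: "B \<ge> 0" "\<And>t n. \<bar>t\<bar> \<le> T \<Longrightarrow> cmod (b t n) \<le> B * (1 / 4) ^ n" "\<And>t n. \<bar>t\<bar> \<le> T \<Longrightarrow> cmod (b t n) \<le> B"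
      "\<And>t n. \<bar>t\<bar> \<le> T \<Longrightarrow> cmod (b t (Suc n)) \<le> B * (1 / 4) ^ n" "\<And>t n. \<bar>t\<bar> \<le> T \<Longrightarrow> cmod (up (b t) n) \<le> W * B"
      using b_bound[of T] by blast
    have ww: "\<bar>w n\<bar> \<le> W" "w n \<ge> 0" for n using w_nonneg w_le by (auto simp: abs_of_nonneg)
    have "\<bar>q n t\<bar> \<le> (W * W) * ((B * (1 / 4) ^ n) * B)" "\<bar>q' n t\<bar> \<le> W * ((W * B) * (B * (1 / 4) ^ n))"
      "\<bar>v n t\<bar> \<le> (W * W) * ((B * (1 / 4) ^ n) * B)" "\<bar>v' n t\<bar> \<le> (W * W) * ((B * (1 / 4) ^ n) * B)"
      if t: "\<bar>t\<bar> \<le> T" for n t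
      unfolding q_def q'_def v_def v'_def abs_mult power2_eq_square
      by (intro mult_mono ww w_nonneg conjunct1[OF Re_Im_mult_bound] B(2-)[OF t] mult_nonneg_nonneg abs_ge_zero norm_ge_zero W_nonneg;
          use B(1) B(2-)[OF t] W_nonneg in \<open>simp add: mult_nonneg_nonneg\<close>)+
    then show ?thesis using B(1) W_nonneg by (intro exI[of _ "W * W * B * B"]) (auto simp: mult_ac)
  qed
  have sm: "summable (\<lambda>n. q n t)" "summable (\<lambda>n. q' n t)" "summable (\<lambda>n. v n t)" "summable (\<lambda>n. v' n t)" for t
  proof -
    obtain K where K: "\<And>n. \<bar>q n t\<bar> \<le> K * (1 / 4) ^ n" "\<And>n. \<bar>q' n t\<bar> \<le> K * (1 / 4) ^ n"
      "\<And>n. \<bar>v n t\<bar> \<le> K * (1 / 4) ^ n" "\<And>n. \<bar>v' n t\<bar> \<le> K * (1 / 4) ^ n" using bd[of "\<bar>t\<bar>"] by blast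
    have g: "summable (\<lambda>n. K * (1 / 4 :: real) ^ n)" by (intro summable_mult summable_geometric) simp
    show "summable (\<lambda>n. q n t)" "summable (\<lambda>n. q' n t)" "summable (\<lambda>n. v n t)" "summable (\<lambda>n. v' n t)"
      using K by (auto intro!: summable_comparison_test'[OF g])
  qed
  have four: "\<bar>2 * (x2 - x1 + (x3 - x4))\<bar> \<le> 8 * X"
    if "\<bar>x1\<bar> \<le> X" "\<bar>x2\<bar> \<le> X" "\<bar>x3\<bar> \<le> X" "\<bar>x4\<bar> \<le> X" for x1 x2 x3 x4 X :: real
    using that by (simp add: abs_le_iff)
  have d: "((\<lambda>t. \<Sum>n. cur n t) has_real_derivative (\<Sum>n. 2 * (q' n t - q n t + (v n t - v' n t)))) (at t)" for t
  proof (rule DERIV_series_bounded)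
    show "(cur n has_real_derivative 2 * (q' n t - q n t + (v n t - v' n t))) (at t)" for n t
      using b_product_deriv[of n t] by (simp add: q_def q'_def v_def v'_def right_diff_distrib)
    show "summable (\<lambda>n. cur n t)" for t using summable_weighted_b(2)[of "\<lambda>_. 1" 1 t] by simp
    show "\<exists>M. summable M \<and> (\<forall>n t. \<bar>t\<bar> \<le> T \<longrightarrow> \<bar>2 * (q' n t - q n t + (v n t - v' n t))\<bar> \<le> M n)" for T
    proof -
      obtain K where K: "\<And>n t. \<bar>t\<bar> \<le> T \<Longrightarrow> \<bar>q n t\<bar> \<le> K * (1 / 4) ^ n \<and> \<bar>q' n t\<bar> \<le> K * (1 / 4) ^ n \<and>
        \<bar>v n t\<bar> \<le> K * (1 / 4) ^ n \<and> \<bar>v' n t\<bar> \<le> K * (1 / 4) ^ n" using bd[of T] by blast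
      have "summable (\<lambda>n. 8 * (K * (1 / 4 :: real) ^ n))" by (intro summable_mult summable_geometric) simp
      moreover have "\<bar>2 * (q' n t - q n t + (v n t - v' n t))\<bar> \<le> 8 * (K * (1 / 4) ^ n)" if "\<bar>t\<bar> \<le> T" for n t
      proof -
        have "\<bar>q n t\<bar> \<le> K * (1 / 4) ^ n" "\<bar>q' n t\<bar> \<le> K * (1 / 4) ^ n"
          "\<bar>v n t\<bar> \<le> K * (1 / 4) ^ n" "\<bar>v' n t\<bar> \<le> K * (1 / 4) ^ n" using K[OF that, of n] by auto
        then show ?thesis by (rule four)
      qed
      ultimately show ?thesis by blast
    qed
  qed
  have "(\<Sum>n. 2 * (q' n t - q n t + (v n t - v' n t))) \<le> 0" for t
  proof -
    \<comment> \<open>\<open>q'\<close> is \<open>q\<close> with the index shifted by one and the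
      value 0 at the bottom, so the correlations cancel.\<close>
    have qq: "(\<Sum>n. q' n t) = (\<Sum>n. q n t)" unfolding q' by (rule suminf_shift(2)[OF sm(1)])
    \<comment> \<open>The shift brings both squared weights to the same site n: there w_(n-1)^2,
      replaced by 0 for n = 0, is compared with w_n^2. Monotone weights enter here.\<close>
    have "(\<Sum>n. v n t) = (\<Sum>n. case n of 0 \<Rightarrow> 0 | Suc m \<Rightarrow> v m t)" by (rule suminf_shift(2)[OF sm(3), symmetric])
    also have "\<dots> \<le> (\<Sum>n. v' n t)"
    proof (intro suminf_le suminf_shift(1) sm)
      show "(case n of 0 \<Rightarrow> 0 | Suc m \<Rightarrow> v m t) \<le> v' n t" for n
        by (cases n) (auto simp: v_def v'_def intro!: mult_right_mono power_mono w_mono w_nonneg)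
    qed
    finally have "(\<Sum>n. v n t) \<le> (\<Sum>n. v' n t)" .
    moreover have "(\<Sum>n. 2 * (q' n t - q n t + (v n t - v' n t)))
        = 2 * ((\<Sum>n. q' n t) - (\<Sum>n. q n t) + ((\<Sum>n. v n t) - (\<Sum>n. v' n t)))"
      using sm by (simp add: suminf_mult suminf_add[symmetric] suminf_diff[symmetric] summable_diff summable_add)
    ultimately show ?thesis using qq by simp
  qed
  then show ?thesis
    unfolding flux_def using assms
    by (intro le_imp_neg_le DERIV_nonpos_imp_nonincreasing[OF assms]) (use d in blast)
qed

lemma flux_0: "flux 0 = 2 * w 0"
proof -
  have "(\<Sum>n. cur n 0) = (\<Sum>n\<in>{0}. cur n 0)"
    by (rule suminf_finite) (auto simp: cur_def dn_def b_0)
  then show ?thesis by (simp add: flux_def cur_def dn_def b_0)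
qed

definition energy :: "real \<Rightarrow> real" where
  "energy t = (\<Sum>n. \<kappa> n * (cmod (b t n))\<^sup>2)"

lemma \<kappa>_bound: "\<bar>\<kappa> n\<bar> \<le> 1 * 2 ^ n"
  using \<kappa>_le_two_power \<kappa>_pos[of n] by simp

text \<open>The derivative of the energy is the flux, which never falls below its initial value
  \<open>2 * w 0\<close>. The nonnegative initial energy is dropped.\<close>

lemma energy_ge: assumes "t \<ge> 0" shows "energy t \<ge> 2 * w 0 * t"
proof -
  have d: "(energy has_real_derivative flux t) (at t)" for t
  proof -
    have "(energy has_real_derivative (\<Sum>n. (\<kappa> n - \<kappa> (Suc n)) * cur n t)) (at t)"
      unfolding energy_def[abs_def] by (rule weighted_norm_deriv[OF \<kappa>_bound]) simp
    moreover have "(\<kappa> n - \<kappa> (Suc n)) * cur n t = - cur n t" for n by (simp add: \<kappa>_def)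
    ultimately show ?thesis
      using summable_weighted_b(2)[of "\<lambda>_. 1" 1 t] by (simp add: flux_def suminf_minus)
  qed
  have "(\<lambda>t. energy t - 2 * w 0 * t) 0 \<le> (\<lambda>t. energy t - 2 * w 0 * t) t"
  proof (rule DERIV_nonneg_imp_nondecreasing[OF assms])
    fix s assume "0 \<le> s" "s \<le> t"
    then show "\<exists>y. ((\<lambda>t. energy t - 2 * w 0 * t) has_real_derivative y) (at s) \<and> 0 \<le> y"
      using flux_mono[of s] flux_0 by (intro exI[of _ "flux s - 2 * w 0"]) (auto intro!: derivative_eq_intros d)
  qed
  moreover have "energy 0 \<ge> 0" unfolding energy_def
    by (intro suminf_nonneg summable_weighted_b(1)[OF \<kappa>_bound]) (simp add: \<kappa>_pos less_imp_le)
  ultimately show ?thesis by simp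
qed

lemma rapid_c: "rapid (c t)"
  by (rule rapid_curve_rapid[OF curves_rapid[OF curves.base]])

lemma sobolev_growth:
  assumes "t > 0" shows "Hs_norm r (hermite_series (c t)) \<ge> w 0 ^ r * t ^ r"
proof -
  \<comment> \<open>The mean of \<open>\<kappa>\<close>: the total mass of the data is 2.\<close>
  define \<mu> where "\<mu> = energy t / 2"
  have \<mu>: "\<mu> \<ge> w 0 * t" unfolding \<mu>_def using energy_ge[of t] assms by simp
  moreover have wt: "w 0 * t > 0" using w0 assms by simp
  ultimately have \<mu>0: "\<mu> > 0" by linarith
  \<comment> \<open>The phases in \<open>c\<close> drop out of the squared norm, which is the moment
    of order 2 r.\<close>
  define m where "m = 2 * r"
  define A where "A n = (cmod (b t n))\<^sup>2" for n
  have sA: "summable A" "summable (\<lambda>n. \<kappa> n * A n)"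
    unfolding A_def using summable_weighted_b(1)[of "\<lambda>_. 1" 1 t] summable_weighted_b(1)[OF \<kappa>_bound] by auto
  have SA: "suminf A = 2" unfolding A_def by (rule mass)
  have SE: "(\<Sum>n. \<kappa> n * A n) = 2 * \<mu>" by (simp add: \<mu>_def energy_def A_def)
  have sq: "(Hs_norm r (hermite_series (c t)))\<^sup>2 = (\<Sum>n. \<kappa> n ^ m * A n)"
    and sm: "summable (\<lambda>n. \<kappa> n ^ m * A n)"
  proof -
    have r: "rapid (\<lambda>n. of_real (\<kappa> n ^ r) * c t n)" by (rule rapid_\<kappa>_pow[OF rapid_c])
    have eq: "(cmod (of_real (\<kappa> n ^ r) * c t n))\<^sup>2 = \<kappa> n ^ m * A n" for n
      using \<kappa>_pos[of n] by (simp add: norm_mult norm_power c_def A_def m_def power_mult_distrib power_mult[symmetric] mult.commute)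
    show "(Hs_norm r (hermite_series (c t)))\<^sup>2 = (\<Sum>n. \<kappa> n ^ m * A n)"
      unfolding Hs_norm_hermite_series[OF rapid_c] L2norm_hermite_series_sq[OF r] eq ..
    show "summable (\<lambda>n. \<kappa> n ^ m * A n)" using summable_norm_sq[OF r] unfolding eq .
  qed
  \<comment> \<open>Jensen's inequality: the tangent bound at the mean is summed against the masses,
    and the linear term contributes nothing because \<mu> is the mean.\<close>
  have "(\<Sum>n. (\<mu> ^ m - real m * \<mu> ^ (m - 1) * \<mu>) * A n + real m * \<mu> ^ (m - 1) * (\<kappa> n * A n)) \<le> (\<Sum>n. \<kappa> n ^ m * A n)"
  proof (intro suminf_le summable_add summable_mult sA sm)
    fix n
    have "(\<mu> ^ m + real m * \<mu> ^ (m - 1) * (\<kappa> n - \<mu>)) * A n \<le> \<kappa> n ^ m * A n"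
      using \<kappa>_pos[of n] \<mu>0 by (intro mult_right_mono power_tangent_le) (auto simp: A_def)
    then show "(\<mu> ^ m - real m * \<mu> ^ (m - 1) * \<mu>) * A n + real m * \<mu> ^ (m - 1) * (\<kappa> n * A n) \<le> \<kappa> n ^ m * A n"
      by (simp add: algebra_simps)
  qed
  also have "(\<Sum>n. (\<mu> ^ m - real m * \<mu> ^ (m - 1) * \<mu>) * A n + real m * \<mu> ^ (m - 1) * (\<kappa> n * A n)) = 2 * \<mu> ^ m"
  proof -
    have e: "(\<Sum>n. x * A n + y * (\<kappa> n * A n)) = x * 2 + y * (2 * \<mu>)" for x y
      unfolding suminf_add[symmetric, OF summable_mult[OF sA(1)] summable_mult[OF sA(2)]]
        suminf_mult[OF sA(1)] suminf_mult[OF sA(2)] SA SE ..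
    show ?thesis unfolding e by (simp add: algebra_simps)
  qed
  finally have "2 * \<mu> ^ m \<le> (Hs_norm r (hermite_series (c t)))\<^sup>2" using sq by simp
  moreover have "((w 0 * t) ^ r)\<^sup>2 \<le> 2 * \<mu> ^ m"
  proof -
    have "(w 0 * t) ^ m \<le> \<mu> ^ m" using \<mu> wt by (intro power_mono) auto
    moreover have "0 \<le> \<mu> ^ m" using \<mu>0 by simp
    ultimately have "(w 0 * t) ^ m \<le> 2 * \<mu> ^ m" by linarith
    then show ?thesis by (simp add: m_def power_mult[symmetric] mult.commute)
  qed
  ultimately have "((w 0 * t) ^ r)\<^sup>2 \<le> (Hs_norm r (hermite_series (c t)))\<^sup>2" by linarith
  then have "(w 0 * t) ^ r \<le> Hs_norm r (hermite_series (c t))"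
    by (rule power2_le_imp_le) (simp add: Hs_norm_def L2norm_nonneg)
  then show ?thesis by (simp add: power_mult_distrib)
qed

end

section \<open>Wallis integrals and the symbol\<close>

text \<open>With s = tan (\<theta> / 2) this is half the integral of the p-th power of cos \<theta>
  over [0, \<pi>/2]. The rational form is the one in which the Gaussian layers of the symbol deliver
  it, with \<sigma> in the place of s.\<close>

definition wallis :: "nat \<Rightarrow> real" where
  "wallis p = integral {0..1} (\<lambda>s. (1 - s\<^sup>2) ^ p / (1 + s\<^sup>2) ^ Suc p)"

lemma one_plus_square_nonzero: "1 + (s::real)\<^sup>2 \<noteq> 0"
  using zero_le_power2[of s] by linarith

lemma wallis_integrable: "(\<lambda>s::real. (1 - s\<^sup>2) ^ p / (1 + s\<^sup>2) ^ Suc p) integrable_on {0..1}"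
  by (intro integrable_continuous_real continuous_intros) (simp add: one_plus_square_nonzero)

lemma wallis_has_integral: "((\<lambda>s::real. (1 - s\<^sup>2) ^ p / (1 + s\<^sup>2) ^ Suc p) has_integral wallis p) {0..1}"
  unfolding wallis_def by (rule integrable_integral[OF wallis_integrable])

lemma wallis_nonneg: "wallis p \<ge> 0"
  unfolding wallis_def by (rule integral_nonneg[OF wallis_integrable]) (auto simp: power_le_one add_nonneg_nonneg)

lemma wallis_mono: "wallis (Suc p) \<le> wallis p"
proof (rule has_integral_le[OF wallis_has_integral wallis_has_integral])
  fix s :: real assume s: "s \<in> {0..1}"
  then have s2: "s\<^sup>2 \<le> 1" by (simp add: power_le_one)
  have "(1 - s\<^sup>2) ^ Suc p / (1 + s\<^sup>2) ^ Suc (Suc p) = (1 - s\<^sup>2) ^ p / (1 + s\<^sup>2) ^ Suc p * ((1 - s\<^sup>2) / (1 + s\<^sup>2))"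
    by (simp add: mult_ac)
  also have "\<dots> \<le> (1 - s\<^sup>2) ^ p / (1 + s\<^sup>2) ^ Suc p * 1"
    using s2 by (intro mult_left_mono) (auto simp: divide_le_eq_1 add_pos_nonneg)
  finally show "(1 - s\<^sup>2) ^ Suc p / (1 + s\<^sup>2) ^ Suc (Suc p) \<le> (1 - s\<^sup>2) ^ p / (1 + s\<^sup>2) ^ Suc p" by simp
qed

text \<open>The primitive vanishes at both endpoints. In angular form it is half of sin \<theta>
  times the power p + 1 of cos \<theta>, as in the classical Wallis reduction.\<close>

lemma wallis_recurrence: "real (Suc (Suc p)) * wallis (Suc (Suc p)) = real (Suc p) * wallis p"
proof -
  have "((\<lambda>s::real. real (Suc (Suc p)) * ((1 - s\<^sup>2) ^ Suc (Suc p) / (1 + s\<^sup>2) ^ Suc (Suc (Suc p)))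
        - real (Suc p) * ((1 - s\<^sup>2) ^ p / (1 + s\<^sup>2) ^ Suc p)) has_integral
      (1 * (1 - 1\<^sup>2) ^ Suc p / (1 + 1\<^sup>2) ^ Suc (Suc p) - 0 * (1 - 0\<^sup>2) ^ Suc p / (1 + 0\<^sup>2) ^ Suc (Suc p))) {0..1}"
  proof (rule fundamental_theorem_of_calculus)
    fix s :: real
    \<comment> \<open>In the variable r, with 1 - s^2 = 2 - r, the claim becomes a polynomial
      identity once a common power of r is cancelled.\<close>
    define r where "r = 1 + s\<^sup>2"
    have r: "r \<noteq> 0" "1 - s\<^sup>2 = 2 - r" "s * s = r - 1"
      using one_plus_square_nonzero[of s] by (auto simp: r_def power2_eq_square)
    have "((\<lambda>s. s * (1 - s\<^sup>2) ^ Suc p / (1 + s\<^sup>2) ^ Suc (Suc p)) has_real_derivative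
      (((1 - s\<^sup>2) ^ Suc p + s * (real (Suc p) * (1 - s\<^sup>2) ^ p * (- 2 * s))) * (1 + s\<^sup>2) ^ Suc (Suc p)
        - s * (1 - s\<^sup>2) ^ Suc p * (real (Suc (Suc p)) * (1 + s\<^sup>2) ^ Suc p * (2 * s)))
        / ((1 + s\<^sup>2) ^ Suc (Suc p) * (1 + s\<^sup>2) ^ Suc (Suc p))) (at s)"
      by (rule DERIV_cong[OF DERIV_divide[OF DERIV_mult[OF DERIV_ident DERIV_power] DERIV_power]])
        (auto intro!: derivative_eq_intros simp: one_plus_square_nonzero algebra_simps simp del: of_nat_Suc power_Suc)
    moreover have "(((1 - s\<^sup>2) ^ Suc p + s * (real (Suc p) * (1 - s\<^sup>2) ^ p * (- 2 * s))) * (1 + s\<^sup>2) ^ Suc (Suc p)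
        - s * (1 - s\<^sup>2) ^ Suc p * (real (Suc (Suc p)) * (1 + s\<^sup>2) ^ Suc p * (2 * s)))
        / ((1 + s\<^sup>2) ^ Suc (Suc p) * (1 + s\<^sup>2) ^ Suc (Suc p))
      = real (Suc (Suc p)) * ((1 - s\<^sup>2) ^ Suc (Suc p) / (1 + s\<^sup>2) ^ Suc (Suc (Suc p)))
        - real (Suc p) * ((1 - s\<^sup>2) ^ p / (1 + s\<^sup>2) ^ Suc p)" (is "?l = ?r")
    proof -
      define v where "v = 2 - r"
      define k where "k = real (Suc p)"
      have "?l = ((v ^ p * v - v ^ p * k * 2 * (r - 1)) * (r ^ p * r * r) - v ^ p * v * ((k + 1) * (r ^ p * r) * 2 * (r - 1)))
          / ((r ^ p * r * r) * (r ^ p * r * r))"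
        by (simp add: r_def[symmetric] v_def k_def r(2) r(3)[symmetric] algebra_simps)
      also have "\<dots> = v ^ p * ((v - k * 2 * (r - 1)) * r - v * ((k + 1) * 2 * (r - 1))) * (r ^ p * r) / ((r ^ p * r * r * r) * (r ^ p * r))"
        by (simp add: algebra_simps)
      also have "\<dots> = v ^ p * ((v - k * 2 * (r - 1)) * r - v * ((k + 1) * 2 * (r - 1))) / (r ^ p * r * r * r)"
        using r(1) by simp
      also have "(v - k * 2 * (r - 1)) * r - v * ((k + 1) * 2 * (r - 1)) = (k + 1) * v * v - k * r * r"
        by (simp add: v_def algebra_simps)
      also have "v ^ p * ((k + 1) * v * v - k * r * r) / (r ^ p * r * r * r)
          = (k + 1) * (v ^ p * v * v / (r ^ p * r * r * r)) - k * (v ^ p / (r ^ p * r))"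
        using r(1) by (simp add: field_simps)
      also have "\<dots> = ?r"
        by (simp add: r_def[symmetric] v_def k_def r(2) mult_ac)
      finally show ?thesis .
    qed
    ultimately show "((\<lambda>s. s * (1 - s\<^sup>2) ^ Suc p / (1 + s\<^sup>2) ^ Suc (Suc p)) has_vector_derivative
        real (Suc (Suc p)) * ((1 - s\<^sup>2) ^ Suc (Suc p) / (1 + s\<^sup>2) ^ Suc (Suc (Suc p)))
        - real (Suc p) * ((1 - s\<^sup>2) ^ p / (1 + s\<^sup>2) ^ Suc p)) (at s within {0..1})"
      by (simp only: has_real_derivative_iff_has_vector_derivative has_vector_derivative_at_within)
  qed simp
  moreover have "((\<lambda>s::real. real (Suc (Suc p)) * ((1 - s\<^sup>2) ^ Suc (Suc p) / (1 + s\<^sup>2) ^ Suc (Suc (Suc p)))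
        - real (Suc p) * ((1 - s\<^sup>2) ^ p / (1 + s\<^sup>2) ^ Suc p)) has_integral
      (real (Suc (Suc p)) * wallis (Suc (Suc p)) - real (Suc p) * wallis p)) {0..1}"
    by (intro has_integral_diff has_integral_mult_right wallis_has_integral)
  ultimately have "real (Suc (Suc p)) * wallis (Suc (Suc p)) - real (Suc p) * wallis p =
     1 * (1 - 1\<^sup>2) ^ Suc p / (1 + 1\<^sup>2) ^ Suc (Suc p) - 0 * (1 - 0\<^sup>2) ^ Suc p / (1 + 0\<^sup>2) ^ Suc (Suc p)"
    by (rule has_integral_unique[rotated])
  then show ?thesis by simp
qed

text \<open>Cauchy-Schwarz in discriminant form: with u = (1 - s^2) / (1 + s^2) and a nonnegative
  factor k, the integral of k (u - t)^2 is nonnegative for every t. The ratio of consecutive Wallis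
  integrals is the optimal t.\<close>

lemma wallis_log_convex: "(wallis (Suc p))\<^sup>2 \<le> wallis (Suc (Suc p)) * wallis p"
proof -
  have q: "0 \<le> wallis (Suc (Suc p)) - 2 * t * wallis (Suc p) + t\<^sup>2 * wallis p" for t
  proof (rule has_integral_nonneg)
    show "((\<lambda>s. (1 - s\<^sup>2) ^ Suc (Suc p) / (1 + s\<^sup>2) ^ Suc (Suc (Suc p))
        - 2 * t * ((1 - s\<^sup>2) ^ Suc p / (1 + s\<^sup>2) ^ Suc (Suc p))
        + t\<^sup>2 * ((1 - s\<^sup>2) ^ p / (1 + s\<^sup>2) ^ Suc p))
      has_integral (wallis (Suc (Suc p)) - 2 * t * wallis (Suc p) + t\<^sup>2 * wallis p)) {0..1}"
      by (intro has_integral_diff has_integral_add has_integral_mult_right wallis_has_integral)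
    fix s :: real assume "s \<in> {0..1}"
    then have s2: "s\<^sup>2 \<le> 1" by (simp add: power_le_one)
    define u where "u = (1 - s\<^sup>2) / (1 + s\<^sup>2)"
    define k where "k = (1 - s\<^sup>2) ^ p / (1 + s\<^sup>2) ^ Suc p"
    have "k \<ge> 0" unfolding k_def using s2 by (auto intro!: divide_nonneg_nonneg)
    then have "0 \<le> k * (u - t)\<^sup>2" by simp
    also have "\<dots> = k * (u * u) - 2 * t * (k * u) + t\<^sup>2 * k"
      by (simp add: power2_eq_square algebra_simps)
    finally show "0 \<le> (1 - s\<^sup>2) ^ Suc (Suc p) / (1 + s\<^sup>2) ^ Suc (Suc (Suc p))
        - 2 * t * ((1 - s\<^sup>2) ^ Suc p / (1 + s\<^sup>2) ^ Suc (Suc p))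
        + t\<^sup>2 * ((1 - s\<^sup>2) ^ p / (1 + s\<^sup>2) ^ Suc p)"
      by (simp add: k_def u_def mult_ac)
  qed
  show ?thesis
  proof (cases "wallis p = 0")
    case True
    then have "wallis (Suc p) = 0" using wallis_mono[of p] wallis_nonneg[of "Suc p"] by simp
    then show ?thesis using True by simp
  next
    case False
    then have pos: "wallis p > 0" using wallis_nonneg[of p] by simp
    have "0 \<le> (wallis (Suc (Suc p)) - 2 * (wallis (Suc p) / wallis p) * wallis (Suc p) + (wallis (Suc p) / wallis p)\<^sup>2 * wallis p) * wallis p"
      using q[of "wallis (Suc p) / wallis p"] pos by (intro mult_nonneg_nonneg) auto
    also have "\<dots> = wallis (Suc (Suc p)) * wallis p - (wallis (Suc p))\<^sup>2"
      using pos by (simp add: field_simps power2_eq_square)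
    finally show ?thesis by simp
  qed
qed

text \<open>The square root is the matrix entry of multiplication by x between
  \<open>hermite_fun n\<close> and \<open>hermite_fun (Suc n)\<close>. The Wallis factor is the
  damping by the profile.\<close>

definition weight :: "nat \<Rightarrow> real" where
  "weight n = sqrt (real (Suc n) / 2) * wallis (Suc n)"

lemma wallis_1_pos: "wallis (Suc 0) > 0"
proof -
  \<comment> \<open>The minorant comes from 1 - s^2 \<ge> 1 - s and (1 + s^2)^2 \<le> 4 on the unit
    interval.\<close>
  have "0 < integral {0..1::real} (\<lambda>s. (1 - s) / 4)"
  proof -
    have "((\<lambda>s::real. (1 - s) / 4) has_integral ((1 - 1\<^sup>2 / 2) / 4 - (0 - 0\<^sup>2 / 2) / 4)) {0..1}"
      by (rule fundamental_theorem_of_calculus)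
        (auto intro!: derivative_eq_intros simp flip: has_real_derivative_iff_has_vector_derivative)
    then have "integral {0..1::real} (\<lambda>s. (1 - s) / 4) = (1 - 1\<^sup>2 / 2) / 4 - (0 - 0\<^sup>2 / 2) / 4"
      by (rule integral_unique)
    also have "\<dots> > 0" by simp
    finally show ?thesis .
  qed
  also have "\<dots> \<le> wallis (Suc 0)"
    unfolding wallis_def
  proof (rule integral_le)
    show "(\<lambda>s::real. (1 - s) / 4) integrable_on {0..1}" by (intro integrable_continuous_real continuous_intros) simp
    fix s :: real assume s: "s \<in> {0..1}"
    then have "s\<^sup>2 \<le> s" by (simp add: power2_eq_square mult_left_le)
    moreover have "s\<^sup>2 \<le> 1" using s by (simp add: power_le_one)
    moreover have "(1 + s\<^sup>2) ^ Suc (Suc 0) \<le> 2 ^ Suc (Suc 0)" using s by (intro power_mono) (auto simp: power_le_one)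
    ultimately have "(1 - s) / 4 \<le> (1 - s\<^sup>2) ^ Suc 0 / (1 + s\<^sup>2) ^ Suc (Suc 0)"
      using s one_plus_square_nonzero[of s] by (intro frac_le) (auto simp: add_pos_nonneg)
    then show "(1 - s) / 4 \<le> (1 - s\<^sup>2) ^ Suc 0 / (1 + s\<^sup>2) ^ Suc (Suc 0)" .
  qed (rule wallis_integrable)
  finally show ?thesis .
qed

text \<open>The recurrence makes \<open>real (Suc n) * wallis (Suc n) * wallis n\<close> independent
  of n; as Wallis integrals decrease, this bounds the weights. Log-convexity multiplied by n + 1
  has, by the same recurrence, the right-hand side (n + 2) times the square of
  \<open>wallis (Suc (Suc n))\<close>, which is monotonicity of the squared weights.\<close>

lemma weight_jacobi: "jacobi weight (sqrt (wallis 1 * wallis 0))"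
proof
  fix n
  show "weight n \<ge> 0" unfolding weight_def by (simp add: wallis_nonneg)
  have sq: "(weight n)\<^sup>2 = real (Suc n) * (wallis (Suc n))\<^sup>2 / 2" for n
    unfolding weight_def power_mult_distrib by (simp add: add_nonneg_nonneg)
  have const: "real (Suc n) * wallis (Suc n) * wallis n = wallis 1 * wallis 0" for n
  proof (induction n)
    case (Suc n)
    then show ?case using wallis_recurrence[of n] by (simp only:) (simp add: mult_ac)
  qed simp
  have "(weight n)\<^sup>2 \<le> real (Suc n) * (wallis (Suc n) * wallis n)"
  proof -
    have "(wallis (Suc n))\<^sup>2 \<le> wallis (Suc n) * wallis n"
      unfolding power2_eq_square by (intro mult_left_mono wallis_mono wallis_nonneg)
    then have "real (Suc n) * (wallis (Suc n))\<^sup>2 \<le> real (Suc n) * (wallis (Suc n) * wallis n)"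
      by (intro mult_left_mono) auto
    moreover have "0 \<le> real (Suc n) * (wallis (Suc n))\<^sup>2" by simp
    ultimately show ?thesis unfolding sq by linarith
  qed
  then show "weight n \<le> sqrt (wallis 1 * wallis 0)"
    using const[of n] by (intro real_le_rsqrt) (simp only: mult.assoc)
  show "weight n \<le> weight (Suc n)"
  proof (rule power2_le_imp_le)
    have "real (Suc n) * (wallis (Suc n))\<^sup>2 \<le> real (Suc n) * (wallis (Suc (Suc n)) * wallis n)"
      by (intro mult_left_mono wallis_log_convex) simp
    also have "\<dots> = (real (Suc (Suc n)) * wallis (Suc (Suc n))) * wallis (Suc (Suc n))"
      unfolding wallis_recurrence by (simp only: mult_ac)
    finally show "(weight n)\<^sup>2 \<le> (weight (Suc n))\<^sup>2"
      unfolding sq by (simp only: power2_eq_square mult.assoc)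
    show "0 \<le> weight (Suc n)" unfolding weight_def by (simp add: wallis_nonneg)
  qed
  show "weight 0 > 0" unfolding weight_def using wallis_1_pos by simp
qed

section \<open>The radial profile and its derivatives\<close>

definition profile :: "nat \<Rightarrow> real \<Rightarrow> real" where
  "profile k \<rho> = integral {0..1} (\<lambda>s. (1 - s\<^sup>2) * s ^ (2 * k) * exp (- s\<^sup>2 * \<rho>))"

lemma profile_integrable: "(\<lambda>s::real. (1 - s\<^sup>2) * s ^ (2 * k) * exp (- s\<^sup>2 * \<rho>)) integrable_on {0..1}"
  by (intro integrable_continuous_real continuous_intros)

text \<open>Differentiation under the integral sign, where each derivative inserts -s^2. Thus
  \<open>profile k\<close> is, up to sign, the k-th derivative of \<open>profile 0\<close>.\<close>

lemma profile_deriv: "(profile k has_real_derivative - profile (Suc k) \<rho>) (at \<rho>)"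
proof -
  have "((\<lambda>\<rho>. integral (cbox 0 1) (\<lambda>s. (1 - s\<^sup>2) * s ^ (2 * k) * exp (- s\<^sup>2 * \<rho>))) has_real_derivative
     integral (cbox 0 1) (\<lambda>s. - ((1 - s\<^sup>2) * s ^ (2 * Suc k) * exp (- s\<^sup>2 * \<rho>)))) (at \<rho> within UNIV)"
  proof (rule leibniz_rule_field_derivative)
    show "((\<lambda>\<rho>. (1 - s\<^sup>2) * s ^ (2 * k) * exp (- s\<^sup>2 * \<rho>)) has_real_derivative
        - ((1 - s\<^sup>2) * s ^ (2 * Suc k) * exp (- s\<^sup>2 * \<rho>))) (at \<rho> within UNIV)" for s \<rho> :: real
      by (auto intro!: derivative_eq_intros simp: power2_eq_square)
    show "(\<lambda>s. (1 - s\<^sup>2) * s ^ (2 * k) * exp (- s\<^sup>2 * \<rho>)) integrable_on cbox 0 1" for \<rho> :: real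
      using profile_integrable by simp
    show "continuous_on (UNIV \<times> cbox 0 1) (\<lambda>(\<rho>, s::real). - ((1 - s\<^sup>2) * s ^ (2 * Suc k) * exp (- s\<^sup>2 * \<rho>)))"
      unfolding split_beta by (intro continuous_intros)
  qed auto
  then show ?thesis by (simp add: profile_def[abs_def])
qed

lemma profile_nonneg: "profile k \<rho> \<ge> 0"
  unfolding profile_def by (rule integral_nonneg[OF profile_integrable]) (auto simp: power_le_one)

lemma power_exp_le_fact: "0 \<le> (y::real) \<Longrightarrow> y ^ k * exp (- y) \<le> fact k"
proof -
  assume y: "0 \<le> y"
  have "y ^ k /\<^sub>R fact k \<le> exp y"
    unfolding exp_def using sum_le_suminf[OF summable_exp_generic[of y], of "{k}"] y by simp
  then show ?thesis by (simp add: exp_minus divide_inverse[symmetric] pos_divide_le_eq mult.commute scaleR_conv_of_real field_simps)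
qed

text \<open>For large \<rho> the mass sits at s of size (1 + \<rho>)^(-1/2): there s^(2k)
  contributes the power -k and the length of the interval the power -1/2.\<close>

lemma profile_bound: "\<exists>C>0. \<forall>\<rho>\<ge>0. profile k \<rho> \<le> C * (1 + \<rho>) powr (- real k - 1 / 2)"
proof -
  define A where "A = (fact k + fact (Suc k) :: real)"
  have A: "A > 0" by (simp add: A_def add_pos_pos)
  have "profile k \<rho> \<le> exp 1 * A * (pi / 2) * (1 + \<rho>) powr (- real k - 1 / 2)" if \<rho>: "\<rho> \<ge> 0" for \<rho>
  proof -
    \<comment> \<open>Passing from \<rho> to 1 + \<rho> in the exponent costs the factor exp (s^2),
      at most exp 1, and avoids the degenerate point \<rho> = 0.\<close>
    define q where "q = 1 + \<rho>"
    have q: "q \<ge> 1" using \<rho> by (simp add: q_def)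
    define r where "r = sqrt q"
    have r: "r > 0" "r\<^sup>2 = q" using q by (auto simp: r_def)
    \<comment> \<open>The majorant: bounding y^k exp (-y) by A / (1 + y) with y = (r s)^2 leaves an
      arctangent, itself at most \<pi>/2, and the factor 1 / r is the half power of decay.\<close>
    have int: "((\<lambda>s. exp 1 * A * (1 / q ^ k) * (1 / (1 + (r * s)\<^sup>2))) has_integral
        (exp 1 * A * (1 / q ^ k) * (arctan (r * 1) / r - arctan (r * 0) / r))) {0..1}"
    proof (intro has_integral_mult_right fundamental_theorem_of_calculus)
      show "((\<lambda>s. arctan (r * s) / r) has_vector_derivative 1 / (1 + (r * s)\<^sup>2)) (at s within {0..1})" for s
      proof -
        have "((\<lambda>s. arctan (r * s) / r) has_real_derivative 1 / (1 + (r * s)\<^sup>2)) (at s)"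
          by (rule DERIV_cong[OF DERIV_cdivide[OF DERIV_chain2[OF DERIV_arctan DERIV_cmult_Id]]])
            (use r in \<open>simp add: divide_inverse\<close>)
        then show ?thesis
          by (simp only: has_real_derivative_iff_has_vector_derivative has_vector_derivative_at_within)
      qed
    qed simp
    have "profile k \<rho> \<le> exp 1 * A * (1 / q ^ k) * (arctan (r * 1) / r - arctan (r * 0) / r)"
      unfolding profile_def
    proof (rule has_integral_le[OF integrable_integral[OF profile_integrable] int])
      fix s :: real assume s: "s \<in> {0..1}"
      define y where "y = s\<^sup>2 * q"
      have y: "y \<ge> 0" "(r * s)\<^sup>2 = y" using q r by (auto simp: y_def power_mult_distrib mult.commute)
      have "y ^ k * exp (- y) * (1 + y) = y ^ k * exp (- y) + y ^ Suc k * exp (- y)" by (simp add: algebra_simps)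
      also have "\<dots> \<le> A" unfolding A_def by (intro add_mono power_exp_le_fact y)
      finally have yk: "y ^ k * exp (- y) \<le> A * (1 / (1 + y))" using y(1) by (simp add: field_simps)
      have s2: "s\<^sup>2 \<le> 1" using s by (simp add: power_le_one)
      have "(1 - s\<^sup>2) * s ^ (2 * k) * exp (- s\<^sup>2 * \<rho>) \<le> 1 * s ^ (2 * k) * exp (- s\<^sup>2 * \<rho>)"
        using s by (intro mult_right_mono) auto
      also have "\<dots> = exp (s\<^sup>2) * ((y ^ k * exp (- y)) / q ^ k)"
      proof -
        have "exp (- s\<^sup>2 * \<rho>) = exp (s\<^sup>2) * exp (- y)"
          unfolding exp_add[symmetric] by (simp add: y_def q_def algebra_simps)
        moreover have "y ^ k / q ^ k = s ^ (2 * k)"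
          using q by (simp add: y_def power_mult_distrib power_mult)
        moreover have "exp (s\<^sup>2) * ((y ^ k * exp (- y)) / q ^ k) = (y ^ k / q ^ k) * (exp (s\<^sup>2) * exp (- y))"
          by simp
        ultimately show ?thesis by (simp only: mult_1)
      qed
      also have "\<dots> \<le> exp 1 * ((A * (1 / (1 + y))) / q ^ k)"
        by (rule mult_mono[OF _ divide_right_mono[OF yk]]) (use s2 q y(1) in auto)
      finally show "(1 - s\<^sup>2) * s ^ (2 * k) * exp (- s\<^sup>2 * \<rho>) \<le> exp 1 * A * (1 / q ^ k) * (1 / (1 + (r * s)\<^sup>2))"
        unfolding y(2) by (simp add: mult_ac)
    qed
    also have "\<dots> \<le> exp 1 * A * (1 / q ^ k) * ((pi / 2) / r)"
    proof (intro mult_left_mono)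
      have "arctan r / r \<le> (pi / 2) / r"
        using r arctan_ubound[of r] by (intro divide_right_mono) auto
      then show "arctan (r * 1) / r - arctan (r * 0) / r \<le> (pi / 2) / r" by simp
    qed (use A q in auto)
    also have "\<dots> = exp 1 * A * (pi / 2) * q powr (- real k - 1 / 2)"
    proof -
      have "q powr (- real k - 1 / 2) = 1 / q ^ k * (1 / r)"
      proof -
        have "q powr (- real k - 1 / 2) = q powr (- real k) * q powr (- (1 / 2))"
          unfolding powr_add[symmetric] by (rule arg_cong[of _ _ "(powr) q"]) simp
        also have "q powr (- real k) = 1 / q ^ k"
          unfolding powr_minus using q by (simp add: powr_realpow divide_inverse)
        also have "q powr (- (1 / 2)) = 1 / r"
          unfolding powr_minus r_def using q by (subst powr_half_sqrt) (simp_all add: divide_inverse)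
        finally show ?thesis .
      qed
      then show ?thesis by simp
    qed
    finally show ?thesis by (simp add: q_def)
  qed
  then show ?thesis using A by (intro exI[of _ "exp 1 * A * (pi / 2)"]) auto
qed

text \<open>\<open>m\<close> is twice the order of the symbol.\<close>

inductive symb :: "int \<Rightarrow> (real \<Rightarrow> real \<Rightarrow> real) \<Rightarrow> bool" where
  monomial: "int i + int j \<le> m + 2 * int k + 1 \<Longrightarrow> symb m (\<lambda>x \<xi>. x ^ i * \<xi> ^ j * profile k (x\<^sup>2 + \<xi>\<^sup>2))"
| add: "symb m f \<Longrightarrow> symb m h \<Longrightarrow> symb m (\<lambda>x \<xi>. f x \<xi> + h x \<xi>)"
| scale: "symb m f \<Longrightarrow> symb m (\<lambda>x \<xi>. c * f x \<xi>)"

lemma symb_deriv_x: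
  "symb m f \<Longrightarrow> \<exists>f'. symb (m - 1) f' \<and> (\<forall>x \<xi>. ((\<lambda>s. f s \<xi>) has_real_derivative f' x \<xi>) (at x))"
proof (induction rule: symb.induct)
  case (monomial i j m k)
  have "symb (m - 1) (\<lambda>x \<xi>. real i * (x ^ (i - 1) * \<xi> ^ j * profile k (x\<^sup>2 + \<xi>\<^sup>2)) + -2 * (x ^ (Suc i) * \<xi> ^ j * profile (Suc k) (x\<^sup>2 + \<xi>\<^sup>2)))"
  proof (intro symb.add)
    show "symb (m - 1) (\<lambda>x \<xi>. real i * (x ^ (i - 1) * \<xi> ^ j * profile k (x\<^sup>2 + \<xi>\<^sup>2)))"
    proof (cases i)
      \<comment> \<open>The truncated exponent \<open>i - 1\<close> stays 0, so the degree condition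
        may fail, but the coefficient is 0. The zero function is produced from a monomial whose
        profile index |m| satisfies the condition.\<close>
      case 0
      have "symb (m - 1) (\<lambda>x \<xi>. 0 * (x ^ 0 * \<xi> ^ 0 * profile (nat \<bar>m\<bar>) (x\<^sup>2 + \<xi>\<^sup>2)))"
        by (intro symb.scale symb.monomial) simp
      then show ?thesis using 0 by simp
    qed (intro symb.scale symb.monomial, use monomial in simp)
  qed (intro symb.scale symb.monomial, use monomial in simp)
  moreover have "((\<lambda>s. s ^ i * \<xi> ^ j * profile k (s\<^sup>2 + \<xi>\<^sup>2)) has_real_derivative
     real i * (x ^ (i - 1) * \<xi> ^ j * profile k (x\<^sup>2 + \<xi>\<^sup>2)) + -2 * (x ^ (Suc i) * \<xi> ^ j * profile (Suc k) (x\<^sup>2 + \<xi>\<^sup>2))) (at x)" for x \<xi>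
    by (auto intro!: derivative_eq_intros DERIV_chain2[OF profile_deriv] simp: algebra_simps)
  ultimately show ?case by blast
next
  case (add m f h)
  then obtain f' h' where "symb (m - 1) f'" "symb (m - 1) h'"
    "\<And>x \<xi>. ((\<lambda>s. f s \<xi>) has_real_derivative f' x \<xi>) (at x)" "\<And>x \<xi>. ((\<lambda>s. h s \<xi>) has_real_derivative h' x \<xi>) (at x)"
    by blast
  then show ?case by (intro exI[of _ "\<lambda>x \<xi>. f' x \<xi> + h' x \<xi>"]) (auto intro!: symb.add DERIV_add)
next
  case (scale m f c)
  then obtain f' where "symb (m - 1) f'" "\<And>x \<xi>. ((\<lambda>s. f s \<xi>) has_real_derivative f' x \<xi>) (at x)" by blast
  then show ?case by (intro exI[of _ "\<lambda>x \<xi>. c * f' x \<xi>"]) (auto intro!: symb.scale DERIV_cmult)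
qed

lemma symb_swap: "symb m f \<Longrightarrow> symb m (\<lambda>x \<xi>. f \<xi> x)"
proof (induction rule: symb.induct)
  case (monomial i j m k)
  then have "symb m (\<lambda>x \<xi>. x ^ j * \<xi> ^ i * profile k (x\<^sup>2 + \<xi>\<^sup>2))" by (intro symb.monomial) simp
  then show ?case by (simp add: mult_ac add.commute)
qed (auto intro: symb.intros)

lemma symb_deriv_xi:
  assumes "symb m f" shows "\<exists>f'. symb (m - 1) f' \<and> (\<forall>x \<xi>. ((\<lambda>s. f x s) has_real_derivative f' x \<xi>) (at \<xi>))"
proof -
  obtain f' where "symb (m - 1) f'" "\<And>x \<xi>. ((\<lambda>s. f \<xi> s) has_real_derivative f' x \<xi>) (at x)"
    using symb_deriv_x[OF symb_swap[OF assms]] by blast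
  then show ?thesis using symb_swap[of "m - 1" f'] by (intro exI[of _ "\<lambda>x \<xi>. f' \<xi> x"]) auto
qed

lemma symb_partial_x:
  assumes "symb m f"
  shows "symb (m - 1) (partial_x f)" "((\<lambda>s. f s \<xi>) has_real_derivative partial_x f x \<xi>) (at x)"
proof -
  obtain f' where f': "symb (m - 1) f'" "\<And>x \<xi>. ((\<lambda>s. f s \<xi>) has_real_derivative f' x \<xi>) (at x)"
    using symb_deriv_x[OF assms] by blast
  have "partial_x f = f'" unfolding partial_x_def using f'(2) by (auto intro!: DERIV_imp_deriv)
  then show "symb (m - 1) (partial_x f)" "((\<lambda>s. f s \<xi>) has_real_derivative partial_x f x \<xi>) (at x)" using f' by auto
qed

lemma symb_partial_xi:
  assumes "symb m f"
  shows "symb (m - 1) (partial_xi f)" "((\<lambda>s. f x s) has_real_derivative partial_xi f x \<xi>) (at \<xi>)"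
proof -
  obtain f' where f': "symb (m - 1) f'" "\<And>x \<xi>. ((\<lambda>s. f x s) has_real_derivative f' x \<xi>) (at \<xi>)"
    using symb_deriv_xi[OF assms] by blast
  have "partial_xi f = f'" unfolding partial_xi_def using f'(2) by (auto intro!: DERIV_imp_deriv)
  then show "symb (m - 1) (partial_xi f)" "((\<lambda>s. f x s) has_real_derivative partial_xi f x \<xi>) (at \<xi>)" using f' by auto
qed

lemma symb_partial_xi_pow: "symb m f \<Longrightarrow> symb (m - int \<beta>) ((partial_xi ^^ \<beta>) f)"
proof (induction \<beta>)
  case (Suc \<beta>)
  then show ?case using symb_partial_xi(1)[of "m - int \<beta>" "(partial_xi ^^ \<beta>) f"] by (simp add: algebra_simps)
qed simp

lemma symb_partial_x_pow: "symb m f \<Longrightarrow> symb (m - int \<alpha>) ((partial_x ^^ \<alpha>) f)"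
proof (induction \<alpha>)
  case (Suc \<alpha>)
  then show ?case using symb_partial_x(1)[of "m - int \<alpha>" "(partial_x ^^ \<alpha>) f"] by (simp add: algebra_simps)
qed simp

lemma symb_mixed: "symb m f \<Longrightarrow> symb (m - int (\<alpha> + \<beta>)) (mixed \<alpha> \<beta> f)"
  unfolding mixed_def using symb_partial_x_pow[OF symb_partial_xi_pow, of m f \<beta> \<alpha>] by (simp add: algebra_simps)

text \<open>\<open>deriv\<close> is additive where the derivatives exist, which the symbol class
  guarantees at every stage of the iteration.\<close>

lemma mixed_lincomb:
  assumes f: "symb m f" and h: "symb m h"
  shows "mixed \<alpha> \<beta> (\<lambda>x \<xi>. a * f x \<xi> + b * h x \<xi>) = (\<lambda>x \<xi>. a * mixed \<alpha> \<beta> f x \<xi> + b * mixed \<alpha> \<beta> h x \<xi>)"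
proof -
  have xi: "(partial_xi ^^ \<beta>) (\<lambda>x \<xi>. a * f x \<xi> + b * h x \<xi>) = (\<lambda>x \<xi>. a * (partial_xi ^^ \<beta>) f x \<xi> + b * (partial_xi ^^ \<beta>) h x \<xi>)" for \<beta>
  proof (induction \<beta>)
    case (Suc \<beta>)
    have "partial_xi (\<lambda>x \<xi>. a * (partial_xi ^^ \<beta>) f x \<xi> + b * (partial_xi ^^ \<beta>) h x \<xi>)
      = (\<lambda>x \<xi>. a * (partial_xi ^^ Suc \<beta>) f x \<xi> + b * (partial_xi ^^ Suc \<beta>) h x \<xi>)"
      unfolding partial_xi_def[of "\<lambda>x \<xi>. a * (partial_xi ^^ \<beta>) f x \<xi> + b * (partial_xi ^^ \<beta>) h x \<xi>"] funpow.simps o_apply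
      by (intro ext DERIV_imp_deriv DERIV_add DERIV_cmult
          symb_partial_xi(2)[OF symb_partial_xi_pow[OF f]] symb_partial_xi(2)[OF symb_partial_xi_pow[OF h]])
    then show ?case using Suc by simp
  qed simp
  have x: "(partial_x ^^ \<alpha>) (\<lambda>x \<xi>. a * (partial_xi ^^ \<beta>) f x \<xi> + b * (partial_xi ^^ \<beta>) h x \<xi>) = (\<lambda>x \<xi>. a * mixed \<alpha> \<beta> f x \<xi> + b * mixed \<alpha> \<beta> h x \<xi>)" for \<alpha>
  proof (induction \<alpha>)
    case (Suc \<alpha>)
    have "partial_x (\<lambda>x \<xi>. a * mixed \<alpha> \<beta> f x \<xi> + b * mixed \<alpha> \<beta> h x \<xi>)
      = (\<lambda>x \<xi>. a * mixed (Suc \<alpha>) \<beta> f x \<xi> + b * mixed (Suc \<alpha>) \<beta> h x \<xi>)"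
      unfolding partial_x_def[of "\<lambda>x \<xi>. a * mixed \<alpha> \<beta> f x \<xi> + b * mixed \<alpha> \<beta> h x \<xi>"] mixed_def[of "Suc \<alpha>"] funpow.simps o_apply
        mixed_def[of \<alpha> \<beta> f, symmetric] mixed_def[of \<alpha> \<beta> h, symmetric]
      by (intro ext DERIV_imp_deriv DERIV_add DERIV_cmult
          symb_partial_x(2)[OF symb_mixed[OF f]] symb_partial_x(2)[OF symb_mixed[OF h]])
    then show ?case using Suc by simp
  qed (simp add: mixed_def)
  show ?thesis unfolding mixed_def[of \<alpha> \<beta> "\<lambda>x \<xi>. a * f x \<xi> + b * h x \<xi>"] xi by (rule x)
qed

lemma symb_differentiable: "symb m f \<Longrightarrow> (\<lambda>(x, \<xi>). f x \<xi>) differentiable (at p)"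
proof (induction rule: symb.induct)
  case (monomial i j m k)
  have "(\<lambda>p. fst p ^ i * snd p ^ j * profile k ((fst p)\<^sup>2 + (snd p)\<^sup>2)) differentiable (at p)"
  proof -
    have fst: "(fst :: real \<times> real \<Rightarrow> real) differentiable (at p)" and snd: "(snd :: real \<times> real \<Rightarrow> real) differentiable (at p)"
      by (auto intro!: bounded_linear_imp_differentiable bounded_linear_fst bounded_linear_snd)
    have g: "profile k differentiable (at y)" for y
      using profile_deriv real_differentiable_def by blast
    have "(\<lambda>p. profile k ((fst p)\<^sup>2 + (snd p)\<^sup>2)) differentiable (at p)"
      using differentiable_compose[of "profile k" "\<lambda>p. (fst p)\<^sup>2 + (snd p)\<^sup>2" p UNIV] g fst snd by simp
    then show ?thesis using fst snd by simp
  qed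
  then show ?case by (simp add: split_beta)
qed (auto simp: split_beta)

text \<open>Each factor x or \<xi> counts half a power of 1 + x^2 + \<xi>^2, and
  \<open>profile k\<close> counts -k - 1/2. The summand 1 in the degree condition is this last
  half.\<close>

lemma symb_bound: "symb m f \<Longrightarrow> \<exists>C>0. \<forall>x \<xi>. \<bar>f x \<xi>\<bar> \<le> C * (1 + x\<^sup>2 + \<xi>\<^sup>2) powr (real_of_int m / 2)"
proof (induction rule: symb.induct)
  case (monomial i j m k)
  obtain C where C: "C > 0" "\<And>\<rho>. \<rho> \<ge> 0 \<Longrightarrow> profile k \<rho> \<le> C * (1 + \<rho>) powr (- real k - 1 / 2)"
    using profile_bound by blast
  have "\<bar>x ^ i * \<xi> ^ j * profile k (x\<^sup>2 + \<xi>\<^sup>2)\<bar> \<le> C * (1 + x\<^sup>2 + \<xi>\<^sup>2) powr (real_of_int m / 2)" for x \<xi>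
  proof -
    define q where "q = 1 + x\<^sup>2 + \<xi>\<^sup>2"
    have q: "q \<ge> 1" by (simp add: q_def)
    have r: "\<bar>x\<bar> \<le> q powr (1 / 2)" "\<bar>\<xi>\<bar> \<le> q powr (1 / 2)"
      using q by (auto simp: powr_half_sqrt q_def intro!: real_le_rsqrt)
    have p: "(q powr (1 / 2)) ^ n = q powr (real n / 2)" for n
      using q by (simp add: powr_realpow[symmetric] powr_powr)
    have "\<bar>x ^ i * \<xi> ^ j * profile k (x\<^sup>2 + \<xi>\<^sup>2)\<bar> = \<bar>x\<bar> ^ i * \<bar>\<xi>\<bar> ^ j * profile k (x\<^sup>2 + \<xi>\<^sup>2)"
      using profile_nonneg by (simp add: abs_mult power_abs)
    also have "\<dots> \<le> (q powr (1 / 2)) ^ i * (q powr (1 / 2)) ^ j * (C * q powr (- real k - 1 / 2))"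
      using r C(2)[of "x\<^sup>2 + \<xi>\<^sup>2"] profile_nonneg by (intro mult_mono power_mono) (auto simp: q_def add.assoc)
    also have "\<dots> = C * q powr (real i / 2 + real j / 2 + (- real k - 1 / 2))"
      unfolding p powr_add by simp
    also have "\<dots> \<le> C * q powr (real_of_int m / 2)"
    proof -
      have "real_of_int (int i + int j) \<le> real_of_int (m + 2 * int k + 1)" using monomial by (simp only: of_int_le_iff)
      then have "real i / 2 + real j / 2 + (- real k - 1 / 2) \<le> real_of_int m / 2" by simp
      then show ?thesis using C q by (intro mult_left_mono powr_mono) auto
    qed
    finally show ?thesis by (simp add: q_def)
  qed
  then show ?case using C(1) by blast
next
  case (add m f h)
  then obtain C D where C: "C > 0" "D > 0" "\<And>x \<xi>. \<bar>f x \<xi>\<bar> \<le> C * (1 + x\<^sup>2 + \<xi>\<^sup>2) powr (real_of_int m / 2)"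
    "\<And>x \<xi>. \<bar>h x \<xi>\<bar> \<le> D * (1 + x\<^sup>2 + \<xi>\<^sup>2) powr (real_of_int m / 2)" by blast
  have "\<bar>f x \<xi> + h x \<xi>\<bar> \<le> (C + D) * (1 + x\<^sup>2 + \<xi>\<^sup>2) powr (real_of_int m / 2)" for x \<xi>
    using C(3,4)[of x \<xi>] abs_triangle_ineq[of "f x \<xi>" "h x \<xi>"] by (simp add: distrib_right)
  then show ?case using C(1,2) by (intro exI[of _ "C + D"]) auto
next
  case (scale m f c)
  then obtain C where C: "C > 0" "\<And>x \<xi>. \<bar>f x \<xi>\<bar> \<le> C * (1 + x\<^sup>2 + \<xi>\<^sup>2) powr (real_of_int m / 2)" by blast
  have "\<bar>c * f x \<xi>\<bar> \<le> (\<bar>c\<bar> + 1) * (C * (1 + x\<^sup>2 + \<xi>\<^sup>2) powr (real_of_int m / 2))" for x \<xi>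
    unfolding abs_mult using C by (intro mult_mono) auto
  then show ?case using C(1) by (intro exI[of _ "(\<bar>c\<bar> + 1) * C"]) (auto simp: mult.assoc)
qed

lemma symb_S_ho: "symb 0 f \<Longrightarrow> f \<in> S_ho 0"
  unfolding S_ho_def smooth_plane_def mem_Collect_eq
proof (intro conjI allI)
  assume f: "symb 0 f"
  show "(\<lambda>(x, \<xi>). mixed \<alpha> \<beta> f x \<xi>) differentiable (at p)" for \<alpha> \<beta> p
    by (rule symb_differentiable[OF symb_mixed[OF f]])
  fix \<alpha> \<beta>
  have "real_of_int (0 - int (\<alpha> + \<beta>)) / 2 = 0 - real (\<alpha> + \<beta>) / 2"
    by (simp add: field_simps)
  then show "\<exists>C>0. \<forall>x \<xi>. \<bar>mixed \<alpha> \<beta> f x \<xi>\<bar> \<le> C * (1 + x\<^sup>2 + \<xi>\<^sup>2) powr (0 - real (\<alpha> + \<beta>) / 2)"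
    using symb_bound[OF symb_mixed[OF f, of \<alpha> \<beta>]] by (simp only:)
qed

text \<open>The suprema are subadditive because the weighted derivatives of symbols are bounded. The
  time dependence of the potential will sit in the scalars a and b, so this inequality controls the
  whole Frechet topology.\<close>

lemma S_ho_seminorm_lincomb:
  assumes f: "symb 0 f" and h: "symb 0 h"
  shows "0 \<le> S_ho_seminorm 0 j (\<lambda>x \<xi>. a * f x \<xi> + b * h x \<xi>)"
    and "S_ho_seminorm 0 j (\<lambda>x \<xi>. a * f x \<xi> + b * h x \<xi>) \<le> \<bar>a\<bar> * S_ho_seminorm 0 j f + \<bar>b\<bar> * S_ho_seminorm 0 j h"
proof -
  define N where "N \<alpha> \<beta> u = (\<lambda>(x, \<xi>). \<bar>mixed \<alpha> \<beta> u x \<xi>\<bar> * (1 + x\<^sup>2 + \<xi>\<^sup>2) powr (- 0 + real (\<alpha> + \<beta>) / 2))" for \<alpha> \<beta> u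
  have fin: "finite {(\<alpha>, \<beta>). \<alpha> + \<beta> \<le> (j::nat)}"
    by (rule finite_subset[of _ "{..j} \<times> {..j}"]) auto
  have bdd: "bdd_above (range (N \<alpha> \<beta> u))" if u: "symb 0 u" for u \<alpha> \<beta>
  proof -
    obtain C where C: "\<And>x \<xi>. \<bar>mixed \<alpha> \<beta> u x \<xi>\<bar> \<le> C * (1 + x\<^sup>2 + \<xi>\<^sup>2) powr (real_of_int (0 - int (\<alpha> + \<beta>)) / 2)"
      using symb_bound[OF symb_mixed[OF u]] by blast
    have "N \<alpha> \<beta> u p \<le> C" for p
    proof -
      obtain x \<xi> where p: "p = (x, \<xi>)" by (cases p)
      have "N \<alpha> \<beta> u p \<le> C * (1 + x\<^sup>2 + \<xi>\<^sup>2) powr (real_of_int (0 - int (\<alpha> + \<beta>)) / 2) * (1 + x\<^sup>2 + \<xi>\<^sup>2) powr (- 0 + real (\<alpha> + \<beta>) / 2)"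
        unfolding N_def p prod.case by (intro mult_right_mono C) simp
      also have "\<dots> = C * (1 + x\<^sup>2 + \<xi>\<^sup>2) powr (real_of_int (0 - int (\<alpha> + \<beta>)) / 2 + (- 0 + real (\<alpha> + \<beta>) / 2))"
        by (simp only: powr_add mult.assoc)
      also have "\<dots> = C"
      proof -
        have "1 + x\<^sup>2 + \<xi>\<^sup>2 > 0" by (simp add: add_pos_nonneg)
        moreover have "real_of_int (0 - int (\<alpha> + \<beta>)) / 2 + (- 0 + real (\<alpha> + \<beta>) / 2) = 0"
          by (simp flip: add_divide_distrib)
        ultimately show ?thesis by (simp only:) simp
      qed
      finally show ?thesis .
    qed
    then show ?thesis by (auto intro!: bdd_aboveI)
  qed
  have nn: "0 \<le> (SUP p. N \<alpha> \<beta> u p)" if "symb 0 u" for u \<alpha> \<beta>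
    by (rule cSUP_upper2[OF bdd[OF that], of "(0,0)"]) (auto simp: N_def)
  have S: "S_ho_seminorm 0 j u = (\<Sum>(\<alpha>, \<beta>)\<in>{(\<alpha>, \<beta>). \<alpha> + \<beta> \<le> j}. (SUP p. N \<alpha> \<beta> u p))" for u
    unfolding S_ho_seminorm_def N_def by simp
  have lc: "symb 0 (\<lambda>x \<xi>. a * f x \<xi> + b * h x \<xi>)" by (intro symb.add symb.scale f h)
  show "0 \<le> S_ho_seminorm 0 j (\<lambda>x \<xi>. a * f x \<xi> + b * h x \<xi>)"
    unfolding S by (intro sum_nonneg) (auto intro!: nn[OF lc])
  have "(SUP p. N \<alpha> \<beta> (\<lambda>x \<xi>. a * f x \<xi> + b * h x \<xi>) p) \<le> \<bar>a\<bar> * (SUP p. N \<alpha> \<beta> f p) + \<bar>b\<bar> * (SUP p. N \<alpha> \<beta> h p)" for \<alpha> \<beta>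
  proof (rule cSUP_least)
    fix p :: "real \<times> real"
    obtain x \<xi> where p: "p = (x, \<xi>)" by (cases p)
    have "\<bar>a * mixed \<alpha> \<beta> f x \<xi> + b * mixed \<alpha> \<beta> h x \<xi>\<bar> \<le> \<bar>a\<bar> * \<bar>mixed \<alpha> \<beta> f x \<xi>\<bar> + \<bar>b\<bar> * \<bar>mixed \<alpha> \<beta> h x \<xi>\<bar>"
      by (rule order_trans[OF abs_triangle_ineq]) (simp add: abs_mult)
    then have "N \<alpha> \<beta> (\<lambda>x \<xi>. a * f x \<xi> + b * h x \<xi>) p \<le> \<bar>a\<bar> * N \<alpha> \<beta> f p + \<bar>b\<bar> * N \<alpha> \<beta> h p"
      unfolding N_def p prod.case mixed_lincomb[OF f h]
      by (metis (no_types, lifting) distrib_right mult.assoc mult_right_mono powr_ge_zero)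
    also have "\<dots> \<le> \<bar>a\<bar> * (SUP p. N \<alpha> \<beta> f p) + \<bar>b\<bar> * (SUP p. N \<alpha> \<beta> h p)"
      by (intro add_mono mult_left_mono cSUP_upper bdd f h) auto
    finally show "N \<alpha> \<beta> (\<lambda>x \<xi>. a * f x \<xi> + b * h x \<xi>) p \<le> \<bar>a\<bar> * (SUP p. N \<alpha> \<beta> f p) + \<bar>b\<bar> * (SUP p. N \<alpha> \<beta> h p)" .
  qed simp
  then have "S_ho_seminorm 0 j (\<lambda>x \<xi>. a * f x \<xi> + b * h x \<xi>)
     \<le> (\<Sum>(\<alpha>, \<beta>)\<in>{(\<alpha>, \<beta>). \<alpha> + \<beta> \<le> j}. \<bar>a\<bar> * (SUP p. N \<alpha> \<beta> f p) + \<bar>b\<bar> * (SUP p. N \<alpha> \<beta> h p))"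
    unfolding S by (intro sum_mono) auto
  also have "\<dots> = \<bar>a\<bar> * S_ho_seminorm 0 j f + \<bar>b\<bar> * S_ho_seminorm 0 j h"
    unfolding S by (simp add: split_beta sum.distrib sum_distrib_left)
  finally show "S_ho_seminorm 0 j (\<lambda>x \<xi>. a * f x \<xi> + b * h x \<xi>) \<le> \<dots>" .
qed

section \<open>The rotating symbol as a smooth periodic curve\<close>

definition rot_symbol :: "real \<Rightarrow> real \<Rightarrow> real \<Rightarrow> real \<Rightarrow> real" where
  "rot_symbol a b x \<xi> = (a * x + b * \<xi>) * profile 0 (x\<^sup>2 + \<xi>\<^sup>2)"

definition symbol_x :: "real \<Rightarrow> real \<Rightarrow> real" where "symbol_x x \<xi> = x * profile 0 (x\<^sup>2 + \<xi>\<^sup>2)"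
definition symbol_xi :: "real \<Rightarrow> real \<Rightarrow> real" where "symbol_xi x \<xi> = \<xi> * profile 0 (x\<^sup>2 + \<xi>\<^sup>2)"

lemma symb_symbol_x: "symb 0 symbol_x"
  using symb.monomial[of 1 0 0 0] by (simp add: symbol_x_def[abs_def])

lemma symb_symbol_xi: "symb 0 symbol_xi"
  using symb.monomial[of 0 1 0 0] by (simp add: symbol_xi_def[abs_def])

lemma rot_symbol_eq: "rot_symbol a b = (\<lambda>x \<xi>. a * symbol_x x \<xi> + b * symbol_xi x \<xi>)"
  by (simp add: fun_eq_iff rot_symbol_def symbol_x_def symbol_xi_def algebra_simps)

text \<open>A time derivative advances the phase by a quarter turn, so all derivatives are rotated
  symbols again. Convergence in every seminorm reduces to the difference quotients of sine and
  cosine times two fixed seminorms.\<close>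

lemma Cb_smooth_rot_symbol: "Cb_smooth_A 0 (\<lambda>t. weyl (rot_symbol (cos t) (- sin t)))"
proof -
  define a where "a n t = rot_symbol (cos (t + real n * (pi / 2))) (- sin (t + real n * (pi / 2)))" for n :: nat and t
  have shift: "cos (t + real (Suc n) * (pi / 2)) = - sin (t + real n * (pi / 2))"
    "sin (t + real (Suc n) * (pi / 2)) = cos (t + real n * (pi / 2))" for n t
  proof -
    have "t + real (Suc n) * (pi / 2) = (t + real n * (pi / 2)) + pi / 2" by (simp add: algebra_simps)
    then show "cos (t + real (Suc n) * (pi / 2)) = - sin (t + real n * (pi / 2))"
      "sin (t + real (Suc n) * (pi / 2)) = cos (t + real n * (pi / 2))"
      by (simp_all only: cos_add sin_add) simp_all
  qed
  note lc = S_ho_seminorm_lincomb[OF symb_symbol_x symb_symbol_xi]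
  show ?thesis
    unfolding Cb_smooth_A_def
  proof (intro exI[of _ a] conjI allI)
    show "weyl (rot_symbol (cos t) (- sin t)) = weyl (a 0 t)" for t by (simp add: a_def)
    show "a 0 (t + 2 * pi) = a 0 t" for t by (simp add: a_def)
    show "a n t \<in> S_ho 0" for n t
      unfolding a_def rot_symbol_eq by (intro symb_S_ho symb.add symb.scale symb_symbol_x symb_symbol_xi)
    show "\<exists>M. \<forall>t. S_ho_seminorm 0 j (a n t) \<le> M" for n j
    proof (intro exI[of _ "S_ho_seminorm 0 j symbol_x + S_ho_seminorm 0 j symbol_xi"] allI)
      fix t
      have nn: "0 \<le> S_ho_seminorm 0 j symbol_x" "0 \<le> S_ho_seminorm 0 j symbol_xi"
        using lc(1)[of j 1 0] lc(1)[of j 0 1] by simp_all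
      show "S_ho_seminorm 0 j (a n t) \<le> S_ho_seminorm 0 j symbol_x + S_ho_seminorm 0 j symbol_xi"
        unfolding a_def rot_symbol_eq
        by (rule order_trans[OF lc(2)]) (intro add_mono mult_left_le_one_le nn; simp)
    qed
    fix n t j
    define \<theta> where "\<theta> = t + real n * (pi / 2)"
    define A where "A h = (cos (\<theta> + h) - cos \<theta>) / h - (- sin \<theta>)" for h
    define B where "B h = - ((sin (\<theta> + h) - sin \<theta>) / h - cos \<theta>)" for h
    have A: "(A \<longlongrightarrow> 0) (at 0)"
      unfolding A_def[abs_def] by (rule LIM_zero) (use DERIV_cos[of \<theta>] in \<open>simp add: DERIV_def\<close>)
    have "((\<lambda>h. (sin (\<theta> + h) - sin \<theta>) / h - cos \<theta>) \<longlongrightarrow> 0) (at 0)"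
      by (rule LIM_zero) (use DERIV_sin[of \<theta>] in \<open>simp add: DERIV_def\<close>)
    from tendsto_minus[OF this] have B: "(B \<longlongrightarrow> 0) (at 0)" unfolding B_def[abs_def] by simp
    have eq: "(\<lambda>x \<xi>. (a n (t + h) x \<xi> - a n t x \<xi>) / h - a (Suc n) t x \<xi>) = (\<lambda>x \<xi>. A h * symbol_x x \<xi> + B h * symbol_xi x \<xi>)" for h
    proof -
      have "t + h + real n * (pi / 2) = \<theta> + h" by (simp add: \<theta>_def)
      then show ?thesis
        unfolding a_def rot_symbol_eq shift A_def B_def \<theta>_def[symmetric]
        by (simp add: fun_eq_iff diff_divide_distrib add_divide_distrib algebra_simps)
    qed
    show "((\<lambda>h. S_ho_seminorm 0 j (\<lambda>x \<xi>. (a n (t + h) x \<xi> - a n t x \<xi>) / h - a (Suc n) t x \<xi>)) \<longlongrightarrow> 0) (at 0)"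
      unfolding eq
    proof (rule tendsto_sandwich[OF always_eventually always_eventually tendsto_const])
      have "((\<lambda>h. \<bar>A h\<bar> * S_ho_seminorm 0 j symbol_x + \<bar>B h\<bar> * S_ho_seminorm 0 j symbol_xi) \<longlongrightarrow> \<bar>0\<bar> * S_ho_seminorm 0 j symbol_x + \<bar>0\<bar> * S_ho_seminorm 0 j symbol_xi) (at 0)"
        by (intro tendsto_intros A B)
      then show "((\<lambda>h. \<bar>A h\<bar> * S_ho_seminorm 0 j symbol_x + \<bar>B h\<bar> * S_ho_seminorm 0 j symbol_xi) \<longlongrightarrow> 0) (at 0)" by simp
    qed (use lc in auto)
  qed
qed

section \<open>Oscillatory integrals and the Mehler kernel\<close>

lemma amp_at_0: "f \<in> amp \<Longrightarrow> (\<lambda>s y. f 0 y) \<in> amp"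
  by (induction rule: amp.induct) (auto intro: amp.intros)

lemma amp_continuous: "f \<in> amp \<Longrightarrow> continuous_on A (f s)"
  using amp_deriv[of f] by (auto intro!: continuous_at_imp_continuous_on has_vector_derivative_continuous)

text \<open>The Gaussian contained in a Hermite function of y, times the part of a Gaussian layer of
  the symbol that depends on the midpoint (x + y) / 2.\<close>

definition damping :: "real \<Rightarrow> real \<Rightarrow> real \<Rightarrow> complex" where
  "damping x s y = exp (complex_of_real (- y\<^sup>2 / 2 - s * (x + y)\<^sup>2 / 4))"

lemma norm_damping: "cmod (damping x s y) = exp (- y\<^sup>2 / 2 - s * (x + y)\<^sup>2 / 4)"
  by (simp add: damping_def)

lemma damping_deriv:
  "(damping x s has_vector_derivative of_real (- y - s * (x + y) / 2) * damping x s y) (at y)"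
proof -
  have "((\<lambda>y. - y\<^sup>2 / 2 - s * (x + y)\<^sup>2 / 4) has_real_derivative (- y - s * (x + y) / 2)) (at y)"
    by (auto intro!: derivative_eq_intros)
  from has_vector_derivative_exp_quadratic[OF has_vector_derivative_of_real[OF this]]
  show ?thesis by (simp add: damping_def[abs_def])
qed

lemma amp_damping_deriv:
  assumes "f \<in> amp"
  shows "\<exists>g\<in>amp. \<forall>s y. ((\<lambda>y. f s y * damping x s y) has_vector_derivative g s y * damping x s y) (at y)"
proof -
  obtain f' where f': "f' \<in> amp" "\<And>s y. (f s has_vector_derivative f' s y) (at y)"
    using amp_deriv[OF assms] by metis
  define g where "g s y = f' s y + f s y * (-1 * complex_of_real y + (-1 / 2) * complex_of_real s * (of_real x + complex_of_real y))" for s y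
  have "g \<in> amp" unfolding g_def[abs_def] by (intro amp.intros assms f')
  moreover have "((\<lambda>y. f s y * damping x s y) has_vector_derivative g s y * damping x s y) (at y)" for s y
    using has_vector_derivative_mult[OF f'(2)[of s y] damping_deriv[of x s y]]
    by (simp add: g_def algebra_simps)
  ultimately show ?thesis by blast
qed

text \<open>For s \<ge> 0 the factor depending on s is at most 1, so the fixed Gaussian in y
  supplies the decay, half of its rate absorbing the amplitude. Hence the uniformity down to s =
  0.\<close>

lemma amp_damping_bound:
  assumes "f \<in> amp"
  shows "\<exists>C\<ge>0. \<forall>s\<in>{0..1}. \<forall>y. cmod (f s y * damping x s y) \<le> C * exp (- (1 / 4) * y\<^sup>2)"
proof -
  obtain C d where C: "C \<ge> 0" "\<And>s y. s \<in> {0..1} \<Longrightarrow> cmod (f s y) \<le> C * exp (d * \<bar>y\<bar>)"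
    using amp_bound[OF assms] by blast
  have "cmod (f s y * damping x s y) \<le> C * exp (d\<^sup>2 / (4 * (1 / 4))) * exp (- (1 / 4) * y\<^sup>2)" if s: "s \<in> {0..1}" for s y
  proof -
    have "cmod (f s y * damping x s y) \<le> (C * (exp (d\<^sup>2 / (4 * (1 / 4))) * exp ((1 / 4) * y\<^sup>2))) * exp (- y\<^sup>2 / 2)"
      unfolding norm_mult norm_damping
      using C(1) s by (intro mult_mono order_trans[OF C(2)[OF s]] mult_left_mono exp_abs_le_gauss) auto
    also have "\<dots> = C * exp (d\<^sup>2 / (4 * (1 / 4))) * exp (- (1 / 4) * y\<^sup>2)"
      by (simp add: mult.assoc flip: exp_add)
    finally show ?thesis .
  qed
  then show ?thesis using C(1) by (intro exI[of _ "C * exp (d\<^sup>2 / (4 * (1 / 4)))"]) auto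
qed

lemma damping_continuous: "continuous_on A (damping x s)"
  unfolding damping_def[abs_def] by (intro continuous_intros) auto

lemma continuous_on_cis': "continuous_on A f \<Longrightarrow> continuous_on A (\<lambda>x. cis (f x))"
  unfolding cis_conv_exp by (intro continuous_intros)

text \<open>Each factor \<xi> is traded for a y-derivative, which maps amplitudes times
  \<open>damping\<close> to the same form. The amplitude changes at every step, so the induction
  keeps f arbitrary.\<close>

lemma oscillatory_decay:
  assumes "f \<in> amp"
  shows "\<exists>C. \<forall>s\<in>{0..1}. \<forall>\<xi>. \<bar>\<xi>\<bar> ^ k * cmod (\<integral>y. cis (- \<xi> * y) * (f s y * damping x s y) \<partial>lborel) \<le> C"
  using assms
proof (induction k arbitrary: f)
  case 0
  obtain C where C: "C \<ge> 0" "\<And>s y. s \<in> {0..1} \<Longrightarrow> cmod (f s y * damping x s y) \<le> C * exp (- (1 / 4) * y\<^sup>2)"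
    using amp_damping_bound[OF 0] by blast
  have "cmod (\<integral>y. cis (- \<xi> * y) * (f s y * damping x s y) \<partial>lborel) \<le> (\<integral>y. C * exp (- (1 / 4) * y\<^sup>2) \<partial>lborel)" if s: "s \<in> {0..1}" for s \<xi>
  proof -
    have int: "integrable lborel (\<lambda>y. C * exp (- (1 / 4) * y\<^sup>2))"
      using has_bochner_integral_gauss[of "1/4" 0] by (simp add: has_bochner_integral_iff)
    have "cmod (\<integral>y. cis (- \<xi> * y) * (f s y * damping x s y) \<partial>lborel) \<le> (\<integral>y. cmod (cis (- \<xi> * y) * (f s y * damping x s y)) \<partial>lborel)"
      by (rule integral_norm_bound)
    also have "\<dots> \<le> (\<integral>y. C * exp (- (1 / 4) * y\<^sup>2) \<partial>lborel)"
    proof (rule integral_mono')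
      show "cmod (cis (- \<xi> * y) * (f s y * damping x s y)) \<le> C * exp (- (1 / 4) * y\<^sup>2)" for y
        using C(2)[OF s, of y] by (simp only: norm_mult norm_cis mult_1)
    qed (use int C in auto)
    finally show ?thesis .
  qed
  then show ?case unfolding power_0 mult_1 by blast
next
  case (Suc k)
  obtain g where g: "g \<in> amp" "\<And>s y. ((\<lambda>y. f s y * damping x s y) has_vector_derivative g s y * damping x s y) (at y)"
    using amp_damping_deriv[OF Suc(2)] by blast
  have dec: "gauss_decay (\<lambda>y. cis (- \<xi> * y) * (h s y * damping x s y))" if h: "h \<in> amp" "s \<in> {0..1}" for h s \<xi>
  proof -
    obtain C where "\<And>y. cmod (h s y * damping x s y) \<le> C * exp (- (1 / 4) * y\<^sup>2)"
      using amp_damping_bound[OF h(1)] h(2) by blast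
    then have "gauss_decay (\<lambda>y. h s y * damping x s y)" by (intro gauss_decayI[of "1/4"]) auto
    then show ?thesis by (rule gauss_decay_mult_bounded[where C = 1]) simp
  qed
  have cont: "continuous_on UNIV (\<lambda>y. cis (- \<xi> * y) * (h s y * damping x s y))" if h: "h \<in> amp" for h s \<xi>
    by (intro continuous_intros continuous_on_cis' amp_continuous damping_continuous h)
  have eq: "\<i> * of_real \<xi> * (\<integral>y. cis (- \<xi> * y) * (f s y * damping x s y) \<partial>lborel) = (\<integral>y. cis (- \<xi> * y) * (g s y * damping x s y) \<partial>lborel)"
    if s: "s \<in> {0..1}" for s \<xi>
  proof -
    let ?F = "\<lambda>y. cis (- \<xi> * y) * (g s y * damping x s y) - \<i> * of_real \<xi> * (cis (- \<xi> * y) * (f s y * damping x s y))"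
    have "(\<integral>y. ?F y \<partial>lborel) = 0"
    proof (rule integral_derivative_eq_0)
      show "((\<lambda>y. cis (- \<xi> * y) * (f s y * damping x s y)) has_vector_derivative ?F y) (at y)" for y
        using has_vector_derivative_mult[OF cis_deriv[of "- \<xi>" y] g(2)[of s y]]
        by (simp add: algebra_simps)
      show "continuous_on UNIV ?F" by (intro continuous_intros cont g Suc)
      show "gauss_decay (\<lambda>y. cis (- \<xi> * y) * (f s y * damping x s y))" by (intro dec Suc s)
      show "gauss_decay ?F" by (intro gauss_decay_diff gauss_decay_cmult dec g Suc s)
    qed
    moreover have "integrable lborel (\<lambda>y. cis (- \<xi> * y) * (h s y * damping x s y))" if "h \<in> amp" for h
      by (intro integrable_gauss_decay dec that s)
        (use borel_measurable_continuous_onI[OF cont[OF that]] in simp)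
    ultimately show ?thesis using g(1) Suc(2) by simp
  qed
  obtain C where C: "\<And>s \<xi>. s \<in> {0..1} \<Longrightarrow> \<bar>\<xi>\<bar> ^ k * cmod (\<integral>y. cis (- \<xi> * y) * (g s y * damping x s y) \<partial>lborel) \<le> C"
    using Suc(1)[OF g(1)] by blast
  have "\<bar>\<xi>\<bar> ^ Suc k * cmod (\<integral>y. cis (- \<xi> * y) * (f s y * damping x s y) \<partial>lborel) \<le> C" if s: "s \<in> {0..1}" for s \<xi>
  proof -
    have eq2: "\<bar>\<xi>\<bar> * cmod (\<integral>y. cis (- \<xi> * y) * (f s y * damping x s y) \<partial>lborel) = cmod (\<integral>y. cis (- \<xi> * y) * (g s y * damping x s y) \<partial>lborel)"
      unfolding eq[OF s, symmetric] by (simp add: norm_mult)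
    show ?thesis unfolding power_Suc2 mult.assoc[of "\<bar>\<xi>\<bar> ^ k"] eq2 by (rule C[OF s])
  qed
  then show ?case by blast
qed

text \<open>The y-integral of the Weyl formula for a single Gaussian layer, without the factor exp
  (-s \<xi>^2), which does not depend on y.\<close>

definition inner_int :: "nat \<Rightarrow> real \<Rightarrow> real \<Rightarrow> real \<Rightarrow> real \<Rightarrow> real \<Rightarrow> complex" where
  "inner_int n a b x s \<xi> = (\<integral>y. cis ((x - y) * \<xi>) *
     of_real ((a * ((x + y) / 2) + b * \<xi>) * (exp (- s * (x + y)\<^sup>2 / 4) * hermite_fun n y)) \<partial>lborel)"

text \<open>
  The decay comes from integration by parts in \<open>y\<close> and is uniform down to \<open>s = 0\<close>, where the Gaussian factor
  in \<open>\<xi>\<close> disappears. This is what makes the exchange of the \<open>\<sigma>\<close> and \<open>\<xi>\<close> integrals legitimate.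
\<close>

lemma inner_int_decay:
  "\<exists>C\<ge>0. \<forall>s\<in>{0..1}. \<forall>\<xi>. cmod (inner_int n a b x s \<xi>) \<le> C * inverse (1 + \<xi>\<^sup>2)"
proof -
  obtain f0 where f0: "f0 \<in> amp" "hermite_c n = (\<lambda>y. f0 0 y * gwave 0 y)" using hermite_c_amp by blast
  define f2 where "f2 = (\<lambda>(s::real) y. f0 0 y)"
  define f1 where "f1 = (\<lambda>s y. of_real (a / 2) * (of_real x + complex_of_real y) * f2 s y)"
  have f2: "f2 \<in> amp" unfolding f2_def by (rule amp_at_0[OF f0(1)])
  have f1: "f1 \<in> amp" unfolding f1_def by (intro amp.intros f2)
  have hq: "of_real (exp (- s * (x + y)\<^sup>2 / 4) * hermite_fun n y) = f2 s y * damping x s y" for s y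
  proof -
    have "of_real (exp (- s * (x + y)\<^sup>2 / 4) * hermite_fun n y) = of_real (exp (- s * (x + y)\<^sup>2 / 4)) * hermite_c n y"
      by (simp add: hermite_c_def)
    also have "\<dots> = f2 s y * (of_real (exp (- s * (x + y)\<^sup>2 / 4)) * gwave 0 y)"
      by (simp add: f0(2) f2_def mult.left_commute)
    also have "of_real (exp (- s * (x + y)\<^sup>2 / 4)) * gwave 0 y = damping x s y"
    proof -
      have "of_real (exp (- s * (x + y)\<^sup>2 / 4)) * gwave 0 y = exp (of_real (- s * (x + y)\<^sup>2 / 4)) * exp (of_real (- y\<^sup>2 / 2))"
        by (simp only: gwave_def exp_of_real mult_zero_left of_real_0 mult_zero_right add_0_right)
      also have "\<dots> = damping x s y"
        unfolding damping_def exp_add[symmetric] of_real_add[symmetric]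
        by (rule arg_cong[of _ _ "\<lambda>z. exp (complex_of_real z)"]) simp
      finally show ?thesis .
    qed
    finally show ?thesis .
  qed
  define X where "X f s \<xi> = (\<integral>y. cis (- \<xi> * y) * (f s y * damping x s y) \<partial>lborel)" for f s \<xi>
  have int: "integrable lborel (\<lambda>y. cis (- \<xi> * y) * (f s y * damping x s y))" if f: "f \<in> amp" and s: "s \<in> {0..1}" for f s \<xi>
  proof (rule integrable_gauss_decay)
    obtain C where "\<And>y. cmod (f s y * damping x s y) \<le> C * exp (- (1 / 4) * y\<^sup>2)"
      using amp_damping_bound[OF f] s by blast
    then have "gauss_decay (\<lambda>y. f s y * damping x s y)" by (intro gauss_decayI[of "1/4"]) auto
    then show "gauss_decay (\<lambda>y. cis (- \<xi> * y) * (f s y * damping x s y))"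
      by (rule gauss_decay_mult_bounded[where C = 1]) simp
    have "continuous_on UNIV (\<lambda>y. cis (- \<xi> * y) * (f s y * damping x s y))"
      by (intro continuous_intros continuous_on_cis' amp_continuous damping_continuous f)
    then show "(\<lambda>y. cis (- \<xi> * y) * (f s y * damping x s y)) \<in> borel_measurable lborel"
      by (simp add: borel_measurable_continuous_onI)
  qed
  have eq: "inner_int n a b x s \<xi> = cis (x * \<xi>) * (X f1 s \<xi> + of_real (b * \<xi>) * X f2 s \<xi>)" if s: "s \<in> {0..1}" for s \<xi>
  proof -
    have pt: "cis ((x - y) * \<xi>) * of_real ((a * ((x + y) / 2) + b * \<xi>) * (exp (- s * (x + y)\<^sup>2 / 4) * hermite_fun n y))
      = cis (x * \<xi>) * (cis (- \<xi> * y) * (f1 s y * damping x s y) + of_real (b * \<xi>) * (cis (- \<xi> * y) * (f2 s y * damping x s y)))" for y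
    proof -
      have "cis ((x - y) * \<xi>) = cis (x * \<xi>) * cis (- \<xi> * y)"
        unfolding cis_mult by (rule arg_cong[of _ _ cis]) (simp add: algebra_simps)
      then show ?thesis
        unfolding of_real_mult[of "a * ((x + y) / 2) + b * \<xi>"] hq by (simp add: f1_def algebra_simps)
    qed
    show ?thesis
      unfolding inner_int_def pt X_def using int[OF f1 s, of \<xi>] int[OF f2 s, of \<xi>] by simp
  qed
  \<comment> \<open>Powers 0 and 2 of |\<xi>| for the midpoint part, 1 and 3 for the part that
    already carries a factor \<xi>: together they give the weight 1 + \<xi>^2.\<close>
  obtain C0 where C0: "\<And>s \<xi>. s \<in> {0..1} \<Longrightarrow> \<bar>\<xi>\<bar> ^ 0 * cmod (X f1 s \<xi>) \<le> C0"
    using oscillatory_decay[OF f1, of 0 x] unfolding X_def by blast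
  obtain C2 where C2: "\<And>s \<xi>. s \<in> {0..1} \<Longrightarrow> \<bar>\<xi>\<bar> ^ 2 * cmod (X f1 s \<xi>) \<le> C2"
    using oscillatory_decay[OF f1, of 2 x] unfolding X_def by blast
  obtain D1 where D1: "\<And>s \<xi>. s \<in> {0..1} \<Longrightarrow> \<bar>\<xi>\<bar> ^ 1 * cmod (X f2 s \<xi>) \<le> D1"
    using oscillatory_decay[OF f2, of 1 x] unfolding X_def by blast
  obtain D3 where D3: "\<And>s \<xi>. s \<in> {0..1} \<Longrightarrow> \<bar>\<xi>\<bar> ^ 3 * cmod (X f2 s \<xi>) \<le> D3"
    using oscillatory_decay[OF f2, of 3 x] unfolding X_def by blast
  define C where "C = C0 + C2 + \<bar>b\<bar> * (D1 + D3)"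
  have le: "cmod (inner_int n a b x s \<xi>) * (1 + \<xi>\<^sup>2) \<le> C" if s: "s \<in> {0..1}" for s \<xi>
  proof -
    have "cmod (inner_int n a b x s \<xi>) \<le> cmod (X f1 s \<xi>) + \<bar>b\<bar> * \<bar>\<xi>\<bar> * cmod (X f2 s \<xi>)"
      unfolding eq[OF s] norm_mult[of "cis (x * \<xi>)"] norm_cis mult_1
      by (rule order_trans[OF norm_triangle_ineq]) (simp add: norm_mult)
    then have "cmod (inner_int n a b x s \<xi>) * (1 + \<xi>\<^sup>2) \<le> (cmod (X f1 s \<xi>) + \<bar>b\<bar> * \<bar>\<xi>\<bar> * cmod (X f2 s \<xi>)) * (1 + \<bar>\<xi>\<bar>\<^sup>2)"
      by (simp add: mult_right_mono)
    also have "\<dots> = (\<bar>\<xi>\<bar> ^ 0 * cmod (X f1 s \<xi>) + \<bar>\<xi>\<bar> ^ 2 * cmod (X f1 s \<xi>))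
        + \<bar>b\<bar> * (\<bar>\<xi>\<bar> ^ 1 * cmod (X f2 s \<xi>) + \<bar>\<xi>\<bar> ^ 3 * cmod (X f2 s \<xi>))"
      by (simp add: algebra_simps power2_eq_square power3_eq_cube)
    also have "\<dots> \<le> C" unfolding C_def
      by (intro add_mono mult_left_mono C0 C2 D1 D3 s) auto
    finally show ?thesis .
  qed
  have "C \<ge> 0" using order_trans[OF _ le[of 0 0]] by simp
  moreover have "cmod (inner_int n a b x s \<xi>) \<le> C * inverse (1 + \<xi>\<^sup>2)" if "s \<in> {0..1}" for s \<xi>
    using le[OF that, of \<xi>] by (simp add: divide_inverse[symmetric] pos_le_divide_eq add_pos_nonneg)
  ultimately show ?thesis by blast
qed

text \<open>Domination by a product of functions of one variable; each exchange of integrals below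
  rests on such a bound.\<close>

lemma integrable_pair_bound:
  fixes F :: "real \<Rightarrow> real \<Rightarrow> complex"
  assumes meas: "(\<lambda>(x, y). F x y) \<in> borel_measurable (lborel \<Otimes>\<^sub>M lborel)"
    and le: "\<And>x y. cmod (F x y) \<le> u x * v y"
    and u: "integrable lborel u" and v: "integrable lborel v"
  shows "integrable (lborel \<Otimes>\<^sub>M lborel) (\<lambda>(x, y). F x y)"
proof (rule Bochner_Integration.integrable_bound[OF _ meas])
  note [measurable] = borel_measurable_integrable[OF u] borel_measurable_integrable[OF v]
  show "integrable (lborel \<Otimes>\<^sub>M lborel) (\<lambda>(x, y). u x * v y)"
    by (rule lborel_pair.Fubini_integrable) (use u v in \<open>auto simp: abs_mult\<close>)
  show "AE p in lborel \<Otimes>\<^sub>M lborel. norm (case p of (x, y) \<Rightarrow> F x y) \<le> norm (case p of (x, y) \<Rightarrow> u x * v y)"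
    using le by (auto intro!: AE_I2 order_trans[OF _ abs_ge_self])
qed

lemma cis_measurable[measurable]: "cis \<in> borel_measurable borel"
  by (intro borel_measurable_continuous_onI continuous_on_cis' continuous_on_id)

text \<open>What a Gaussian layer leaves after the \<xi>-integration: the first summand of the
  exponent is the Fourier transform of exp (-s \<xi>^2) at x - y, up to a constant. Up to
  normalisation this is the Mehler kernel with parameter (1 - s) / (1 + s).\<close>

definition mehler :: "real \<Rightarrow> real \<Rightarrow> real \<Rightarrow> real" where
  "mehler s x y = exp (- (x - y)\<^sup>2 / (4 * s) - s * (x + y)\<^sup>2 / 4)"

lemma mehler_deriv:
  "s > 0 \<Longrightarrow> (mehler s x has_real_derivative ((1 / (2 * s) - s / 2) * x - (1 / (2 * s) + s / 2) * y) * mehler s x y) (at y)"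
  unfolding mehler_def[abs_def]
  by (auto intro!: derivative_eq_intros simp: field_simps)

lemma continuous_mehler: "s > 0 \<Longrightarrow> continuous_on A (mehler s x)"
  unfolding mehler_def[abs_def] by (intro continuous_intros) auto

lemma mehler_bounds: "s > 0 \<Longrightarrow> \<bar>mehler s x y\<bar> \<le> 1"
  unfolding mehler_def by (simp add: diff_le_0_iff_le) (smt (verit) divide_nonneg_nonneg mult_nonneg_nonneg zero_le_power2)

lemma mehler_hermite_fun:
  assumes "s > 0"
  shows "gauss_decay (\<lambda>y. mehler s x y * hermite_fun n y)" "integrable lborel (\<lambda>y. mehler s x y * hermite_fun n y)"
    "gauss_decay (\<lambda>y. y * (mehler s x y * hermite_fun n y))" "integrable lborel (\<lambda>y. y * (mehler s x y * hermite_fun n y))"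
proof -
  show 1: "gauss_decay (\<lambda>y. mehler s x y * hermite_fun n y)" for n
    by (rule gauss_decay_mult_bounded[OF gauss_decay_hermite_fun, where C = 1]) (use mehler_bounds[OF assms] in simp)
  show 2: "gauss_decay (\<lambda>y. y * (mehler s x y * hermite_fun n y))"
    using gauss_decay_mult_id[OF 1[of n]] by simp
  have [measurable]: "mehler s x \<in> borel_measurable borel"
    by (rule borel_measurable_continuous_onI[OF continuous_mehler[OF assms]])
  show "integrable lborel (\<lambda>y. mehler s x y * hermite_fun n y)" "integrable lborel (\<lambda>y. y * (mehler s x y * hermite_fun n y))"
    by (auto intro!: integrable_gauss_decay 1 2)
qed

text \<open>
  Integrating by parts in \<open>y\<close> alone gives a three-term recurrence in \<open>n\<close> that differs from the Hermite
  recurrence only by powers of \<open>u\<close>, so no derivative in \<open>x\<close> under the integral is needed.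
\<close>

lemma mehler_moments:
  fixes s x :: real
  assumes s: "s > 0"
  defines "M \<equiv> \<lambda>n. \<integral>y. mehler s x y * hermite_fun n y \<partial>lborel" and "N \<equiv> \<lambda>n. \<integral>y. y * (mehler s x y * hermite_fun n y) \<partial>lborel"
  shows "(1 / (2 * s) - s / 2) * x * M n - (1 / (2 * s) + s / 2) * N n + N n - sqrt (2 * real (Suc n)) * M (Suc n) = 0"
    and "(1 / (2 * s) - s / 2) * x * M n - (1 / (2 * s) + s / 2) * N n + sqrt (2 * real n) * M (n - 1) - N n = 0"
proof -
  define p where "p = (1 / (2 * s) - s / 2) * x"
  define q where "q = 1 / (2 * s) + s / 2"
  have d: "((\<lambda>y. mehler s x y * hermite_fun n y) has_vector_derivative
      p * (mehler s x y * hermite_fun n y) - q * (y * (mehler s x y * hermite_fun n y)) + mehler s x y * D) (at y)"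
    if "(hermite_fun n has_real_derivative D) (at y)" for y D
    unfolding has_real_derivative_iff_has_vector_derivative[symmetric]
    by (rule DERIV_cong[OF DERIV_mult[OF mehler_deriv[OF s] that]]) (simp add: p_def q_def algebra_simps)
  note intro = gauss_decay_diff gauss_decay_add gauss_decay_cmult mehler_hermite_fun[OF s]
  note cont = continuous_intros continuous_mehler[OF s]
  have "(\<integral>y. p * (mehler s x y * hermite_fun n y) - q * (y * (mehler s x y * hermite_fun n y))
      + (y * (mehler s x y * hermite_fun n y) - sqrt (2 * real (Suc n)) * (mehler s x y * hermite_fun (Suc n) y)) \<partial>lborel) = 0"
  proof (rule integral_derivative_eq_0)
    show "((\<lambda>y. mehler s x y * hermite_fun n y) has_vector_derivative (p * (mehler s x y * hermite_fun n y) - q * (y * (mehler s x y * hermite_fun n y))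
      + (y * (mehler s x y * hermite_fun n y) - sqrt (2 * real (Suc n)) * (mehler s x y * hermite_fun (Suc n) y)))) (at y)" for y
      using d[OF hermite_fun_deriv_raise[of n y]] by (simp add: algebra_simps)
  qed (intro cont intro)+
  then show "(1 / (2 * s) - s / 2) * x * M n - (1 / (2 * s) + s / 2) * N n + N n - sqrt (2 * real (Suc n)) * M (Suc n) = 0"
    using mehler_hermite_fun(2,4)[OF s, of x n] mehler_hermite_fun(2)[OF s, of x "Suc n"]
    by (simp add: M_def N_def p_def[symmetric] q_def[symmetric])
  have "(\<integral>y. p * (mehler s x y * hermite_fun n y) - q * (y * (mehler s x y * hermite_fun n y))
      + (sqrt (2 * real n) * (mehler s x y * hermite_fun (n - 1) y) - y * (mehler s x y * hermite_fun n y)) \<partial>lborel) = 0"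
  proof (rule integral_derivative_eq_0)
    show "((\<lambda>y. mehler s x y * hermite_fun n y) has_vector_derivative (p * (mehler s x y * hermite_fun n y) - q * (y * (mehler s x y * hermite_fun n y))
      + (sqrt (2 * real n) * (mehler s x y * hermite_fun (n - 1) y) - y * (mehler s x y * hermite_fun n y)))) (at y)" for y
      using d[OF hermite_fun_deriv[of n y]] by (simp add: algebra_simps)
  qed (intro cont intro)+
  then show "(1 / (2 * s) - s / 2) * x * M n - (1 / (2 * s) + s / 2) * N n + sqrt (2 * real n) * M (n - 1) - N n = 0"
    using mehler_hermite_fun(2,4)[OF s, of x n] mehler_hermite_fun(2)[OF s, of x "n - 1"]
    by (simp add: M_def N_def p_def[symmetric] q_def[symmetric])
qed

text \<open>Completing the square in y: \<open>\<alpha>\<close> and \<open>m\<close> are rate and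
  centre of the resulting Gaussian, and the remaining exponent is that of
  \<open>hermite_fun 0 x\<close>.\<close>

lemma mehler_hermite_fun_0:
  assumes s: "s > 0"
  shows "(\<integral>y. mehler s x y * hermite_fun 0 y \<partial>lborel) = 2 * sqrt (pi * s) / (1 + s) * hermite_fun 0 x"
proof -
  define \<alpha> where "\<alpha> = (1 + s)\<^sup>2 / (4 * s)"
  define m where "m = x * (1 - s) / (1 + s)"
  have \<alpha>: "\<alpha> > 0" using s by (simp add: \<alpha>_def add_pos_pos)
  have ex: "- (x - y)\<^sup>2 / (4 * s) - s * (x + y)\<^sup>2 / 4 + - y\<^sup>2 / 2 = - \<alpha> * (y - m)\<^sup>2 + - x\<^sup>2 / 2" for y
  proof -
    have r: "1 + s \<noteq> 0" using s by simp
    have "\<alpha> * (y - m)\<^sup>2 = ((1 + s) * (y - m))\<^sup>2 / (4 * s)" by (simp add: \<alpha>_def power_mult_distrib)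
    moreover have "(1 + s) * m = x * (1 - s)" using r by (simp add: m_def)
    then have m1: "(1 + s) * (y - m) = (1 + s) * y - x * (1 - s)" by (simp add: right_diff_distrib)
    ultimately have "\<alpha> * (y - m)\<^sup>2 = ((1 + s) * y - x * (1 - s))\<^sup>2 / (4 * s)"
      by (simp only: m1)
    then show ?thesis using s by (simp add: field_simps power2_eq_square)
  qed
  have "mehler s x y * hermite_fun 0 y = hermite_fun 0 x * exp (- \<alpha> * (y - m)\<^sup>2)" for y
  proof -
    have "mehler s x y * exp (- y\<^sup>2 / 2) = exp (- \<alpha> * (y - m)\<^sup>2) * exp (- x\<^sup>2 / 2)"
      unfolding mehler_def exp_add[symmetric] ex ..
    then show ?thesis by (simp add: hermite_fun.simps(1) mult.commute)
  qed
  then have "(\<integral>y. mehler s x y * hermite_fun 0 y \<partial>lborel) = hermite_fun 0 x * sqrt (pi / \<alpha>)"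
    using has_bochner_integral_gauss[OF \<alpha>, of m] by (simp add: has_bochner_integral_iff)
  moreover have "sqrt (pi / \<alpha>) = 2 * sqrt (pi * s) / (1 + s)"
  proof -
    have "pi / \<alpha> = (2 / (1 + s))\<^sup>2 * (pi * s)" using s by (simp add: \<alpha>_def power_divide field_simps)
    then show ?thesis using s by (simp add: real_sqrt_mult)
  qed
  ultimately show ?thesis by simp
qed

text \<open>The linear algebra behind the moment identities, with A and B for the neighbouring
  moments times their square roots. Subtraction gives N; after multiplication by 2 s the
  coefficients factor into 1 + s and 1 - s, which is the origin of u.\<close>

lemma mehler_recurrence_solution:
  assumes s: "s > (0::real)" and u: "u = (1 - s) / (1 + s)"
    and E1: "(1 / (2 * s) - s / 2) * x * M - (1 / (2 * s) + s / 2) * N + N - A = 0"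
    and E2: "(1 / (2 * s) - s / 2) * x * M - (1 / (2 * s) + s / 2) * N + B - N = 0"
  shows "A = 2 * u * x * M - u\<^sup>2 * B" "N = (A + B) / 2"
proof -
  have "P + N - A = 0 \<Longrightarrow> P + B - N = 0 \<Longrightarrow> N = (A + B) / 2" for P :: real
    by (simp add: field_simps)
  from this[OF E1 E2] show N: "N = (A + B) / 2" .
  have "(2 * s) * (p * x * M - q * N + N - A) = ((2 * s) * p) * x * M - ((2 * s) * q) * N + 2 * s * N - 2 * s * A" for p q
    by (simp add: algebra_simps)
  from this[of "1 / (2 * s) - s / 2" "1 / (2 * s) + s / 2"]
  have "((2 * s) * (1 / (2 * s) - s / 2)) * x * M - ((2 * s) * (1 / (2 * s) + s / 2)) * N + 2 * s * N - 2 * s * A = 0"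
    unfolding E1 by simp
  moreover have "(2 * s) * (1 / (2 * s) - s / 2) = 1 - s\<^sup>2" "(2 * s) * (1 / (2 * s) + s / 2) = 1 + s\<^sup>2"
    using s by (simp_all add: field_simps power2_eq_square)
  ultimately have "(1 - s\<^sup>2) * x * M - (1 + s\<^sup>2) * N + 2 * s * N - 2 * s * A = 0"
    by (simp only:)
  then have "(1 + s)\<^sup>2 * A = 2 * ((1 - s) * (1 + s)) * x * M - (1 - s)\<^sup>2 * B"
    unfolding N by (simp add: power2_eq_square field_simps)
  also have "1 - s = u * (1 + s)" using s by (simp add: u)
  finally have "(1 + s)\<^sup>2 * A = (1 + s)\<^sup>2 * (2 * u * x * M - u\<^sup>2 * B)"
    by (simp add: power_mult_distrib right_diff_distrib power2_eq_square mult_ac)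
  moreover have "(1 + s)\<^sup>2 \<noteq> 0" using s by simp
  ultimately show "A = 2 * u * x * M - u\<^sup>2 * B" by (metis mult_left_cancel)
qed

text \<open>The moments obey the Hermite recurrence with one factor u per index, so the Gaussian
  case determines all of them. At n = 0 the preceding moment has coefficient 0, hence the
  conditional second hypothesis of \<open>step\<close>.\<close>

lemma mehler_eigen:
  fixes s x :: real
  assumes s: "s > 0"
  defines "u \<equiv> (1 - s) / (1 + s)" and "l \<equiv> 2 * sqrt (pi * s) / (1 + s)"
  shows "(\<integral>y. mehler s x y * hermite_fun n y \<partial>lborel) = l * u ^ n * hermite_fun n x"
proof -
  define M where "M n = (\<integral>y. mehler s x y * hermite_fun n y \<partial>lborel)" for n
  have rec: "sqrt (2 * real (Suc n)) * M (Suc n) = 2 * u * x * M n - u\<^sup>2 * (sqrt (2 * real n) * M (n - 1))" for n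
    using mehler_recurrence_solution(1)[OF s refl mehler_moments[OF s, of x n]] unfolding M_def u_def .
  have M0: "M 0 = l * u ^ 0 * hermite_fun 0 x" unfolding M_def l_def using mehler_hermite_fun_0[OF s] by simp
  have step: "M (Suc n) = l * u ^ Suc n * hermite_fun (Suc n) x"
    if "M n = l * u ^ n * hermite_fun n x" "n > 0 \<Longrightarrow> M (n - 1) = l * u ^ (n - 1) * hermite_fun (n - 1) x" for n
  proof -
    have b: "u\<^sup>2 * (sqrt (2 * real n) * M (n - 1)) = l * u ^ Suc n * (sqrt (2 * real n) * hermite_fun (n - 1) x)"
      using that(2) by (cases n) (simp_all add: power2_eq_square)
    have "sqrt (2 * real (Suc n)) * M (Suc n) = l * u ^ Suc n * (sqrt (2 * real (Suc n)) * hermite_fun (Suc n) x)"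
      unfolding rec b that(1) hermite_fun_recurrence by (simp add: algebra_simps)
    moreover have "sqrt (2 * real (Suc n)) \<noteq> 0" by simp
    ultimately show ?thesis by (metis mult.left_commute mult_left_cancel)
  qed
  have "M n = l * u ^ n * hermite_fun n x \<and> M (Suc n) = l * u ^ Suc n * hermite_fun (Suc n) x"
  proof (induction n)
    case 0
    then show ?case using M0 step[of 0] by simp
  next
    case (Suc n)
    then show ?case using step[of "Suc n"] by simp
  qed
  then show ?thesis by (simp add: M_def)
qed

lemma mehler_first_moment:
  assumes s: "s > 0"
  shows "(\<integral>y. y * (mehler s x y * hermite_fun n y) \<partial>lborel) =
    (sqrt (2 * real (Suc n)) * (\<integral>y. mehler s x y * hermite_fun (Suc n) y \<partial>lborel) + sqrt (2 * real n) * (\<integral>y. mehler s x y * hermite_fun (n - 1) y \<partial>lborel)) / 2"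
  by (rule mehler_recurrence_solution(2)[OF s refl mehler_moments[OF s]])

section \<open>Fourier integrals of Gaussians\<close>

lemma gauss_fourier:
  assumes s: "s > 0"
  shows "(\<integral>\<xi>. cis (v * \<xi>) * of_real (exp (- s * \<xi>\<^sup>2)) \<partial>lborel) = of_real (sqrt (pi / s) * exp (- v\<^sup>2 / (4 * s)))"
proof -
  \<comment> \<open>The scale that carries the standard normal density to a multiple of exp (-s
    \<xi>^2), so that its characteristic function can be used.\<close>
  define c where "c = sqrt (2 * s)"
  have c: "c > 0" "c\<^sup>2 = 2 * s" using s by (auto simp: c_def)
  have "of_real (exp (- ((v / c)\<^sup>2) / 2)) = char std_normal_distribution (v / c)"
    by (simp add: char_std_normal_distribution)
  also have "\<dots> = (\<integral>x. std_normal_density x *\<^sub>R iexp (v / c * x) \<partial>lborel)"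
    unfolding char_def by (subst integral_density) auto
  also have "\<dots> = \<bar>c\<bar> *\<^sub>R (\<integral>\<xi>. std_normal_density (0 + c * \<xi>) *\<^sub>R iexp (v / c * (0 + c * \<xi>)) \<partial>lborel)"
    using c by (intro lborel_integral_real_affine) auto
  also have "\<dots> = of_real c * (\<integral>\<xi>. of_real (1 / sqrt (2 * pi)) * (cis (v * \<xi>) * of_real (exp (- s * \<xi>\<^sup>2))) \<partial>lborel)"
  proof -
    have "std_normal_density (0 + c * \<xi>) *\<^sub>R iexp (v / c * (0 + c * \<xi>)) = of_real (1 / sqrt (2 * pi)) * (cis (v * \<xi>) * of_real (exp (- s * \<xi>\<^sup>2)))" for \<xi>
      using c by (simp add: std_normal_density_def power_mult_distrib scaleR_conv_of_real cis_conv_exp mult_ac)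
    then show ?thesis using c by (simp add: scaleR_conv_of_real)
  qed
  also have "\<dots> = of_real (c / sqrt (2 * pi)) * (\<integral>\<xi>. cis (v * \<xi>) * of_real (exp (- s * \<xi>\<^sup>2)) \<partial>lborel)"
    by simp
  finally have "(\<integral>\<xi>. cis (v * \<xi>) * of_real (exp (- s * \<xi>\<^sup>2)) \<partial>lborel) = of_real (sqrt (2 * pi) / c) * of_real (exp (- ((v / c)\<^sup>2) / 2))"
    using c by (simp add: field_simps)
  also have "sqrt (2 * pi) / c = sqrt (pi / s)" unfolding c_def using s by (simp add: real_sqrt_divide[symmetric])
  also have "- ((v / c)\<^sup>2) / 2 = - v\<^sup>2 / (4 * s)" by (simp add: power_divide c)
  finally show ?thesis by simp
qed

lemma gauss_decay_exp_square: "s > 0 \<Longrightarrow> gauss_decay (\<lambda>\<xi>. cis (v * \<xi>) * of_real (exp (- s * \<xi>\<^sup>2)))"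
  by (rule gauss_decayI[of s _ 1]) (simp_all add: norm_mult)

text \<open>The derivative of the Gaussian wave combines its first moment with the zeroth, which is
  known; the integral of the derivative vanishes.\<close>

lemma gauss_fourier_moment:
  assumes s: "s > 0"
  shows "(\<integral>\<xi>. of_real \<xi> * (cis (v * \<xi>) * of_real (exp (- s * \<xi>\<^sup>2))) \<partial>lborel)
      = \<i> * of_real (v / (2 * s) * (sqrt (pi / s) * exp (- v\<^sup>2 / (4 * s))))"
    and "integrable lborel (\<lambda>\<xi>. cis (v * \<xi>) * of_real (exp (- s * \<xi>\<^sup>2)))"
    and "integrable lborel (\<lambda>\<xi>. of_real \<xi> * (cis (v * \<xi>) * of_real (exp (- s * \<xi>\<^sup>2))))"
proof -
  let ?E = "\<lambda>\<xi>. cis (v * \<xi>) * of_real (exp (- s * \<xi>\<^sup>2))"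
  note dec = gauss_decay_exp_square[OF s, of v]
  show int: "integrable lborel ?E" "integrable lborel (\<lambda>\<xi>. of_real \<xi> * ?E \<xi>)"
    by (intro integrable_gauss_decay dec gauss_decay_mult_id; measurable)+
  let ?F = "\<lambda>\<xi>. \<i> * of_real v * ?E \<xi> - of_real (2 * s) * (of_real \<xi> * ?E \<xi>)"
  have "(\<integral>\<xi>. ?F \<xi> \<partial>lborel) = 0"
  proof (rule integral_derivative_eq_0)
    show "(?E has_vector_derivative ?F \<xi>) (at \<xi>)" for \<xi>
    proof -
      have "((\<lambda>\<xi>. exp (- s * \<xi>\<^sup>2)) has_real_derivative - (2 * s * \<xi>) * exp (- s * \<xi>\<^sup>2)) (at \<xi>)"
        by (auto intro!: derivative_eq_intros)
      from has_vector_derivative_mult[OF cis_deriv[of v \<xi>] has_vector_derivative_of_real[OF this]]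
      show ?thesis by (simp add: algebra_simps)
    qed
    show "continuous_on UNIV ?F" by (intro continuous_intros continuous_on_cis')
    show "gauss_decay ?F" by (intro gauss_decay_diff gauss_decay_cmult gauss_decay_mult_id dec)
  qed (rule dec)
  then have "of_real (2 * s) * (\<integral>\<xi>. of_real \<xi> * ?E \<xi> \<partial>lborel) = \<i> * of_real v * (\<integral>\<xi>. ?E \<xi> \<partial>lborel)"
    using int by simp
  then show "(\<integral>\<xi>. of_real \<xi> * ?E \<xi> \<partial>lborel) = \<i> * of_real (v / (2 * s) * (sqrt (pi / s) * exp (- v\<^sup>2 / (4 * s))))"
    unfolding gauss_fourier[OF s] using s by (simp add: field_simps)
qed

section \<open>Weyl quantization of the symbol on Hermite functions\<close>

definition cutoff :: "real \<Rightarrow> real" where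
  "cutoff \<sigma> = indicator {0..1} \<sigma> * (1 - \<sigma>\<^sup>2)"

lemma cutoff_measurable[measurable]: "cutoff \<in> borel_measurable borel"
  unfolding cutoff_def[abs_def] by measurable

lemma cutoff_abs: "\<bar>cutoff \<sigma>\<bar> \<le> indicator {0..1} \<sigma>"
  by (auto simp: cutoff_def power_le_one split: split_indicator)

lemma integrable_indicator_unit: "integrable lborel (\<lambda>\<sigma>::real. indicator {0..1} \<sigma> :: real)"
  by simp

lemma integral_indicator_continuous:
  fixes f :: "real \<Rightarrow> real"
  assumes "continuous_on {0..1} f"
  shows "integrable lborel (\<lambda>\<sigma>. indicator {0..1} \<sigma> * f \<sigma>)"
    "(\<integral>\<sigma>. indicator {0..1} \<sigma> * f \<sigma> \<partial>lborel) = integral {0..1} f"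
proof -
  have s: "set_integrable lborel {0..1} f" by (rule borel_integrable_atLeastAtMost'[OF assms])
  then show "integrable lborel (\<lambda>\<sigma>. indicator {0..1} \<sigma> * f \<sigma>)" by (simp add: set_integrable_def)
  show "(\<integral>\<sigma>. indicator {0..1} \<sigma> * f \<sigma> \<partial>lborel) = integral {0..1} f"
    using set_borel_integral_eq_integral(2)[OF s] by (simp add: set_lebesgue_integral_def)
qed

lemma profile_0_cutoff: "profile 0 \<rho> = (\<integral>\<sigma>. cutoff \<sigma> * exp (- \<sigma>\<^sup>2 * \<rho>) \<partial>lborel)"
proof -
  have "(\<integral>\<sigma>. indicator {0..1} \<sigma> * ((1 - \<sigma>\<^sup>2) * exp (- \<sigma>\<^sup>2 * \<rho>)) \<partial>lborel) = integral {0..1} (\<lambda>\<sigma>. (1 - \<sigma>\<^sup>2) * exp (- \<sigma>\<^sup>2 * \<rho>))"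
    by (intro integral_indicator_continuous continuous_intros)
  then show ?thesis by (simp add: profile_def cutoff_def mult.assoc)
qed

context
  fixes n :: nat and a b x :: real
begin

definition weyl_integrand :: "real \<Rightarrow> real \<Rightarrow> complex" where
  "weyl_integrand \<xi> y = cis ((x - y) * \<xi>) * of_real (rot_symbol a b ((x + y) / 2) \<xi>) * hermite_c n y"

text \<open>The Weyl integrand before the integration over \<sigma> that defines the profile. In
  general it is not absolutely integrable in all three variables, so the orders of integration are
  exchanged in pairs.\<close>

definition triple :: "real \<Rightarrow> real \<Rightarrow> real \<Rightarrow> complex" where
  "triple \<sigma> \<xi> y = cis ((x - y) * \<xi>) *
     of_real (cutoff \<sigma> * exp (- \<sigma>\<^sup>2 * \<xi>\<^sup>2) * ((a * ((x + y) / 2) + b * \<xi>) * (exp (- \<sigma>\<^sup>2 * (x + y)\<^sup>2 / 4) * hermite_fun n y)))"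

lemma triple_bound: "cmod (triple \<sigma> \<xi> y) \<le> indicator {0..1} \<sigma> * \<bar>(a * ((x + y) / 2) + b * \<xi>) * hermite_fun n y\<bar>"
proof -
  have "cmod (triple \<sigma> \<xi> y) = (\<bar>cutoff \<sigma>\<bar> * exp (- \<sigma>\<^sup>2 * \<xi>\<^sup>2) * exp (- \<sigma>\<^sup>2 * (x + y)\<^sup>2 / 4)) * \<bar>(a * ((x + y) / 2) + b * \<xi>) * hermite_fun n y\<bar>"
    by (simp add: triple_def norm_mult abs_mult mult_ac del: of_real_mult of_real_add)
  also have "\<dots> \<le> (indicator {0..1} \<sigma> * 1 * 1) * \<bar>(a * ((x + y) / 2) + b * \<xi>) * hermite_fun n y\<bar>"
    by (intro mult_right_mono mult_mono cutoff_abs) auto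
  finally show ?thesis by simp
qed

lemma integrable_linear_hermite_fun: "integrable lborel (\<lambda>y. \<bar>(a * ((x + y) / 2) + c) * hermite_fun n y\<bar>)"
proof -
  have eq: "(a * ((x + y) / 2) + c) * hermite_fun n y = (a * x / 2 + c) * hermite_fun n y + (a / 2) * (y * hermite_fun n y)" for y
    by (simp add: algebra_simps)
  have "gauss_decay (\<lambda>y. (a * ((x + y) / 2) + c) * hermite_fun n y)"
    unfolding eq by (intro gauss_decay_add gauss_decay_cmult gauss_decay_hermite_fun gauss_decay_id_hermite_fun)
  then show ?thesis by (intro integrable_abs integrable_gauss_decay) auto
qed

text \<open>At fixed \<xi> the variables \<sigma> and y may be exchanged. The exchange of \<sigma>
  and \<xi> waits until the y-integral has produced decay in \<xi>, in
  \<open>integrable_layer\<close>.\<close>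

lemma integrable_triple_sigma_y: "integrable (lborel \<Otimes>\<^sub>M lborel) (\<lambda>(\<sigma>, y). triple \<sigma> \<xi> y)"
  by (rule integrable_pair_bound[OF _ triple_bound integrable_indicator_unit integrable_linear_hermite_fun])
    (unfold triple_def, measurable)

lemma weyl_integrand_eq: "weyl_integrand \<xi> y = (\<integral>\<sigma>. triple \<sigma> \<xi> y \<partial>lborel)"
proof -
  have "triple \<sigma> \<xi> y = (cis ((x - y) * \<xi>) * of_real ((a * ((x + y) / 2) + b * \<xi>) * hermite_fun n y))
      * of_real (cutoff \<sigma> * exp (- \<sigma>\<^sup>2 * (((x + y) / 2)\<^sup>2 + \<xi>\<^sup>2)))" for \<sigma>
  proof -
    have "exp (- \<sigma>\<^sup>2 * (((x + y) / 2)\<^sup>2 + \<xi>\<^sup>2)) = exp (- \<sigma>\<^sup>2 * \<xi>\<^sup>2) * exp (- \<sigma>\<^sup>2 * (x + y)\<^sup>2 / 4)"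
      unfolding exp_add[symmetric] by (rule arg_cong[of _ _ exp]) (simp add: power_divide algebra_simps)
    then show ?thesis unfolding triple_def by (simp add: mult_ac)
  qed
  then have "(\<integral>\<sigma>. triple \<sigma> \<xi> y \<partial>lborel) = (cis ((x - y) * \<xi>) * of_real ((a * ((x + y) / 2) + b * \<xi>) * hermite_fun n y)) * of_real (profile 0 (((x + y) / 2)\<^sup>2 + \<xi>\<^sup>2))"
    unfolding profile_0_cutoff by (simp only: integral_mult_right_zero integral_complex_of_real)
  then show ?thesis by (simp add: weyl_integrand_def rot_symbol_def hermite_c_def mult_ac)
qed

lemma integrable_weyl_integrand: "integrable lborel (weyl_integrand \<xi>)"
  using lborel_pair.integrable_snd[OF integrable_triple_sigma_y[of \<xi>]]
  unfolding weyl_integrand_eq[abs_def] by simp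

lemma triple_inner: "(\<integral>y. triple \<sigma> \<xi> y \<partial>lborel) = of_real (cutoff \<sigma> * exp (- \<sigma>\<^sup>2 * \<xi>\<^sup>2)) * inner_int n a b x (\<sigma>\<^sup>2) \<xi>"
proof -
  have "triple \<sigma> \<xi> y = of_real (cutoff \<sigma> * exp (- \<sigma>\<^sup>2 * \<xi>\<^sup>2)) *
    (cis ((x - y) * \<xi>) * of_real ((a * ((x + y) / 2) + b * \<xi>) * (exp (- \<sigma>\<^sup>2 * (x + y)\<^sup>2 / 4) * hermite_fun n y)))" for y
    unfolding triple_def of_real_mult[of "cutoff \<sigma> * exp (- \<sigma>\<^sup>2 * \<xi>\<^sup>2)"] by (rule mult.left_commute)
  then show ?thesis unfolding inner_int_def by (simp only: integral_mult_right_zero)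
qed

definition layer :: "real \<Rightarrow> real \<Rightarrow> complex" where
  "layer \<sigma> \<xi> = of_real (cutoff \<sigma> * exp (- \<sigma>\<^sup>2 * \<xi>\<^sup>2)) * inner_int n a b x (\<sigma>\<^sup>2) \<xi>"

lemma integral_weyl_integrand: "(\<integral>y. weyl_integrand \<xi> y \<partial>lborel) = (\<integral>\<sigma>. layer \<sigma> \<xi> \<partial>lborel)"
  unfolding weyl_integrand_eq layer_def triple_inner[symmetric]
  by (rule lborel_pair.Fubini_integral[OF integrable_triple_sigma_y])

lemma integrable_layer: "integrable (lborel \<Otimes>\<^sub>M lborel) (\<lambda>(\<sigma>, \<xi>). layer \<sigma> \<xi>)"
proof -
  obtain C where C: "C \<ge> 0" "\<And>s \<xi>. s \<in> {0..1} \<Longrightarrow> cmod (inner_int n a b x s \<xi>) \<le> C * inverse (1 + \<xi>\<^sup>2)"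
    using inner_int_decay by blast
  show ?thesis
  proof (rule integrable_pair_bound)
    show "(\<lambda>(\<sigma>, \<xi>). layer \<sigma> \<xi>) \<in> borel_measurable (lborel \<Otimes>\<^sub>M lborel)"
      unfolding layer_def inner_int_def by measurable
    show "cmod (layer \<sigma> \<xi>) \<le> indicator {0..1} \<sigma> * (C * inverse (1 + \<xi>\<^sup>2))" for \<sigma> \<xi>
    proof (cases "\<sigma> \<in> {0..1}")
      case True
      then have s: "\<sigma>\<^sup>2 \<in> {0..1}" by (simp add: power_le_one)
      have "cmod (layer \<sigma> \<xi>) = (\<bar>cutoff \<sigma>\<bar> * exp (- \<sigma>\<^sup>2 * \<xi>\<^sup>2)) * cmod (inner_int n a b x (\<sigma>\<^sup>2) \<xi>)"
        by (simp add: layer_def norm_mult abs_mult)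
      also have "\<dots> \<le> (indicator {0..1} \<sigma> * 1) * (C * inverse (1 + \<xi>\<^sup>2))"
        using C(1) by (intro mult_mono cutoff_abs C(2)[OF s]) (auto intro!: mult_nonneg_nonneg)
      finally show ?thesis by simp
    qed (simp add: layer_def cutoff_def)
    show "integrable lborel (\<lambda>\<xi>::real. C * inverse (1 + \<xi>\<^sup>2))"
      using integrable_inverse_1_plus_square by (simp add: set_integrable_def)
  qed simp
qed

lemma integrable_weyl_outer: "integrable lborel (\<lambda>\<xi>. \<integral>y. weyl_integrand \<xi> y \<partial>lborel)"
  unfolding integral_weyl_integrand using lborel_pair.integrable_snd[OF integrable_layer] by simp

lemma weyl_outer_swap:
  "(\<integral>\<xi>. (\<integral>y. weyl_integrand \<xi> y \<partial>lborel) \<partial>lborel) = (\<integral>\<sigma>. (\<integral>\<xi>. layer \<sigma> \<xi> \<partial>lborel) \<partial>lborel)"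
  unfolding integral_weyl_integrand by (rule lborel_pair.Fubini_integral[OF integrable_layer])

text \<open>For s > 0 the Gaussian in \<xi> makes the integrand jointly integrable in \<xi> and y.
  After the exchange the \<xi>-integral is explicit, and a factor \<xi> becomes \<i> (x - y) / (2
  s).\<close>

lemma inner_int_transform:
  assumes s: "s > 0"
  shows "(\<integral>\<xi>. of_real (exp (- s * \<xi>\<^sup>2)) * inner_int n a b x s \<xi> \<partial>lborel) =
    of_real (sqrt (pi / s)) * (\<integral>y. of_real (mehler s x y * hermite_fun n y) * (of_real (a * (x + y) / 2) + \<i> * of_real (b * (x - y) / (2 * s))) \<partial>lborel)"
proof -
  define G where "G \<xi> y = cis ((x - y) * \<xi>) * of_real (exp (- s * \<xi>\<^sup>2)) *
     of_real ((a * ((x + y) / 2) + b * \<xi>) * (exp (- s * (x + y)\<^sup>2 / 4) * hermite_fun n y))" for \<xi> y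
  have G_int: "integrable (lborel \<Otimes>\<^sub>M lborel) (\<lambda>(\<xi>, y). G \<xi> y)"
  proof (rule integrable_pair_bound)
    show "(\<lambda>(\<xi>, y). G \<xi> y) \<in> borel_measurable (lborel \<Otimes>\<^sub>M lborel)"
      unfolding G_def by measurable
    show "integrable lborel (\<lambda>\<xi>. (1 + \<bar>\<xi>\<bar>) * exp (- s * \<xi>\<^sup>2))"
    proof -
      have g: "gauss_decay (\<lambda>\<xi>. exp (- s * \<xi>\<^sup>2))" by (rule gauss_decayI[OF s, of _ 1]) simp
      have "gauss_decay (\<lambda>\<xi>. (1 + \<bar>\<xi>\<bar>) * exp (- s * \<xi>\<^sup>2))"
        by (rule gauss_decay_mult_exp[OF g, of _ 1 1]) (use exp_ge_add_one_self in simp)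
      then show ?thesis by (rule integrable_gauss_decay) measurable
    qed
    show "integrable lborel (\<lambda>y. \<bar>(\<bar>a\<bar> * \<bar>x + y\<bar> / 2 + \<bar>b\<bar>) * hermite_fun n y\<bar>)"
    proof -
      have "gauss_decay (\<lambda>y. (\<bar>a\<bar> * \<bar>x + y\<bar> / 2 + \<bar>b\<bar>) * hermite_fun n y)"
      proof (rule gauss_decay_mult_exp[OF gauss_decay_hermite_fun, of _ "\<bar>a\<bar> * (\<bar>x\<bar> + 1) + \<bar>b\<bar>" 1])
        fix y :: real
        have e: "1 \<le> exp \<bar>y\<bar>" "\<bar>y\<bar> \<le> exp \<bar>y\<bar>" using exp_ge_add_one_self[of "\<bar>y\<bar>"] by linarith+
        have "p / 2 \<le> q * 1 + r" if "p \<le> q + r" "0 \<le> p" for p q r :: real using that by simp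
        from this[OF abs_triangle_ineq abs_ge_zero] have "\<bar>x + y\<bar> / 2 \<le> \<bar>x\<bar> * 1 + \<bar>y\<bar>" .
        also have "\<dots> \<le> \<bar>x\<bar> * exp \<bar>y\<bar> + exp \<bar>y\<bar>" using e by (intro add_mono mult_left_mono) auto
        finally have "\<bar>a\<bar> * (\<bar>x + y\<bar> / 2) + \<bar>b\<bar> * 1 \<le> \<bar>a\<bar> * (\<bar>x\<bar> * exp \<bar>y\<bar> + exp \<bar>y\<bar>) + \<bar>b\<bar> * exp \<bar>y\<bar>"
          using e by (intro add_mono mult_left_mono) auto
        then show "norm (\<bar>a\<bar> * \<bar>x + y\<bar> / 2 + \<bar>b\<bar>) \<le> (\<bar>a\<bar> * (\<bar>x\<bar> + 1) + \<bar>b\<bar>) * exp (1 * \<bar>y\<bar>)"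
          by (simp add: algebra_simps)
      qed
      then show ?thesis by (intro integrable_abs integrable_gauss_decay) auto
    qed
    show "cmod (G \<xi> y) \<le> ((1 + \<bar>\<xi>\<bar>) * exp (- s * \<xi>\<^sup>2)) * \<bar>(\<bar>a\<bar> * \<bar>x + y\<bar> / 2 + \<bar>b\<bar>) * hermite_fun n y\<bar>" for \<xi> y
    proof -
      have "\<bar>a * ((x + y) / 2) + b * \<xi>\<bar> \<le> \<bar>a\<bar> * \<bar>x + y\<bar> / 2 + \<bar>b\<bar> * \<bar>\<xi>\<bar>"
        by (rule order_trans[OF abs_triangle_ineq]) (simp add: abs_mult)
      also have "p + q * z \<le> (1 + z) * (p + q)" if "0 \<le> p" "0 \<le> q" "0 \<le> z" for p q z :: real
        using that by (simp add: algebra_simps)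
      then have "\<bar>a\<bar> * \<bar>x + y\<bar> / 2 + \<bar>b\<bar> * \<bar>\<xi>\<bar> \<le> (1 + \<bar>\<xi>\<bar>) * (\<bar>a\<bar> * \<bar>x + y\<bar> / 2 + \<bar>b\<bar>)" by simp
      finally have L: "\<bar>a * ((x + y) / 2) + b * \<xi>\<bar> \<le> (1 + \<bar>\<xi>\<bar>) * (\<bar>a\<bar> * \<bar>x + y\<bar> / 2 + \<bar>b\<bar>)" .
      have "cmod (G \<xi> y) = exp (- s * \<xi>\<^sup>2) * (\<bar>a * ((x + y) / 2) + b * \<xi>\<bar> * (exp (- s * (x + y)\<^sup>2 / 4) * \<bar>hermite_fun n y\<bar>))"
        unfolding G_def norm_mult norm_cis norm_of_real abs_mult abs_exp_cancel mult_1 ..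
      also have "\<dots> \<le> exp (- s * \<xi>\<^sup>2) * (((1 + \<bar>\<xi>\<bar>) * (\<bar>a\<bar> * \<bar>x + y\<bar> / 2 + \<bar>b\<bar>)) * (1 * \<bar>hermite_fun n y\<bar>))"
        using s by (intro mult_left_mono mult_mono L mult_right_mono) auto
      also have "\<dots> = ((1 + \<bar>\<xi>\<bar>) * exp (- s * \<xi>\<^sup>2)) * \<bar>(\<bar>a\<bar> * \<bar>x + y\<bar> / 2 + \<bar>b\<bar>) * hermite_fun n y\<bar>"
        by (simp add: abs_mult mult_ac)
      finally show ?thesis .
    qed
  qed
  have "(\<integral>\<xi>. of_real (exp (- s * \<xi>\<^sup>2)) * inner_int n a b x s \<xi> \<partial>lborel) = (\<integral>\<xi>. (\<integral>y. G \<xi> y \<partial>lborel) \<partial>lborel)"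
    unfolding inner_int_def G_def
    by (simp only: integral_mult_right_zero[symmetric] mult_ac)
  also have "\<dots> = (\<integral>y. (\<integral>\<xi>. G \<xi> y \<partial>lborel) \<partial>lborel)"
    by (rule lborel_pair.Fubini_integral[OF G_int, symmetric])
  also have "\<dots> = (\<integral>y. of_real (sqrt (pi / s)) * (of_real (mehler s x y * hermite_fun n y) * (of_real (a * (x + y) / 2) + \<i> * of_real (b * (x - y) / (2 * s)))) \<partial>lborel)"
  proof (rule Bochner_Integration.integral_cong[OF refl])
    fix y
    define v where "v = x - y"
    define k where "k = exp (- s * (x + y)\<^sup>2 / 4) * hermite_fun n y"
    define E where "E \<xi> = cis (v * \<xi>) * complex_of_real (exp (- s * \<xi>\<^sup>2))" for \<xi>
    have "G \<xi> y = of_real (k * (a * ((x + y) / 2))) * E \<xi> + of_real (k * b) * (of_real \<xi> * E \<xi>)" for \<xi>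
      unfolding G_def E_def k_def v_def by (simp add: algebra_simps)
    then have "(\<integral>\<xi>. G \<xi> y \<partial>lborel) = of_real (k * (a * ((x + y) / 2))) * (\<integral>\<xi>. E \<xi> \<partial>lborel) + of_real (k * b) * (\<integral>\<xi>. of_real \<xi> * E \<xi> \<partial>lborel)"
      unfolding E_def using gauss_fourier_moment(2,3)[OF s, of v] by simp
    also have "\<dots> = of_real (sqrt (pi / s)) * (of_real (exp (- v\<^sup>2 / (4 * s)) * k) * (of_real (a * (x + y) / 2) + \<i> * of_real (b * v / (2 * s))))"
      unfolding E_def gauss_fourier[OF s] gauss_fourier_moment(1)[OF s] by (simp add: algebra_simps)
    also have "exp (- v\<^sup>2 / (4 * s)) * k = mehler s x y * hermite_fun n y"
    proof -
      have "mehler s x y = exp (- v\<^sup>2 / (4 * s)) * exp (- s * (x + y)\<^sup>2 / 4)"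
        unfolding mehler_def exp_add[symmetric] v_def by (rule arg_cong[of _ _ exp]) simp
      then show ?thesis by (simp add: k_def)
    qed
    finally show "(\<integral>\<xi>. G \<xi> y \<partial>lborel) = of_real (sqrt (pi / s)) * (of_real (mehler s x y * hermite_fun n y) * (of_real (a * (x + y) / 2) + \<i> * of_real (b * (x - y) / (2 * s))))"
      by (simp add: v_def)
  qed
  also have "\<dots> = of_real (sqrt (pi / s)) * (\<integral>y. of_real (mehler s x y * hermite_fun n y) * (of_real (a * (x + y) / 2) + \<i> * of_real (b * (x - y) / (2 * s))) \<partial>lborel)"
    by (rule integral_mult_right_zero)
  finally show ?thesis .
qed

lemma mehler_linear_integral:
  assumes s: "s > 0"
  defines "M \<equiv> \<integral>y. mehler s x y * hermite_fun n y \<partial>lborel" and "N \<equiv> \<integral>y. y * (mehler s x y * hermite_fun n y) \<partial>lborel"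
  shows "(\<integral>y. of_real (mehler s x y * hermite_fun n y) * (of_real (a * (x + y) / 2) + \<i> * of_real (b * (x - y) / (2 * s))) \<partial>lborel)
    = of_real (a / 2 * (x * M + N)) + \<i> * of_real (b / (2 * s) * (x * M - N))"
proof -
  let ?p = "\<lambda>y. mehler s x y * hermite_fun n y"
  have eq: "of_real (?p y) * (of_real (a * (x + y) / 2) + \<i> * of_real (b * (x - y) / (2 * s)))
    = of_real (a / 2 * (x * ?p y + y * ?p y)) + \<i> * of_real (b / (2 * s) * (x * ?p y - y * ?p y))" for y
    by (simp add: algebra_simps add_divide_distrib diff_divide_distrib)
  have I: "integrable lborel (\<lambda>y. a / 2 * (x * ?p y + y * ?p y))" "integrable lborel (\<lambda>y. b / (2 * s) * (x * ?p y - y * ?p y))"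
    using mehler_hermite_fun(2,4)[OF s] by auto
  have "(\<integral>y. of_real (a / 2 * (x * ?p y + y * ?p y)) + \<i> * of_real (b / (2 * s) * (x * ?p y - y * ?p y)) \<partial>lborel)
    = (\<integral>y. complex_of_real (a / 2 * (x * ?p y + y * ?p y)) \<partial>lborel) + (\<integral>y. \<i> * complex_of_real (b / (2 * s) * (x * ?p y - y * ?p y)) \<partial>lborel)"
    by (intro Bochner_Integration.integral_add integrable_mult_right integrable_of_real I)
  also have "\<dots> = of_real (\<integral>y. a / 2 * (x * ?p y + y * ?p y) \<partial>lborel) + \<i> * of_real (\<integral>y. b / (2 * s) * (x * ?p y - y * ?p y) \<partial>lborel)"
    by (simp only: integral_mult_right_zero integral_complex_of_real)
  also have "(\<integral>y. a / 2 * (x * ?p y + y * ?p y) \<partial>lborel) = a / 2 * (x * M + N)"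
    using mehler_hermite_fun(2,4)[OF s, of x n] by (simp add: M_def N_def)
  also have "(\<integral>y. b / (2 * s) * (x * ?p y - y * ?p y) \<partial>lborel) = b / (2 * s) * (x * M - N)"
    using mehler_hermite_fun(2,4)[OF s, of x n] by (simp add: M_def N_def)
  finally show ?thesis unfolding eq .
qed

text \<open>These two combinations come with a and b respectively. They split into raised and
  lowered Hermite functions since 1 + u = 2 / (1 + s) and 1 - u = 2 s / (1 + s); the extra s in the
  second cancels the denominator 2 s of the Fourier moment.\<close>

lemma moments_closed_form:
  assumes s: "s > 0"
  defines "u \<equiv> (1 - s) / (1 + s)" and "l \<equiv> 2 * sqrt (pi * s) / (1 + s)"
    and "A \<equiv> sqrt (2 * real (Suc n)) * hermite_fun (Suc n) x" and "B \<equiv> sqrt (2 * real n) * hermite_fun (n - 1) x"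
    and "M \<equiv> \<integral>y. mehler s x y * hermite_fun n y \<partial>lborel" and "N \<equiv> \<integral>y. y * (mehler s x y * hermite_fun n y) \<partial>lborel"
  shows "x * M + N = l / (1 + s) * (u ^ n * A + u ^ (n - 1) * B)"
    and "x * M - N = l * s / (1 + s) * (u ^ n * A - u ^ (n - 1) * B)"
proof -
  have r: "1 + s \<noteq> 0" using s by simp
  \<comment> \<open>At n = 0 both sides vanish with B, so the truncated exponent does no
    harm.\<close>
  have uB: "u ^ n * B = u * (u ^ (n - 1) * B)" unfolding B_def by (cases n) auto
  have x: "2 * (x * hermite_fun n x) = A + B" unfolding A_def B_def hermite_fun_recurrence by simp
  have M: "M = l * u ^ n * hermite_fun n x" unfolding M_def u_def l_def by (rule mehler_eigen[OF s])
  have "2 * N = l * (u * (u ^ n * A) + u ^ (n - 1) * B)"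
    unfolding N_def mehler_first_moment[OF s] mehler_eigen[OF s] u_def[symmetric] l_def[symmetric] A_def B_def
    by (simp add: algebra_simps)
  moreover have "2 * (x * M) = l * (u ^ n * A + u * (u ^ (n - 1) * B))"
  proof -
    have "2 * (x * M) = l * (u ^ n * (2 * (x * hermite_fun n x)))" unfolding M by (simp add: mult_ac)
    then show ?thesis unfolding x distrib_left[of "u ^ n"] uB .
  qed
  moreover have "1 + u = 2 / (1 + s)" "1 - u = 2 * s / (1 + s)" using r by (simp_all add: u_def field_simps)
  moreover have "l * (p + u * q) + l * (u * p + q) = l * (1 + u) * (p + q)"
    "l * (p + u * q) - l * (u * p + q) = l * (1 - u) * (p - q)" for p q by (simp_all add: algebra_simps)
  ultimately have "2 * (x * M) + 2 * N = l * (2 / (1 + s)) * (u ^ n * A + u ^ (n - 1) * B)"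
    "2 * (x * M) - 2 * N = l * (2 * s / (1 + s)) * (u ^ n * A - u ^ (n - 1) * B)" by metis+
  moreover have "2 * p + 2 * q = l * (2 / (1 + s)) * y \<Longrightarrow> p + q = l / (1 + s) * y"
    "2 * p - 2 * q = l * (2 * s / (1 + s)) * y \<Longrightarrow> p - q = l * s / (1 + s) * y" for p q y
    using r by (simp_all add: field_simps)
  ultimately show "x * M + N = l / (1 + s) * (u ^ n * A + u ^ (n - 1) * B)"
    "x * M - N = l * s / (1 + s) * (u ^ n * A - u ^ (n - 1) * B)" by blast+
qed

definition upper_val :: complex where
  "upper_val = Complex a b * of_real (sqrt (2 * real (Suc n)) * hermite_fun (Suc n) x)"

definition lower_val :: complex where
  "lower_val = Complex a (- b) * of_real (sqrt (2 * real n) * hermite_fun (n - 1) x)"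

lemma inner_int_value:
  assumes s: "s > 0"
  defines "u \<equiv> (1 - s) / (1 + s)"
  shows "(\<integral>\<xi>. of_real (exp (- s * \<xi>\<^sup>2)) * inner_int n a b x s \<xi> \<partial>lborel) =
    of_real (pi / (1 + s)\<^sup>2) * (of_real (u ^ n) * upper_val + of_real (u ^ (n - 1)) * lower_val)"
proof -
  define A where "A = sqrt (2 * real (Suc n)) * hermite_fun (Suc n) x"
  define B where "B = sqrt (2 * real n) * hermite_fun (n - 1) x"
  define l where "l = 2 * sqrt (pi * s) / (1 + s)"
  \<comment> \<open>The square roots of s from the \<xi>-integral and from the Mehler eigenvalue
    cancel.\<close>
  have l: "sqrt (pi / s) * l = 2 * pi / (1 + s)"
  proof -
    have "sqrt (pi / s) * sqrt (pi * s) = pi" using s by (simp add: real_sqrt_mult[symmetric])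
    then have "sqrt (pi / s) * (2 * sqrt (pi * s)) = 2 * pi" by simp
    then show ?thesis unfolding l_def times_divide_eq_right by simp
  qed
  have gen: "2 * pi / r * (c / 2 / r * y) = pi / r\<^sup>2 * (c * y)" for c y r :: real
    by (simp add: power2_eq_square)
  have 1: "sqrt (pi / s) * (a / 2 * (l / (1 + s) * (u ^ n * A + u ^ (n - 1) * B)))
      = pi / (1 + s)\<^sup>2 * (a * (u ^ n * A + u ^ (n - 1) * B))"
  proof -
    have "sqrt (pi / s) * (a / 2 * (l / (1 + s) * (u ^ n * A + u ^ (n - 1) * B)))
       = (sqrt (pi / s) * l) * (a / 2 / (1 + s) * (u ^ n * A + u ^ (n - 1) * B))" by simp
    then show ?thesis unfolding l gen .
  qed
  have 2: "sqrt (pi / s) * (b / (2 * s) * (l * s / (1 + s) * (u ^ n * A - u ^ (n - 1) * B)))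
      = pi / (1 + s)\<^sup>2 * (b * (u ^ n * A - u ^ (n - 1) * B))"
  proof -
    have "sqrt (pi / s) * (b / (2 * s) * (l * s / (1 + s) * (u ^ n * A - u ^ (n - 1) * B)))
       = (sqrt (pi / s) * l) * (b / 2 / (1 + s) * (u ^ n * A - u ^ (n - 1) * B))" using s by simp
    then show ?thesis unfolding l gen .
  qed
  have "(\<integral>\<xi>. of_real (exp (- s * \<xi>\<^sup>2)) * inner_int n a b x s \<xi> \<partial>lborel)
    = of_real (sqrt (pi / s) * (a / 2 * (l / (1 + s) * (u ^ n * A + u ^ (n - 1) * B))))
      + \<i> * of_real (sqrt (pi / s) * (b / (2 * s) * (l * s / (1 + s) * (u ^ n * A - u ^ (n - 1) * B))))"
    unfolding inner_int_transform[OF s] mehler_linear_integral[OF s]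
      moments_closed_form[OF s, folded A_def B_def u_def l_def]
    by (simp add: distrib_left mult.left_commute[of _ \<i>])
  also have "\<dots> = of_real (pi / (1 + s)\<^sup>2) * (of_real (u ^ n) * upper_val + of_real (u ^ (n - 1)) * lower_val)"
    unfolding 1 2 upper_val_def lower_val_def A_def[symmetric] B_def[symmetric] Complex_eq
    by (simp add: algebra_simps)
  finally show ?thesis .
qed

definition wallis_integrand :: "nat \<Rightarrow> real \<Rightarrow> real" where
  "wallis_integrand p \<sigma> = indicator {0..1} \<sigma> * ((1 - \<sigma>\<^sup>2) ^ p / (1 + \<sigma>\<^sup>2) ^ Suc p)"

lemma wallis_integrand: "integrable lborel (wallis_integrand p)" "(\<integral>\<sigma>. wallis_integrand p \<sigma> \<partial>lborel) = wallis p"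
  unfolding wallis_integrand_def wallis_def
  by (intro integral_indicator_continuous continuous_intros; simp add: one_plus_square_nonzero)+

text \<open>Here the factor 1 - \<sigma>^2 of the profile takes effect: with s = \<sigma>^2 it turns
  (1 - s)^n / (1 + s)^(n+2) into the Wallis integrand of index n + 1, and likewise the lowered term
  into that of index n. For n = 0 the lowered term is 0.\<close>

lemma layer_value:
  assumes "\<sigma> \<noteq> 0"
  shows "(\<integral>\<xi>. layer \<sigma> \<xi> \<partial>lborel) = of_real pi * (of_real (wallis_integrand (Suc n) \<sigma>) * upper_val + of_real (wallis_integrand n \<sigma>) * lower_val)"
proof -
  define s where "s = \<sigma>\<^sup>2"
  have s: "s > 0" using assms by (simp add: s_def)
  define u where "u = (1 - s) / (1 + s)"
  have r: "1 + s \<noteq> 0" using s by simp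
  have j1: "cutoff \<sigma> * (pi / (1 + s)\<^sup>2) * u ^ n = pi * wallis_integrand (Suc n) \<sigma>"
    unfolding cutoff_def wallis_integrand_def s_def[symmetric] u_def by (simp add: power_divide power2_eq_square mult_ac)
  have j2: "of_real (cutoff \<sigma> * (pi / (1 + s)\<^sup>2) * u ^ (n - 1)) * lower_val = of_real (pi * wallis_integrand n \<sigma>) * lower_val"
  proof (cases n)
    case (Suc m)
    have "cutoff \<sigma> * (pi / (1 + s)\<^sup>2) * u ^ m = pi * wallis_integrand (Suc m) \<sigma>"
      unfolding cutoff_def wallis_integrand_def s_def[symmetric] u_def by (simp add: power_divide power2_eq_square mult_ac)
    then show ?thesis using Suc by simp
  qed (unfold lower_val_def, simp)
  have "(\<integral>\<xi>. layer \<sigma> \<xi> \<partial>lborel) = of_real (cutoff \<sigma>) * (\<integral>\<xi>. of_real (exp (- s * \<xi>\<^sup>2)) * inner_int n a b x s \<xi> \<partial>lborel)"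
    unfolding layer_def s_def[symmetric] of_real_mult mult.assoc by (rule integral_mult_right_zero)
  also have "\<dots> = of_real (cutoff \<sigma> * (pi / (1 + s)\<^sup>2) * u ^ n) * upper_val + of_real (cutoff \<sigma> * (pi / (1 + s)\<^sup>2) * u ^ (n - 1)) * lower_val"
    unfolding inner_int_value[OF s, folded u_def] by (simp only: distrib_left of_real_mult mult.assoc)
  also have "\<dots> = of_real pi * (of_real (wallis_integrand (Suc n) \<sigma>) * upper_val + of_real (wallis_integrand n \<sigma>) * lower_val)"
    unfolding j1 j2 by (simp only: distrib_left of_real_mult mult.assoc)
  finally show ?thesis .
qed

lemma weyl_outer_value:
  "(\<integral>\<xi>. (\<integral>y. weyl_integrand \<xi> y \<partial>lborel) \<partial>lborel) = of_real pi * (of_real (wallis (Suc n)) * upper_val + of_real (wallis n) * lower_val)"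
proof -
  have "(\<integral>\<sigma>. (\<integral>\<xi>. layer \<sigma> \<xi> \<partial>lborel) \<partial>lborel) = (\<integral>\<sigma>. of_real pi * (of_real (wallis_integrand (Suc n) \<sigma>) * upper_val + of_real (wallis_integrand n \<sigma>) * lower_val) \<partial>lborel)"
  proof (rule integral_cong_AE)
    have "integrable lborel (\<lambda>\<sigma>. \<integral>\<xi>. layer \<sigma> \<xi> \<partial>lborel)"
      using lborel_pair.integrable_fst[OF integrable_layer] by simp
    then show "(\<lambda>\<sigma>. \<integral>\<xi>. layer \<sigma> \<xi> \<partial>lborel) \<in> borel_measurable lborel" by auto
    show "AE \<sigma> in lborel. (\<integral>\<xi>. layer \<sigma> \<xi> \<partial>lborel) = of_real pi * (of_real (wallis_integrand (Suc n) \<sigma>) * upper_val + of_real (wallis_integrand n \<sigma>) * lower_val)"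
      \<comment> \<open>The value was computed for \<sigma> \<noteq> 0, where the kernel is regular;
        the excluded point is a null set.\<close>
      using AE_lborel_singleton[of 0] by eventually_elim (rule layer_value)
  qed (unfold wallis_integrand_def, measurable)
  also have "\<dots> = of_real pi * (of_real (wallis (Suc n)) * upper_val + of_real (wallis n) * lower_val)"
    using wallis_integrand by simp
  finally show ?thesis unfolding weyl_outer_swap .
qed

text \<open>The constants 1 / (2 \<pi>), \<pi> and the ladder factor sqrt (2 (n + 1)) combine to the
  square root in \<open>weight\<close>. For (a, b) on the unit circle the complex factors are the
  phases produced by rotating the symbol.\<close>

lemma weyl_hermite_c_value:
  "weyl (rot_symbol a b) (hermite_c n) x =
     Complex a b * of_real (weight n) * hermite_c (Suc n) x + (if n = 0 then 0 else Complex a (- b) * of_real (weight (n - 1)) * hermite_c (n - 1) x)"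
proof -
  have sq: "sqrt (2 * real (Suc m)) = 2 * sqrt (real (Suc m) / 2)" for m
  proof -
    have "sqrt (2 * real (Suc m)) = sqrt (2\<^sup>2 * (real (Suc m) / 2))" by simp
    also have "\<dots> = 2 * sqrt (real (Suc m) / 2)" unfolding real_sqrt_mult by simp
    finally show ?thesis .
  qed
  have "weyl (rot_symbol a b) (hermite_c n) x = of_real (1 / (2 * pi)) * (\<integral>\<xi>. (\<integral>y. weyl_integrand \<xi> y \<partial>lborel) \<partial>lborel)"
    unfolding weyl_def weyl_integrand_def cis_conv_exp ..
  also have "\<dots> = of_real (1 / 2 * wallis (Suc n)) * upper_val + of_real (1 / 2 * wallis n) * lower_val"
    unfolding weyl_outer_value by (simp add: field_simps)
  also have "of_real (1 / 2 * wallis (Suc n)) * upper_val = Complex a b * of_real (weight n) * hermite_c (Suc n) x"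
    unfolding upper_val_def weight_def hermite_c_def sq by simp
  also have "of_real (1 / 2 * wallis n) * lower_val = (if n = 0 then 0 else Complex a (- b) * of_real (weight (n - 1)) * hermite_c (n - 1) x)"
  proof (cases n)
    case (Suc m)
    then show ?thesis unfolding lower_val_def unfolding weight_def hermite_c_def Suc sq by simp
  qed (unfold lower_val_def, simp)
  finally show ?thesis .
qed

end

section \<open>The growing solution\<close>

lemma hermite_series_quotient:
  assumes "rapid c" "rapid d" "rapid e"
  shows "(hermite_series c x - hermite_series d x) / a - hermite_series e x = hermite_series (\<lambda>n. (c n - d n) / a - e n) x"
proof -
  have r: "rapid (\<lambda>n. inverse a * (c n - d n))" by (intro rapid_cmult rapid_diff assms)
  have "hermite_series (\<lambda>n. inverse a * (c n - d n) - e n) x = inverse a * (hermite_series c x - hermite_series d x) - hermite_series e x"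
    unfolding hermite_series_diff[OF r assms(3)] hermite_series_cmult[OF rapid_diff[OF assms(1,2)]] hermite_series_diff[OF assms(1,2)] ..
  then show ?thesis by (simp add: divide_inverse mult.commute)
qed

lemma rapid_quotient:
  assumes "rapid c" "rapid d" "rapid e" shows "rapid (\<lambda>n. (c n - d n) / a - e n)"
  using rapid_diff[OF rapid_cmult[OF rapid_diff[OF assms(1,2)], of "inverse a"] assms(3)]
  by (simp add: divide_inverse mult.commute)

text \<open>From \<open>\<kappa> m \<ge> 1 / 2\<close>. It reduces convergence in every dual norm to
  convergence in L2.\<close>

lemma L2norm_hermite_series_inv_\<kappa>:
  assumes c: "rapid c" shows "L2norm (hermite_series (\<lambda>m. of_real (inverse (\<kappa> m) ^ n) * c m)) \<le> 2 ^ n * L2norm (hermite_series c)"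
proof (rule power2_le_imp_le)
  have "(L2norm (hermite_series (\<lambda>m. of_real (inverse (\<kappa> m) ^ n) * c m)))\<^sup>2 = (\<Sum>m. (cmod (of_real (inverse (\<kappa> m) ^ n) * c m))\<^sup>2)"
    by (rule L2norm_hermite_series_sq[OF rapid_inv_\<kappa>_pow[OF c]])
  also have "\<dots> \<le> (\<Sum>m. (2 ^ n)\<^sup>2 * (cmod (c m))\<^sup>2)"
  proof (intro suminf_le summable_mult summable_norm_sq c rapid_inv_\<kappa>_pow)
    fix m
    have "inverse (\<kappa> m) ^ n \<le> 2 ^ n" using \<kappa>_pos[of m]
      by (intro power_mono) (auto simp: \<kappa>_def field_simps)
    then have "cmod (of_real (inverse (\<kappa> m) ^ n) * c m) \<le> 2 ^ n * cmod (c m)"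
      using \<kappa>_pos[of m] by (simp add: norm_mult norm_power norm_inverse mult_right_mono)
    then show "(cmod (of_real (inverse (\<kappa> m) ^ n) * c m))\<^sup>2 \<le> (2 ^ n)\<^sup>2 * (cmod (c m))\<^sup>2"
      unfolding power_mult_distrib[symmetric] by (intro power_mono) auto
  qed
  also have "\<dots> = (2 ^ n * L2norm (hermite_series c))\<^sup>2"
    unfolding suminf_mult[OF summable_norm_sq[OF c]] L2norm_hermite_series_sq[OF c, symmetric] power_mult_distrib ..
  finally show "(L2norm (hermite_series (\<lambda>m. of_real (inverse (\<kappa> m) ^ n) * c m)))\<^sup>2 \<le> (2 ^ n * L2norm (hermite_series c))\<^sup>2" .
qed (simp add: L2norm_nonneg)

section \<open>Regularity of the solution along the scale\<close>

context jacobi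
begin

lemma rapid_curves: "d \<in> curves \<Longrightarrow> rapid (d t)"
  by (rule rapid_curve_rapid[OF curves_rapid])

lemma curves_\<kappa>_pow: "d \<in> curves \<Longrightarrow> (\<lambda>t n. of_real (\<kappa> n ^ m) * d t n) \<in> curves"
proof (induction m)
  case (Suc m)
  then show ?case using curves.mult_\<kappa>[of "\<lambda>t n. of_real (\<kappa> n ^ m) * d t n"] by (simp add: mult.assoc)
qed simp

text \<open>An increment is h times the sum of the derivative and the error of the difference
  quotient, so continuity follows from differentiability.\<close>

lemma curves_increment:
  assumes d: "d \<in> curves"
  shows "((\<lambda>h. L2norm (hermite_series (\<lambda>n. d (t + h) n - d t n))) \<longlongrightarrow> 0) (at 0)"
proof -
  obtain d' where d': "d' \<in> curves" "\<And>t n. ((\<lambda>t. d t n) has_vector_derivative d' t n) (at t)"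
    using curves_deriv[OF d] by blast
  note q = curves_quotient[OF d d']
  define Q where "Q h = (\<lambda>n. (d (t + h) n - d t n) / of_real h - d' t n)" for h
  have le: "L2norm (hermite_series (\<lambda>n. d (t + h) n - d t n)) \<le> \<bar>h\<bar> * (L2norm (hermite_series (Q h)) + L2norm (hermite_series (d' t)))" if h: "h \<noteq> 0" for h
  proof -
    have r: "rapid (Q h)" "rapid (d' t)" unfolding Q_def by (rule q rapid_curves[OF d'(1)])+
    have "(\<lambda>n. d (t + h) n - d t n) = (\<lambda>n. of_real h * (Q h n + d' t n))"
      using h by (simp add: Q_def fun_eq_iff)
    then have "hermite_series (\<lambda>n. d (t + h) n - d t n) = (\<lambda>x. of_real h * (hermite_series (Q h) x + hermite_series (d' t) x))"
      by (simp only: hermite_series_cmult[OF rapid_add[OF r]] hermite_series_add[OF r] fun_eq_iff) simp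
    then have "L2norm (hermite_series (\<lambda>n. d (t + h) n - d t n)) = \<bar>h\<bar> * L2norm (\<lambda>x. hermite_series (Q h) x + hermite_series (d' t) x)"
      by (simp add: L2norm_cmult)
    also have "\<dots> \<le> \<bar>h\<bar> * (L2norm (hermite_series (Q h)) + L2norm (hermite_series (d' t)))"
      by (intro mult_left_mono L2norm_triangle hermite_series_L2 r) auto
    finally show ?thesis .
  qed
  show ?thesis
  proof (rule Lim_null_comparison)
    show "\<forall>\<^sub>F h in at 0. norm (L2norm (hermite_series (\<lambda>n. d (t + h) n - d t n))) \<le> \<bar>h\<bar> * (L2norm (hermite_series (Q h)) + L2norm (hermite_series (d' t)))"
      using le by (auto simp: eventually_at_filter L2norm_nonneg)
    have "((\<lambda>h. \<bar>h\<bar> * (L2norm (hermite_series (Q h)) + L2norm (hermite_series (d' t)))) \<longlongrightarrow> \<bar>0\<bar> * (0 + L2norm (hermite_series (d' t)))) (at 0)"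
      unfolding Q_def by (intro tendsto_intros q)
    then show "((\<lambda>h. \<bar>h\<bar> * (L2norm (hermite_series (Q h)) + L2norm (hermite_series (d' t)))) \<longlongrightarrow> 0) (at 0)" by simp
  qed
qed

text \<open>The norm of order m multiplies coefficients by \<open>\<kappa> n ^ m\<close>. Since
  \<open>curves\<close> is stable under this, every order reduces to the L2 statement for another
  curve.\<close>

lemma curve_deriv_Hs:
  assumes d: "d \<in> curves" and d': "d' \<in> curves" and deriv: "\<And>t n. ((\<lambda>t. d t n) has_vector_derivative d' t n) (at t)"
  shows "curve_deriv (Hs_norm m) (\<lambda>t. hermite_series (d t)) (hermite_series (d' t)) t"
proof -
  have k: "((\<lambda>t. of_real (\<kappa> n ^ m) * d t n) has_vector_derivative of_real (\<kappa> n ^ m) * d' t n) (at t)" for t n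
    by (intro has_vector_derivative_mult_right deriv)
  have "Hs_norm m (\<lambda>x. (hermite_series (d (t + h)) x - hermite_series (d t) x) / of_real h - hermite_series (d' t) x)
    = L2norm (hermite_series (\<lambda>n. (of_real (\<kappa> n ^ m) * d (t + h) n - of_real (\<kappa> n ^ m) * d t n) / of_real h - of_real (\<kappa> n ^ m) * d' t n))" for h
    unfolding hermite_series_quotient[OF rapid_curves[OF d] rapid_curves[OF d] rapid_curves[OF d']]
      Hs_norm_hermite_series[OF rapid_quotient[OF rapid_curves[OF d] rapid_curves[OF d] rapid_curves[OF d']]]
    by (simp add: right_diff_distrib)
  then show ?thesis
    unfolding curve_deriv_def using curves_quotient(1)[OF curves_\<kappa>_pow[OF d] curves_\<kappa>_pow[OF d'] k, where t = t] by simp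
qed

lemma curve_cont_Hs:
  assumes d: "d \<in> curves" shows "curve_cont (Hs_norm m) (\<lambda>t. hermite_series (d t)) t"
proof -
  have "Hs_norm m (\<lambda>x. hermite_series (d s) x - hermite_series (d t) x) = L2norm (hermite_series (\<lambda>n. of_real (\<kappa> n ^ m) * d s n - of_real (\<kappa> n ^ m) * d t n))" for s
    unfolding hermite_series_diff[OF rapid_curves[OF d] rapid_curves[OF d], symmetric]
      Hs_norm_hermite_series[OF rapid_diff[OF rapid_curves[OF d] rapid_curves[OF d]]]
    by (simp add: right_diff_distrib)
  then show ?thesis
    unfolding curve_cont_def using curves_increment[OF curves_\<kappa>_pow[OF d, of m], where t = t] 
    by (intro LIM_offset_zero_cancel[where a = t]) simp
qed

lemma Hneg_norm_tendsto:
  assumes e: "\<And>h. rapid (e h)" and u: "\<And>h f. f \<in> Hs m \<Longrightarrow> u h f = pairing (hermite_series (e h)) f"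
    and lim: "((\<lambda>h. L2norm (hermite_series (e h))) \<longlongrightarrow> 0) F"
  shows "((\<lambda>h. Hneg_norm m (u h)) \<longlongrightarrow> 0) F"
proof (rule tendsto_sandwich[OF always_eventually always_eventually tendsto_const])
  show "\<forall>h. 0 \<le> Hneg_norm m (u h)" using Hneg_norm_le(1)[OF e u] by blast
  show "\<forall>h. Hneg_norm m (u h) \<le> 2 ^ m * L2norm (hermite_series (e h))"
    using order_trans[OF Hneg_norm_le(2)[OF e u] L2norm_hermite_series_inv_\<kappa>[OF e]] by blast
  show "((\<lambda>h. 2 ^ m * L2norm (hermite_series (e h))) \<longlongrightarrow> 0) F" by (rule tendsto_mult_right_zero[OF lim])
qed

text \<open>On \<open>Hs m\<close> the error functional is the pairing with the error series, so the
  L2 estimate for difference quotients carries over to the dual norm.\<close>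

lemma curve_deriv_Hneg:
  assumes d: "d \<in> curves" and d': "d' \<in> curves" and deriv: "\<And>t n. ((\<lambda>t. d t n) has_vector_derivative d' t n) (at t)"
  shows "curve_deriv (Hneg_norm m) (\<lambda>t. pairing (hermite_series (d t))) (pairing (hermite_series (d' t))) t"
  unfolding curve_deriv_def
proof (rule Hneg_norm_tendsto[OF curves_quotient(2)[OF d d' deriv] _ curves_quotient(1)[OF d d' deriv]])
  fix h f assume f: "f \<in> Hs m"
  note r = rapid_curves[OF d] rapid_curves[OF d']
  have q: "hermite_series (\<lambda>n. (d (t + h) n - d t n) / of_real h - d' t n) = (\<lambda>x. inverse (of_real h) * (hermite_series (d (t + h)) x - hermite_series (d t) x) - hermite_series (d' t) x)"
    by (rule ext, unfold hermite_series_quotient[OF r(1) r(1) r(2), symmetric]) (simp add: divide_inverse mult.commute)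
  have "pairing (hermite_series (\<lambda>n. (d (t + h) n - d t n) / of_real h - d' t n)) f
    = pairing (\<lambda>x. inverse (of_real h) * (hermite_series (d (t + h)) x - hermite_series (d t) x) - hermite_series (d' t) x) f"
    unfolding q ..
  also have "\<dots> = inverse (of_real h) * (pairing (hermite_series (d (t + h))) f - pairing (hermite_series (d t)) f) - pairing (hermite_series (d' t)) f"
    using Hs_L2[OF f] by (simp add: pairing_diff pairing_cmult L2_diff L2_cmult hermite_series_L2 r)
  finally show "(pairing (hermite_series (d (t + h))) f - pairing (hermite_series (d t)) f) / of_real h - pairing (hermite_series (d' t)) f
    = pairing (hermite_series (\<lambda>n. (d (t + h) n - d t n) / of_real h - d' t n)) f"
    by (simp add: divide_inverse mult.commute)
qed

lemma curve_cont_Hneg: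
  assumes d: "d \<in> curves" shows "curve_cont (Hneg_norm m) (\<lambda>t. pairing (hermite_series (d t))) t"
proof -
  note r = rapid_curves[OF d]
  have "((\<lambda>h. Hneg_norm m (\<lambda>f. pairing (hermite_series (d (t + h))) f - pairing (hermite_series (d t)) f)) \<longlongrightarrow> 0) (at 0)"
  proof (rule Hneg_norm_tendsto[OF rapid_diff[OF r r] _ curves_increment[OF d]])
    fix h f assume f: "f \<in> Hs m"
    have "hermite_series (\<lambda>n. d (t + h) n - d t n) = (\<lambda>x. hermite_series (d (t + h)) x - hermite_series (d t) x)"
      by (intro ext hermite_series_diff r)
    then show "pairing (hermite_series (d (t + h))) f - pairing (hermite_series (d t)) f = pairing (hermite_series (\<lambda>n. d (t + h) n - d t n)) f"
      using Hs_L2[OF f] by (simp add: pairing_diff hermite_series_L2 r)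
  qed
  then show ?thesis unfolding curve_cont_def by (rule LIM_offset_zero_cancel)
qed

text \<open>A choice of derivative inside \<open>curves\<close>. Its iterates supply the sequence of
  derivatives required by \<open>Ck_curve\<close>, the same one for all spaces.\<close>

definition der :: "(real \<Rightarrow> nat \<Rightarrow> complex) \<Rightarrow> real \<Rightarrow> nat \<Rightarrow> complex" where
  "der d = (SOME d'. d' \<in> curves \<and> (\<forall>t n. ((\<lambda>t. d t n) has_vector_derivative d' t n) (at t)))"

lemma der: "d \<in> curves \<Longrightarrow> der d \<in> curves \<and> (\<forall>t n. ((\<lambda>t. d t n) has_vector_derivative der d t n) (at t))"
proof -
  assume "d \<in> curves"
  then have "\<exists>d'. d' \<in> curves \<and> (\<forall>t n. ((\<lambda>t. d t n) has_vector_derivative d' t n) (at t))"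
    using curves_deriv by blast
  then show ?thesis unfolding der_def by (rule someI_ex)
qed

lemma der_pow: "(der ^^ j) c \<in> curves"
  by (induction j) (auto simp: curves.base der)

text \<open>All iterated derivatives are Hermite series with rapid coefficients and lie in every
  space of the scale, so both branches are instances of statements for arbitrary m.\<close>

lemma smooth_solution: "smooth_in_scale r (\<lambda>t. hermite_series (c t))"
  unfolding smooth_in_scale_def
proof
  fix k
  have d: "((\<lambda>t. (der ^^ j) c t n) has_vector_derivative (der ^^ Suc j) c t n) (at t)" for j t n
    using der[OF der_pow[of j]] by simp
  have "Ck_curve k (Hs m) (Hs_norm m) (\<lambda>t. hermite_series (c t))" for m
    unfolding Ck_curve_def
  proof (intro exI[of _ "\<lambda>j t. hermite_series ((der ^^ j) c t)"] conjI allI impI)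
    fix j t
    show "hermite_series ((der ^^ j) c t) \<in> Hs m" by (intro hermite_series_Hs rapid_curves der_pow)
    show "curve_cont (Hs_norm m) (\<lambda>t. hermite_series ((der ^^ j) c t)) t" by (intro curve_cont_Hs der_pow)
    show "curve_deriv (Hs_norm m) (\<lambda>t. hermite_series ((der ^^ j) c t)) (hermite_series ((der ^^ Suc j) c t)) t"
      by (rule curve_deriv_Hs[OF der_pow der_pow d])
  qed simp
  moreover have "Ck_curve k (Hneg m) (Hneg_norm m) (\<lambda>t. pairing (hermite_series (c t)))" for m
    unfolding Ck_curve_def
  proof (intro exI[of _ "\<lambda>j t. pairing (hermite_series ((der ^^ j) c t))"] conjI allI impI)
    fix j t
    show "pairing (hermite_series ((der ^^ j) c t)) \<in> Hneg m" by (intro pairing_hermite_series_Hneg rapid_curves der_pow)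
    show "curve_cont (Hneg_norm m) (\<lambda>t. pairing (hermite_series ((der ^^ j) c t))) t" by (intro curve_cont_Hneg der_pow)
    show "curve_deriv (Hneg_norm m) (\<lambda>t. pairing (hermite_series ((der ^^ j) c t))) (pairing (hermite_series ((der ^^ Suc j) c t))) t"
      by (rule curve_deriv_Hneg[OF der_pow der_pow d])
  qed simp
  ultimately show "if k \<le> r then Ck_curve k (Hs (r - k)) (Hs_norm (r - k)) (\<lambda>t. hermite_series (c t))
     else Ck_curve k (Hneg (k - r)) (Hneg_norm (k - r)) (\<lambda>t. pairing (hermite_series (c t)))" by simp
qed

end

section \<open>The concrete potential and its action on Hermite series\<close>

definition ladder :: "real \<Rightarrow> (nat \<Rightarrow> complex) \<Rightarrow> nat \<Rightarrow> complex" where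
  "ladder t d n = cis (- t) * jacobi.up weight d n + cis t * jacobi.dn weight d n"

interpretation W: jacobi weight "sqrt (wallis 1 * wallis 0)" by (rule weight_jacobi)

definition potential :: "real \<Rightarrow> real \<Rightarrow> real \<Rightarrow> real" where
  "potential t = rot_symbol (cos t) (- sin t)"

lemma ladder_norm: "cmod (ladder t d n) \<le> sqrt (wallis 1 * wallis 0) * (case n of 0 \<Rightarrow> 0 | Suc m \<Rightarrow> cmod (d m)) + sqrt (wallis 1 * wallis 0) * cmod (d (Suc n))"
proof -
  have "cmod (ladder t d n) \<le> cmod (W.up d n) + cmod (W.dn d n)"
    unfolding ladder_def by (rule order_trans[OF norm_triangle_ineq]) (simp add: norm_mult)
  moreover have "cmod (W.up d n) \<le> sqrt (wallis 1 * wallis 0) * (case n of 0 \<Rightarrow> 0 | Suc m \<Rightarrow> cmod (d m))"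
    by (cases n) (use W.up_norm in auto)
  ultimately show ?thesis using W.dn_norm[of d n] by linarith
qed

lemma rapid_ladder: assumes d: "rapid d" shows "rapid (ladder t d)"
proof -
  have "rapid_curve (\<lambda>_. d)" using d unfolding rapid_curve_def rapid_def by blast
  from rapid_add[OF rapid_curve_rapid[OF W.rapid_curve_up[OF this]] rapid_curve_rapid[OF W.rapid_curve_dn[OF this]], of t t]
  show ?thesis by (simp add: ladder_def[abs_def])
qed

lemma ladder_diff: "ladder t (\<lambda>n. c n - d n) n = ladder t c n - ladder t d n"
  unfolding ladder_def W.up_def W.dn_def by (cases n) (simp_all add: algebra_simps)

text \<open>Linearity of the iterated integral rests on the integrability of both the inner and the
  outer integrand for each Hermite function. The sum is then built up one coefficient at a
  time.\<close>

lemma weyl_hermite_sum: "weyl (potential t) (hermite_sum N c) = hermite_series (ladder t (\<lambda>n. if n < N then c n else 0))"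
proof -
  define g where "g x \<xi> m = (\<integral>y. weyl_integrand m (cos t) (- sin t) x \<xi> y \<partial>lborel)" for x \<xi> m
  have w: "weyl (potential t) (hermite_sum N c) x = (\<Sum>m<N. c m * weyl (potential t) (hermite_c m) x)" for x
  proof -
    have e: "cis ((x - y) * \<xi>) * of_real (potential t ((x + y) / 2) \<xi>) * hermite_sum N c y
      = (\<Sum>m<N. c m * weyl_integrand m (cos t) (- sin t) x \<xi> y)" for \<xi> y
      unfolding hermite_sum_def weyl_integrand_def potential_def sum_distrib_left by (intro sum.cong) (auto simp: mult_ac)
    have "weyl (potential t) (hermite_sum N c) x = of_real (1 / (2 * pi)) * (\<integral>\<xi>. (\<integral>y. (\<Sum>m<N. c m * weyl_integrand m (cos t) (- sin t) x \<xi> y) \<partial>lborel) \<partial>lborel)"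
      unfolding weyl_def cis_conv_exp[symmetric] e ..
    also have "\<dots> = of_real (1 / (2 * pi)) * (\<integral>\<xi>. (\<Sum>m<N. c m * g x \<xi> m) \<partial>lborel)"
      unfolding g_def using integrable_weyl_integrand by (subst Bochner_Integration.integral_sum) auto
    also have "\<dots> = of_real (1 / (2 * pi)) * (\<Sum>m<N. c m * (\<integral>\<xi>. g x \<xi> m \<partial>lborel))"
      unfolding g_def using integrable_weyl_outer by (subst Bochner_Integration.integral_sum) auto
    also have "\<dots> = (\<Sum>m<N. c m * weyl (potential t) (hermite_c m) x)"
      unfolding sum_distrib_left g_def weyl_def cis_conv_exp[symmetric] potential_def weyl_integrand_def
      by (intro sum.cong) (auto simp: mult_ac)
    finally show ?thesis .
  qed
  have h: "weyl (potential t) (hermite_c m) x = cis (- t) * of_real (weight m) * hermite_c (Suc m) x + (if m = 0 then 0 else cis t * of_real (weight (m - 1)) * hermite_c (m - 1) x)" for m x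
  proof -
    have "Complex (cos t) (- sin t) = cis (- t)" "Complex (cos t) (- (- sin t)) = cis t"
      by (simp_all add: complex_eq_iff)
    then show ?thesis unfolding potential_def weyl_hermite_c_value by (simp only:)
  qed
  have "(\<Sum>m<N. c m * weyl (potential t) (hermite_c m) x) = hermite_series (ladder t (\<lambda>n. if n < N then c n else 0)) x" for x
  proof (induction N)
    case 0
    have "ladder t (\<lambda>n. if n < 0 then c n else 0) = (\<lambda>_. 0)"
      by (auto simp: ladder_def W.up_def W.dn_def fun_eq_iff split: nat.split)
    then show ?case by (simp add: hermite_series_def)
  next
    case (Suc N)
    let ?c = "\<lambda>n. if n < N then c n else 0" and ?e = "\<lambda>n. if n = N then c N else 0"
    have r: "rapid ?c" "rapid ?e" by (rule rapid_finite[of "Suc N"]; simp)+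
    have "ladder t (\<lambda>n. if n < Suc N then c n else 0) = (\<lambda>n. ladder t ?c n + ladder t ?e n)"
      unfolding fun_eq_iff ladder_def W.up_def W.dn_def by (auto simp: algebra_simps less_Suc_eq split: nat.split)
    then have "hermite_series (ladder t (\<lambda>n. if n < Suc N then c n else 0)) x = hermite_series (ladder t ?c) x + hermite_series (ladder t ?e) x"
      by (simp add: hermite_series_add[OF rapid_ladder[OF r(1)] rapid_ladder[OF r(2)]])
    also have "hermite_series (ladder t ?e) x = hermite_sum (Suc (Suc N)) (ladder t ?e) x"
      by (subst hermite_series_finite[of "Suc (Suc N)"]) (auto simp: ladder_def W.up_def W.dn_def split: nat.split)
    also have "\<dots> = c N * weyl (potential t) (hermite_c N) x"
    proof (cases N)
      case 0
      then show ?thesis unfolding h hermite_sum_def by (simp add: ladder_def W.up_def W.dn_def algebra_simps)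
    next
      case (Suc m)
      have "(\<Sum>n<m. ladder t ?e n * hermite_c n x) = 0"
        by (intro sum.neutral) (auto simp: ladder_def W.up_def W.dn_def Suc split: nat.split)
      moreover have "ladder t ?e m = cis t * of_real (weight m) * c N"
        by (cases m) (simp_all add: ladder_def W.up_def W.dn_def Suc)
      moreover have "ladder t ?e (Suc m) = 0" "ladder t ?e (Suc (Suc m)) = cis (- t) * of_real (weight (Suc m)) * c N"
        by (simp_all add: ladder_def W.up_def W.dn_def Suc)
      ultimately show ?thesis unfolding h hermite_sum_def Suc by (simp add: algebra_simps)
    qed
    finally show ?case using Suc by simp
  qed
  then show ?thesis using w by (simp add: fun_eq_iff)
qed

text \<open>Partial sums serve as the approximating Schwartz functions. \<open>ladder\<close> shifts
  the index by one in either direction with bounded weights, so the sum of the moduli of the error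
  coefficients is at most twice the weight bound times the tail of \<open>c\<close>.\<close>

lemma L2_closure_hermite_series:
  assumes c: "rapid c" shows "L2_closure (weyl (potential t)) (hermite_series c) (hermite_series (ladder t c))"
  unfolding L2_closure_def
proof (intro conjI exI[of _ "\<lambda>N. hermite_sum N c"] allI)
  let ?T = "\<lambda>N n. if n < N then c n else 0"
  have rT: "rapid (?T N)" for N by (rule rapid_finite[of N]) simp
  show "hermite_series c \<in> L2" "hermite_series (ladder t c) \<in> L2" by (intro hermite_series_L2 c rapid_ladder)+
  show "hermite_sum N c \<in> schwartz" "weyl (potential t) (hermite_sum N c) \<in> L2" for N
    unfolding weyl_hermite_sum by (intro hermite_sum_schwartz hermite_series_L2 rapid_ladder rT)+
  have "L2norm (\<lambda>x. hermite_sum N c x - hermite_series c x) = L2norm (\<lambda>x. hermite_series c x - hermite_sum N c x)" for N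
    unfolding L2norm_def by (simp add: norm_minus_commute)
  then show "(\<lambda>N. L2norm (\<lambda>x. hermite_sum N c x - hermite_series c x)) \<longlonglongrightarrow> 0"
    using hermite_sum_L2norm_tendsto[OF c] by simp
  let ?W = "sqrt (wallis 1 * wallis 0)"
  let ?f = "\<lambda>n. cmod (c n)"
  have W0: "?W \<ge> 0" by (rule W.W_nonneg)
  have le: "L2norm (\<lambda>x. weyl (potential t) (hermite_sum N c) x - hermite_series (ladder t c) x) \<le> 2 * ?W * (suminf ?f - sum ?f {..<N})" for N
  proof -
    define e where "e n = ?T N n - c n" for n
    have re: "rapid e" unfolding e_def[abs_def] by (intro rapid_diff rT c)
    have ne: "cmod (e n) = (if n < N then 0 else ?f n)" for n by (simp add: e_def)
    have se: "summable (\<lambda>n. cmod (e n))" by (rule rapid_summable_norm[OF re])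
    have sS: "summable (\<lambda>n. cmod (e (Suc n)))" using se by (subst summable_Suc_iff)
    have "(\<lambda>x. weyl (potential t) (hermite_sum N c) x - hermite_series (ladder t c) x) = hermite_series (ladder t e)"
      unfolding weyl_hermite_sum e_def[abs_def] ladder_diff[abs_def]
      by (simp add: hermite_series_diff[OF rapid_ladder[OF rT] rapid_ladder[OF c]] fun_eq_iff)
    then have "L2norm (\<lambda>x. weyl (potential t) (hermite_sum N c) x - hermite_series (ladder t c) x) \<le> (\<Sum>n. cmod (ladder t e n))"
      using L2norm_hermite_series_le[OF rapid_ladder[OF re]] by simp
    also have "\<dots> \<le> (\<Sum>n. ?W * (case n of 0 \<Rightarrow> 0 | Suc m \<Rightarrow> cmod (e m)) + ?W * cmod (e (Suc n)))"
      by (intro suminf_le ladder_norm rapid_summable_norm rapid_ladder re summable_add summable_mult suminf_shift(1) se sS)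
    also have "\<dots> = ?W * (\<Sum>n. cmod (e n)) + ?W * (\<Sum>n. cmod (e (Suc n)))"
      unfolding suminf_add[OF summable_mult[OF suminf_shift(1)[OF se]] summable_mult[OF sS], symmetric]
        suminf_mult[OF suminf_shift(1)[OF se]] suminf_mult[OF sS] suminf_shift(2)[OF se] ..
    also have "\<dots> \<le> ?W * (\<Sum>n. cmod (e n)) + ?W * (\<Sum>n. cmod (e n))"
      using W0 suminf_split_head[OF se] by (intro add_left_mono mult_left_mono) auto
    also have "(\<Sum>n. cmod (e n)) = suminf ?f - sum ?f {..<N}"
      unfolding ne by (rule suminf_tail[OF rapid_summable_norm[OF c]])
    finally show ?thesis by simp
  qed
  have "(\<lambda>N. 2 * ?W * (suminf ?f - sum ?f {..<N})) \<longlonglongrightarrow> 2 * ?W * (suminf ?f - suminf ?f)"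
    by (intro tendsto_intros summable_LIMSEQ rapid_summable_norm c)
  then have lim: "(\<lambda>N. 2 * ?W * (suminf ?f - sum ?f {..<N})) \<longlonglongrightarrow> 0" by simp
  show "(\<lambda>N. L2norm (\<lambda>x. weyl (potential t) (hermite_sum N c) x - hermite_series (ladder t c) x)) \<longlonglongrightarrow> 0"
    by (rule tendsto_sandwich[OF always_eventually always_eventually tendsto_const lim])
      (intro allI L2norm_nonneg le)+
qed

text \<open>The equation is an identity between coefficients and holds at every point for the
  series. It becomes an almost everywhere statement only through the representative picked by
  \<open>K0\<close>.\<close>

lemma solves_hermite_series: "solves r (\<lambda>t. weyl (potential t)) (\<lambda>t. hermite_series (W.c t))"
  unfolding solves_def
proof (intro allI conjI exI)
  fix t
  define d where "d t n = - \<i> * W.Mc t (W.c t) n" for t n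
  have d: "d \<in> W.curves" unfolding d_def[abs_def] by (rule W.Mc_curves[OF W.curves.base])
  note c = W.rapid_c
  show "hermite_series (W.c t) \<in> Hs r" by (rule hermite_series_Hs[OF c])
  show "hermite_series (d t) \<in> Hs (r - 1)" by (rule hermite_series_Hs[OF W.rapid_curves[OF d]])
  show "curve_deriv (Hs_norm (r - 1)) (\<lambda>t. hermite_series (W.c t)) (hermite_series (d t)) t"
    by (rule W.curve_deriv_Hs[OF W.curves.base d]) (unfold d_def, rule W.c_deriv)
  show "L2_closure (weyl (potential t)) (hermite_series (W.c t)) (hermite_series (ladder t (W.c t)))" by (rule L2_closure_hermite_series[OF c])
  have "\<i> * hermite_series (d t) x = hermite_series (\<lambda>n. of_real (\<kappa> n) * W.c t n) x + hermite_series (ladder t (W.c t)) x" for x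
  proof -
    have "\<i> * hermite_series (d t) x = hermite_series (\<lambda>n. \<i> * d t n) x" by (rule hermite_series_cmult[OF W.rapid_curves[OF d], symmetric])
    also have "(\<lambda>n. \<i> * d t n) = (\<lambda>n. of_real (\<kappa> n) * W.c t n + ladder t (W.c t) n)"
      by (simp add: d_def W.Mc_def ladder_def fun_eq_iff mult.assoc[symmetric])
    also have "hermite_series \<dots> x = hermite_series (\<lambda>n. of_real (\<kappa> n) * W.c t n) x + hermite_series (ladder t (W.c t)) x"
      by (rule hermite_series_add[OF rapid_\<kappa>[OF c] rapid_ladder[OF c]])
    finally show ?thesis .
  qed
  moreover have "AE x in lborel. K0 (hermite_series (W.c t)) x = hermite_series (\<lambda>n. of_real (\<kappa> n) * W.c t n) x"
    using K0_AE_hermite_series(2)[OF c hermite_series_L2[OF c]] by simp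
  ultimately show "AE x in lborel. \<i> * hermite_series (d t) x = K0 (hermite_series (W.c t)) x + hermite_series (ladder t (W.c t)) x"
    by auto
qed

theorem theorem3p4:
  shows "\<exists>V :: real \<Rightarrow> (real \<Rightarrow> complex) \<Rightarrow> real \<Rightarrow> complex.
           Cb_smooth_A 0 V \<and>
           (\<forall>r::nat. r \<ge> 1 \<longrightarrow>
              (\<exists>C>0. \<exists>\<psi> :: real \<Rightarrow> real \<Rightarrow> complex.
                 smooth_in_scale r \<psi> \<and>
                 solves r V \<psi> \<and>
                 (\<forall>t\<ge>0. \<psi> t \<in> Hs r) \<and>
                 (\<forall>\<^sub>F t in at_top. Hs_norm r (\<psi> t) \<ge> C * t ^ r)))"
proof (intro exI[of _ "\<lambda>t. weyl (potential t)"] conjI allI impI)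
  show "Cb_smooth_A 0 (\<lambda>t. weyl (potential t))"
    unfolding potential_def by (rule Cb_smooth_rot_symbol)
  fix r :: nat
  show "\<exists>C>0. \<exists>\<psi>. smooth_in_scale r \<psi> \<and> solves r (\<lambda>t. weyl (potential t)) \<psi> \<and> (\<forall>t\<ge>0. \<psi> t \<in> Hs r) \<and>
      (\<forall>\<^sub>F t in at_top. Hs_norm r (\<psi> t) \<ge> C * t ^ r)"
  \<comment> \<open>One solution serves all orders; only the constant depends on r.\<close>
  proof (intro exI[of _ "weight 0 ^ r"] conjI exI[of _ "\<lambda>t. hermite_series (W.c t)"])
    show "weight 0 ^ r > 0" using W.w0 by simp
    show "\<forall>\<^sub>F t in at_top. Hs_norm r (hermite_series (W.c t)) \<ge> weight 0 ^ r * t ^ r"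
      using eventually_gt_at_top[of 0] by eventually_elim (rule W.sobolev_growth)
  qed (auto intro: W.smooth_solution solves_hermite_series hermite_series_Hs W.rapid_c)
qed

end
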